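(* Let $G$ be a sofic group and let $\Sigma=(\sigma_n:G\to\mathrm{Sym}(D_n))$ be a sofic approximation to $G$. Let $H$ be a profinite group with Haar probability measure $\lambda_H$, and let $G$ act on $H$ by continuous group automorphisms. If the homoclinic group of $H$ is dense in $H$, then $$h^\Sigma_{\mathrm{meas}}(G\curvearrowright H,\lambda_H)=h^\Sigma_{\mathrm{top}}(G\curvearrowright H).$$
   Context: Profinite: here a profinite group is a topological group isomorphic to the inverse limit of a sequence of finite discrete groups (in particular it is compact and metrizable). Homoclinic group: a point $h\in H$ is homoclinic if $g_n\cdot h\to1_H$ for every injective sequence $(g_n)$ of elements of $G$; the homoclinic points form a subgroup of $H$, the homoclinic group. Sofic approximation: A sofic approximation to a countable group $G$ is a sequence $\Sigma=(\sigma_n:G\to\mathrm{Sym}(D_n))$ of maps (not necessarily homomorphisms), $D_n$ finite sets with $|D_n|\to\infty$, $\sigma_n(1_G)=\mathrm{id}$, such that $|\{i\in D_n:\sigma_n(g)(i)\ne i\}|/|D_n|\to1$ for all $g\ne1_G$, and $|\{i\in D_n:\sigma_n(g)\circ\sigma_n(h)(i)=\sigma_n(gh)(i)\}|/|D_n|\to1$ for all $g,h\in G$. $G$ is sofic if it admits one. Topological sofic entropy: Let $G\curvearrowright X$ be a continuous action on a compact metrizable space. Let $\rho$ be a continuous pseudo-metric on $X$ that is generating (for $x\ne y$ there is $g\in G$ with $\rho(g\cdot x,g\cdot y)>0$). For $\phi,\phi':D_n\to X$ let $\rho_2(\phi,\phi')=\bigl(\frac1{|D_n|}\sum_{i}\rho(\phi(i),\phi'(i))^2\bigr)^{1/2}$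 and $\rho_\infty(\phi,\phi')=\max_i\rho(\phi(i),\phi'(i))$. For finite $F\subseteq G$, $\delta>0$ let $\mathrm{Map}(\rho,F,\delta,\sigma_n)=\{\phi:D_n\to X:\rho_2(\phi\circ\sigma_n(f),f\cdot\phi)<\delta\ \forall f\in F\}$, and let $N_\kappa(\cdot,\rho_\infty)$ be the maximum cardinality of a subset whose distinct elements satisfy $\rho_\infty(\phi,\phi')\ge\kappa$. Then $$h^\Sigma_{\mathrm{top}}(G\curvearrowright X)=\sup_{\kappa>0}\inf_{\delta>0}\inf_{F}\limsup_{n\to\infty}\frac1{|D_n|}\log N_\kappa(\mathrm{Map}(\rho,F,\delta,\sigma_n),\rho_\infty)$$ ($F$ ranging over finite subsets of $G$, $\log 0=-\infty$); this is independent of $\rho$. Measured sofic entropy: Let $G\curvearrowright(X,\mu)$ be a probability-measure-preserving action on a standard probability space. For a Borel $\alpha:X\to A$ with $A$ finite, $F\subseteq G$ finite, $\epsilon>0$, let $\mathcal{M}_\mu(\alpha,F,\epsilon,\sigma_n)$ be the set of $a\in A^{D_n}$ such that for every $p\in A^F$, $\bigl|\mu(\{x:\alpha(f\cdot x)=p(f)\ \forall f\in F\})-\frac1{|D_n|}|\{i\in D_n:a(\sigma_n(f)(i))=p(f)\ \forall f\in F\}|\bigr|\le\epsilon$. For finite-valued Borel $\alpha:X\to A$, $\beta:X\to B$ write $\alpha\ge\beta$ if $\beta=\beta_\alpha\circ\alpha$ for some $\beta_\alpha:A\to B$. Then $$h^\Sigma_{\mathrm{meas}}(G\curvearrowright X,\mu)=\sup_\beta\inf_{\alpha\ge\beta}\inf_{\epsilon>0}\inf_{F}\limsup_{n\to\infty}\frac1{|D_n|}\log\bigl|\{\beta_\alpha\circ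 a:a\in\mathcal{M}_\mu(\alpha,F,\epsilon,\sigma_n)\}\bigr|,$$ with $\alpha,\beta$ ranging over finite-valued Borel functions on $X$. *)

theory Defs
  imports "HOL-Probability.Probability" "HOL-Algebra.Algebra"
begin

definition topological_group :: "('h, 'b) monoid_scheme \<Rightarrow> 'h topology \<Rightarrow> bool" where
  "topological_group H T \<longleftrightarrow>
     group H \<and> topspace T = carrier H \<and>
     continuous_map (prod_topology T T) T (\<lambda>(x, y). x \<otimes>\<^bsub>H\<^esub> y) \<and>
     continuous_map T T (\<lambda>x. inv\<^bsub>H\<^esub> x)"

definition inverse_limit_group ::
  "(nat \<Rightarrow> 'k monoid) \<Rightarrow> (nat \<Rightarrow> 'k \<Rightarrow> 'k) \<Rightarrow> (nat \<Rightarrow> 'k) monoid" where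
  "inverse_limit_group K \<pi> =
     (product_group UNIV K)
       \<lparr>carrier := {x \<in> carrier (product_group UNIV K). \<forall>n. \<pi> n (x (Suc n)) = x n}\<rparr>"

definition inverse_limit_topology ::
  "(nat \<Rightarrow> 'k monoid) \<Rightarrow> (nat \<Rightarrow> 'k \<Rightarrow> 'k) \<Rightarrow> (nat \<Rightarrow> 'k) topology" where
  "inverse_limit_topology K \<pi> =
     subtopology (product_topology (\<lambda>n. discrete_topology (carrier (K n))) UNIV)
       (carrier (inverse_limit_group K \<pi>))"

text \<open>Taking the finite groups \<open>K n\<close> on sets of natural numbers is no loss of generality, since
  every finite group is isomorphic to such a group.\<close>

definition profinite_group :: "('h, 'b) monoid_scheme \<Rightarrow> 'h topology \<Rightarrow> bool" where
  "profinite_group H T \<longleftrightarrow>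
     topological_group H T \<and>
     (\<exists>(K :: nat \<Rightarrow> nat monoid) \<pi> f.
        (\<forall>n. group (K n) \<and> finite (carrier (K n))) \<and>
        (\<forall>n. \<pi> n \<in> hom (K (Suc n)) (K n)) \<and>
        f \<in> iso H (inverse_limit_group K \<pi>) \<and>
        homeomorphic_map T (inverse_limit_topology K \<pi>) f)"

text \<open>A left-invariant Borel probability measure; on a compact metrizable group there is
  exactly one, and it is automatically regular and bi-invariant.\<close>

definition haar_prob_measure ::
  "('h, 'b) monoid_scheme \<Rightarrow> 'h topology \<Rightarrow> 'h measure \<Rightarrow> bool" where
  "haar_prob_measure H T \<mu> \<longleftrightarrow>
     prob_space \<mu> \<and> sets \<mu> = sets (sigma (topspace T) {U. openin T U}) \<and>
     (\<forall>h\<in>carrier H. \<forall>A\<in>sets \<mu>. emeasure \<mu> (h <#\<^bsub>H\<^esub> A) = emeasure \<mu> A)"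

definition acts_by_continuous_automorphisms ::
  "('g, 'a) monoid_scheme \<Rightarrow> ('h, 'b) monoid_scheme \<Rightarrow> 'h topology \<Rightarrow> ('g \<Rightarrow> 'h \<Rightarrow> 'h) \<Rightarrow> bool"
where
  "acts_by_continuous_automorphisms G H T act \<longleftrightarrow>
     group_action G (carrier H) act \<and>
     (\<forall>g\<in>carrier G. act g \<in> hom H H \<and> continuous_map T T (act g))"

definition homoclinic_group ::
  "('g, 'a) monoid_scheme \<Rightarrow> ('h, 'b) monoid_scheme \<Rightarrow> 'h topology \<Rightarrow> ('g \<Rightarrow> 'h \<Rightarrow> 'h) \<Rightarrow> 'h set"
where
  "homoclinic_group G H T act =
     {h \<in> carrier H. \<forall>g :: nat \<Rightarrow> 'g. inj g \<and> range g \<subseteq> carrier G \<longrightarrow>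
        limitin T (\<lambda>n. act (g n) h) \<one>\<^bsub>H\<^esub> sequentially}"

definition sofic_approximation ::
  "('g, 'a) monoid_scheme \<Rightarrow> (nat \<Rightarrow> 'd set) \<Rightarrow> (nat \<Rightarrow> 'g \<Rightarrow> 'd \<Rightarrow> 'd) \<Rightarrow> bool"
where
  "sofic_approximation G D \<sigma> \<longleftrightarrow>
     (\<forall>n. finite (D n)) \<and>
     filterlim (\<lambda>n. card (D n)) at_top sequentially \<and>
     (\<forall>n. \<forall>g\<in>carrier G. \<sigma> n g permutes D n) \<and>
     (\<forall>n. \<sigma> n \<one>\<^bsub>G\<^esub> = id) \<and>
     (\<forall>g\<in>carrier G. g \<noteq> \<one>\<^bsub>G\<^esub> \<longrightarrow>
        (\<lambda>n. card {i \<in> D n. \<sigma> n g i \<noteq> i} / card (D n)) \<longlonglongrightarrow> 1) \<and>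
     (\<forall>g\<in>carrier G. \<forall>h\<in>carrier G.
        (\<lambda>n. card {i \<in> D n. \<sigma> n g (\<sigma> n h i) = \<sigma> n (g \<otimes>\<^bsub>G\<^esub> h) i} / card (D n)) \<longlonglongrightarrow> 1)"

text \<open>The logarithm of a cardinality, with \<open>log 0 = -\<infinity>\<close>.\<close>

definition log_count :: "enat \<Rightarrow> ereal" where
  "log_count N =
     (case N of enat k \<Rightarrow> if k = 0 then -\<infinity> else ereal (ln (real k)) | \<infinity> \<Rightarrow> \<infinity>)"

definition finite_subsets :: "'a set \<Rightarrow> 'a set set" where
  "finite_subsets A = {F. finite F \<and> F \<subseteq> A}"

definition continuous_pseudometric :: "'x topology \<Rightarrow> ('x \<Rightarrow> 'x \<Rightarrow> real) \<Rightarrow> bool" where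
  "continuous_pseudometric T \<rho> \<longleftrightarrow>
     (\<forall>x\<in>topspace T. \<forall>y\<in>topspace T. 0 \<le> \<rho> x y \<and> \<rho> x x = 0 \<and> \<rho> x y = \<rho> y x) \<and>
     (\<forall>x\<in>topspace T. \<forall>y\<in>topspace T. \<forall>z\<in>topspace T. \<rho> x z \<le> \<rho> x y + \<rho> y z) \<and>
     continuous_map (prod_topology T T) euclideanreal (\<lambda>(x, y). \<rho> x y)"

definition generating_pseudometric ::
  "('g, 'a) monoid_scheme \<Rightarrow> 'x topology \<Rightarrow> ('g \<Rightarrow> 'x \<Rightarrow> 'x) \<Rightarrow> ('x \<Rightarrow> 'x \<Rightarrow> real) \<Rightarrow> bool" where
  "generating_pseudometric G T act \<rho> \<longleftrightarrow>
     (\<forall>x\<in>topspace T. \<forall>y\<in>topspace T. x \<noteq> y \<longrightarrow> (\<exists>g\<in>carrier G. 0 < \<rho> (act g x) (act g y)))"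

definition rho_2 ::
  "('x \<Rightarrow> 'x \<Rightarrow> real) \<Rightarrow> 'd set \<Rightarrow> ('d \<Rightarrow> 'x) \<Rightarrow> ('d \<Rightarrow> 'x) \<Rightarrow> real" where
  "rho_2 \<rho> D \<phi> \<psi> = sqrt ((\<Sum>i\<in>D. (\<rho> (\<phi> i) (\<psi> i))\<^sup>2) / card D)"

definition rho_inf ::
  "('x \<Rightarrow> 'x \<Rightarrow> real) \<Rightarrow> 'd set \<Rightarrow> ('d \<Rightarrow> 'x) \<Rightarrow> ('d \<Rightarrow> 'x) \<Rightarrow> real" where
  "rho_inf \<rho> D \<phi> \<psi> = Max ((\<lambda>i. \<rho> (\<phi> i) (\<psi> i)) ` D)"

text \<open>In \<open>sofic_Map\<close> and \<open>microstates\<close>, \<open>D\<close> and \<open>\<sigma>\<close> are a single term of the sofic approximation.\<close>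

definition sofic_Map ::
  "'x topology \<Rightarrow> ('g \<Rightarrow> 'x \<Rightarrow> 'x) \<Rightarrow> ('x \<Rightarrow> 'x \<Rightarrow> real) \<Rightarrow> 'g set \<Rightarrow> real \<Rightarrow>
     'd set \<Rightarrow> ('g \<Rightarrow> 'd \<Rightarrow> 'd) \<Rightarrow> ('d \<Rightarrow> 'x) set" where
  "sofic_Map T act \<rho> F \<delta> D \<sigma> =
     {\<phi> \<in> D \<rightarrow>\<^sub>E topspace T. \<forall>f\<in>F. rho_2 \<rho> D (\<lambda>i. \<phi> (\<sigma> f i)) (\<lambda>i. act f (\<phi> i)) < \<delta>}"

definition separation_number :: "('y \<Rightarrow> 'y \<Rightarrow> real) \<Rightarrow> real \<Rightarrow> 'y set \<Rightarrow> enat" where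
  "separation_number d \<kappa> M =
     Sup {enat (card S) | S. finite S \<and> S \<subseteq> M \<and> pairwise (\<lambda>\<phi> \<psi>. \<kappa> \<le> d \<phi> \<psi>) S}"

definition topological_sofic_entropy ::
  "('g, 'a) monoid_scheme \<Rightarrow> 'x topology \<Rightarrow> ('g \<Rightarrow> 'x \<Rightarrow> 'x) \<Rightarrow> ('x \<Rightarrow> 'x \<Rightarrow> real) \<Rightarrow>
     (nat \<Rightarrow> 'd set) \<Rightarrow> (nat \<Rightarrow> 'g \<Rightarrow> 'd \<Rightarrow> 'd) \<Rightarrow> ereal" where
  "topological_sofic_entropy G T act \<rho> D \<sigma> =
     (SUP \<kappa>\<in>{0<..}. INF \<delta>\<in>{0<..}. INF F\<in>finite_subsets (carrier G).
        limsup (\<lambda>n. log_count (separation_number (rho_inf \<rho> (D n)) \<kappa>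
                                 (sofic_Map T act \<rho> F \<delta> (D n) (\<sigma> n)))
                    / ereal (card (D n))))"

text \<open>A finite-valued observable is recorded together with its finite codomain, encoded as a set
  of natural numbers.\<close>

definition finite_observables :: "'x measure \<Rightarrow> (nat set \<times> ('x \<Rightarrow> nat)) set" where
  "finite_observables \<mu> = {(A, \<alpha>). finite A \<and> \<alpha> \<in> measurable \<mu> (count_space A)}"

text \<open>The observables refining \<open>\<beta>\<close>, each with a witness \<open>\<gamma>\<close> (written \<open>\<beta>\<^sub>\<alpha>\<close> in the
  literature) of \<open>\<beta> = \<gamma> \<circ> \<alpha>\<close>. Outside the image of \<open>\<alpha>\<close> the map \<open>\<gamma>\<close> is not determined; the
  infimum below is over all choices, and does not depend on them as it may be restricted to
  surjective \<open>\<alpha>\<close>.\<close>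

definition refinements ::
  "'x measure \<Rightarrow> nat set \<Rightarrow> ('x \<Rightarrow> nat) \<Rightarrow> (nat set \<times> ('x \<Rightarrow> nat) \<times> (nat \<Rightarrow> nat)) set" where
  "refinements \<mu> B \<beta> =
     {(A, \<alpha>, \<gamma>). (A, \<alpha>) \<in> finite_observables \<mu> \<and> \<gamma> \<in> A \<rightarrow> B \<and> (\<forall>x\<in>space \<mu>. \<beta> x = \<gamma> (\<alpha> x))}"

definition microstates ::
  "('g \<Rightarrow> 'x \<Rightarrow> 'x) \<Rightarrow> 'x measure \<Rightarrow> nat set \<Rightarrow> ('x \<Rightarrow> nat) \<Rightarrow> 'g set \<Rightarrow> real \<Rightarrow>
     'd set \<Rightarrow> ('g \<Rightarrow> 'd \<Rightarrow> 'd) \<Rightarrow> ('d \<Rightarrow> nat) set" where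
  "microstates act \<mu> A \<alpha> F \<epsilon> D \<sigma> =
     {a \<in> D \<rightarrow>\<^sub>E A. \<forall>p \<in> F \<rightarrow>\<^sub>E A.
        \<bar>measure \<mu> {x \<in> space \<mu>. \<forall>f\<in>F. \<alpha> (act f x) = p f}
           - card {i \<in> D. \<forall>f\<in>F. a (\<sigma> f i) = p f} / card D\<bar> \<le> \<epsilon>}"

definition measured_sofic_entropy ::
  "('g, 'a) monoid_scheme \<Rightarrow> ('g \<Rightarrow> 'x \<Rightarrow> 'x) \<Rightarrow> 'x measure \<Rightarrow>
     (nat \<Rightarrow> 'd set) \<Rightarrow> (nat \<Rightarrow> 'g \<Rightarrow> 'd \<Rightarrow> 'd) \<Rightarrow> ereal" where
  "measured_sofic_entropy G act \<mu> D \<sigma> =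
     (SUP (B, \<beta>)\<in>finite_observables \<mu>. INF (A, \<alpha>, \<gamma>)\<in>refinements \<mu> B \<beta>.
        INF \<epsilon>\<in>{0<..}. INF F\<in>finite_subsets (carrier G).
          limsup (\<lambda>n. log_count (enat (card
                        ((\<lambda>a. compose (D n) \<gamma> a) ` microstates act \<mu> A \<alpha> F \<epsilon> (D n) (\<sigma> n))))
                      / ereal (card (D n))))"

end

theory Submission
  imports Defs
begin

text \<open>Both entropies are shown to equal one purely symbolic quantity, \<open>SUP m. model_entropy
  m\<close>.

  Write \<open>q m\<close> for the projection of \<open>H\<close> onto its \<open>m\<close>-th
  finite quotient \<open>K m\<close>. Colour the sites of \<open>D n\<close> by elements of
  \<open>K m'\<close>. A site is realised, for a finite window \<open>F\<close> of group elements,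
  if the colours seen from it along \<open>F\<close> are \<open>q m' (f x)\<close> for a single
  point \<open>x\<close> of \<open>H\<close>. A near model is a colouring almost all of whose
  sites are realised. The quantity \<open>model_entropy m\<close> is the exponential growth rate
  of the number of near models at level \<open>m'\<close> seen through the projection to level
  \<open>m\<close>, minimised over \<open>m'\<close>, the window and the tolerance. No measure and
  no metric enters.

  Topological entropy. By compactness, closeness in a generating pseudometric along finitely many
  group elements determines \<open>q m\<close>, and equality under \<open>q m'\<close> for large
  \<open>m'\<close> forces closeness. Thus an approximately equivariant map \<open>D n
  \<rightarrow> H\<close> projects to a near model, and a near model lifts to an approximately
  equivariant map by choosing at each realised site a point that realises it. The unrealised sites
  are so few that they change counts only by a subexponential factor
  (\<open>few_small_modifications\<close>).

  Measured entropy, upper bound. Approximate an observable \<open>\<beta>\<close> by a function of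
  \<open>q m\<close>, and refine it by the observable \<open>(\<beta>, q m')\<close>. The second
  component of a microstate is a near model, because patterns that no point realises have measure
  zero, and the first component agrees with a function of the second off a small set of sites.

  Measured entropy, lower bound. This is the step that needs homoclinic points. The patterns over
  \<open>F\<close> that points of \<open>H\<close> realise form a finite group, the image of
  \<open>H\<close>, and Haar measure pushes forward to its uniform distribution. So one has to
  turn near models, in which only the set of patterns is controlled, into colourings in which all
  patterns are equally frequent. Take the finite group of all colourings that are realised at
  every site where the sofic approximation looks like a free action, and multiply a near model by
  a uniformly random element of it. The orbit of a homoclinic point under \<open>q m\<close> is
  nontrivial at finitely many places only, so it can be copied around any such site; by density
  these copies have arbitrary patterns at that site, and trivial patterns away from it
  (\<open>homoclinic_local_perturbations\<close>). Hence the pattern of the random product is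
  uniform at each site and uncorrelated between distant sites, and Chebyshev's inequality makes at
  least half of all products microstates. Since multiplication by a fixed colouring is injective
  and compatible with the projections, some single colouring sends at least half of all projected
  near models to projected microstates, so the two counts have the same growth rate
  (\<open>projected_models_le_microstates\<close>). Finally an arbitrary observable that refines
  \<open>q m\<close> is approximated by a function of some \<open>q m'\<close>, whose microstates
  it inherits by invariance of Haar measure (\<open>microstates_of_approximation\<close>).\<close>

section \<open>Counting and growth rates\<close>

lemma limsup_le_limsup_add:
  fixes f g :: "nat \<Rightarrow> ereal"
  assumes "eventually (\<lambda>n. f n \<le> g n + ereal c) sequentially"
  shows "limsup f \<le> limsup g + ereal c"
  unfolding Limsup_le_iff
proof (intro allI impI)
  fix y assume "limsup g + ereal c < y"
  then have "limsup g < y - ereal c" by (cases "limsup g"; cases y) auto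
  then have "eventually (\<lambda>n. g n < y - ereal c) sequentially" by (rule Limsup_lessD)
  with assms show "eventually (\<lambda>n. f n < y) sequentially"
  proof eventually_elim
    case (elim n)
    then show ?case by (cases "g n"; cases y; cases "f n") auto
  qed
qed

lemma log_count_mono: "a \<le> b \<Longrightarrow> log_count a \<le> log_count b"
  by (cases a; cases b) (auto simp: log_count_def)

lemma log_count_per_site_mono:
  "N > 0 \<Longrightarrow> a \<le> b \<Longrightarrow> log_count a / ereal (real N) \<le> log_count b / ereal (real N)"
  by (intro ereal_divide_right_mono log_count_mono) auto

text \<open>A factor that is exponential in the number \<open>N\<close> of sites costs its rate
  \<open>c\<close> in the growth rate. The larger count is allowed to be infinite, as is needed
  for separation numbers.\<close>

lemma log_count_per_site_le:
  assumes N: "N > 0" and le: "real a \<le> exp (c * real N) * real k" and "enat k \<le> b"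
  shows "log_count (enat a) / ereal (real N) \<le> log_count b / ereal (real N) + ereal c"
proof (cases "a = 0")
  case True
  then show ?thesis using N by (simp add: log_count_def)
next
  case False
  then have k: "k > 0" using le by (cases k) auto
  have "ln (real a) \<le> ln (exp (c * real N) * real k)"
    using False k le by (subst ln_le_cancel_iff) auto
  also have "\<dots> = c * real N + ln (real k)" using k by (simp add: ln_mult)
  finally have "ln (real a) / real N \<le> (c * real N + ln (real k)) / real N"
    by (rule divide_right_mono) simp
  also have "\<dots> = ln (real k) / real N + c" using N by (simp add: add_divide_distrib)
  finally have "log_count (enat a) / ereal (real N) \<le> log_count (enat k) / ereal (real N) + ereal c"
    using False k N by (simp add: log_count_def)
  also have "\<dots> \<le> log_count b / ereal (real N) + ereal c"
    by (intro add_right_mono log_count_per_site_mono N assms)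
  finally show ?thesis .
qed

lemma enat_card_le_separation_number:
  assumes "finite S" "S \<subseteq> M" "pairwise (\<lambda>\<phi> \<psi>. \<kappa> \<le> d \<phi> \<psi>) S"
  shows "enat (card S) \<le> separation_number d \<kappa> M"
  unfolding separation_number_def by (rule Sup_upper) (use assms in blast)

lemma sum_power_card_Pow:
  fixes y :: real
  assumes "finite D"
  shows "(\<Sum>S\<in>Pow D. y ^ card S) = (1 + y) ^ card D"
  using assms
proof (induction D)
  case empty then show ?case by simp
next
  case (insert x D)
  have inj: "inj_on (insert x) (Pow D)" using insert.hyps by (auto simp: inj_on_def)
  have disj: "Pow D \<inter> insert x ` Pow D = {}" using insert.hyps by auto
  have "(\<Sum>S\<in>Pow (insert x D). y ^ card S)
      = (\<Sum>S\<in>Pow D. y ^ card S) + (\<Sum>S\<in>insert x ` Pow D. y ^ card S)"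
    unfolding Pow_insert by (rule sum.union_disjoint) (use insert.hyps disj in auto)
  also have "(\<Sum>S\<in>insert x ` Pow D. y ^ card S) = (\<Sum>S\<in>Pow D. y ^ card (insert x S))"
    by (subst sum.reindex[OF inj]) simp
  also have "\<dots> = (\<Sum>S\<in>Pow D. y * y ^ card S)"
  proof (rule sum.cong)
    fix S assume "S \<in> Pow D"
    then have "finite S" "x \<notin> S" using insert.hyps finite_subset by auto
    then show "y ^ card (insert x S) = y * y ^ card S" by simp
  qed simp
  finally show ?case using insert by (simp add: sum_distrib_left[symmetric] algebra_simps)
qed

text \<open>A Chernoff bound. If \<open>0 < x < 1\<close> and \<open>card S \<le> t N\<close>, then
  \<open>C ^ card S \<le> x powr (- t N) * (C x) ^ card S\<close>, and the sum of \<open>(C x) ^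
  card S\<close> over all subsets is \<open>(1 + C x) ^ N \<le> exp (C x N)\<close>. First
  \<open>x\<close> is chosen so small that \<open>C x \<le> c / 2\<close>, then \<open>t\<close>
  so small that \<open>t ln (1 / x) = c / 2\<close>.

  The summand \<open>C ^ card S\<close> counts the colourings of \<open>S\<close> by
  \<open>C\<close> colours, so the sum counts the ways of recolouring a small set of sites.\<close>

lemma few_small_modifications:
  fixes C c :: real
  assumes "c > 0" "C \<ge> 0"
  obtains t where "t > 0"
    "\<And>D :: 'd set. finite D \<Longrightarrow>
       (\<Sum>S | S \<subseteq> D \<and> real (card S) \<le> t * real (card D). C ^ card S) \<le> exp (c * real (card D))"
proof -
  define x where "x = min (1/2) (c / (2 * (C + 1)))"
  have x: "0 < x" "x < 1" and xc: "C * x \<le> c / 2"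
  proof -
    show "0 < x" "x < 1" using assms by (auto simp: x_def)
    have "C * x \<le> C * (c / (2 * (C + 1)))" using assms by (intro mult_left_mono) (auto simp: x_def)
    also have "\<dots> \<le> c / 2" using assms by (simp add: field_simps)
    finally show "C * x \<le> c / 2" .
  qed
  define L where "L = ln (1 / x)"
  have L: "L > 0" using x by (simp add: L_def)
  define t where "t = c / (2 * L)"
  have t: "t > 0" using assms L by (simp add: t_def)
  have tL: "t * L = c / 2" using L by (simp add: t_def)
  show ?thesis
  proof (rule that[OF t])
    fix D :: "'d set" assume D: "finite D"
    let ?N = "real (card D)"
    have *: "C ^ card S \<le> exp (t * ?N * L) * (C * x) ^ card S"
      if "S \<subseteq> D" "real (card S) \<le> t * ?N" for S
    proof -
      have "exp (real (card S) * L) \<le> exp (t * ?N * L)"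
        using that L by (simp add: mult_right_mono)
      moreover have "exp (real (card S) * L) = (1 / x) ^ card S"
        using x by (simp add: exp_of_nat_mult L_def)
      ultimately have "(1 / x) ^ card S * (C * x) ^ card S \<le> exp (t * ?N * L) * (C * x) ^ card S"
        using assms x by (intro mult_right_mono) auto
      moreover have "(1 / x) ^ card S * (C * x) ^ card S = C ^ card S"
        using x by (simp flip: power_mult_distrib)
      ultimately show ?thesis by simp
    qed
    have "(\<Sum>S | S \<subseteq> D \<and> real (card S) \<le> t * ?N. C ^ card S)
        \<le> (\<Sum>S | S \<subseteq> D \<and> real (card S) \<le> t * ?N. exp (t * ?N * L) * (C * x) ^ card S)"
      by (rule sum_mono) (use * in auto)
    also have "\<dots> \<le> (\<Sum>S\<in>Pow D. exp (t * ?N * L) * (C * x) ^ card S)"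
      by (rule sum_mono2) (use D assms x in auto)
    also have "\<dots> = exp (t * ?N * L) * (1 + C * x) ^ card D"
      by (simp add: sum_distrib_left[symmetric] sum_power_card_Pow[OF D])
    also have "\<dots> \<le> exp (t * ?N * L) * exp (C * x) ^ card D"
      using assms x by (intro mult_left_mono power_mono exp_ge_add_one_self) auto
    also have "\<dots> = exp ((t * L + C * x) * ?N)"
      by (simp add: exp_of_nat_mult[symmetric] exp_add[symmetric] algebra_simps)
    also have "\<dots> \<le> exp (c * ?N)"
      using tL xc by (simp add: mult_right_mono)
    finally show "(\<Sum>S | S \<subseteq> D \<and> real (card S) \<le> t * ?N. C ^ card S) \<le> exp (c * ?N)" .
  qed
qed

lemma card_UN_le_sum:
  assumes "finite I" "Y \<subseteq> (\<Union>i\<in>I. Z i)" "\<And>i. i \<in> I \<Longrightarrow> finite (Z i) \<and> card (Z i) \<le> k i"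
  shows "card Y \<le> (\<Sum>i\<in>I. k i)"
proof -
  have "card Y \<le> card (\<Union>i\<in>I. Z i)" using assms by (intro card_mono) auto
  also have "\<dots> \<le> (\<Sum>i\<in>I. card (Z i))" by (rule card_UN_le[OF assms(1)])
  also have "\<dots> \<le> (\<Sum>i\<in>I. k i)" using assms(3) by (intro sum_mono) auto
  finally show ?thesis .
qed

text \<open>A family of colourings is sorted into classes by an exceptional set \<open>S y\<close>
  attached to each member and by the colours on that set. Together with the bound
  \<open>few_small_modifications\<close> on the number of classes, a bound on the size of each
  class controls the whole family up to a subexponential factor.\<close>

lemma card_le_small_modifications:
  fixes t :: real and k :: nat
  assumes D: "finite D" and C: "finite C" and Y: "Y \<subseteq> D \<rightarrow>\<^sub>E C"
    and S: "\<And>y. y \<in> Y \<Longrightarrow> S y \<subseteq> D \<and> real (card (S y)) \<le> t * real (card D)"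
    and k: "\<And>R r. R \<subseteq> D \<Longrightarrow> card {y \<in> Y. S y = R \<and> restrict y R = r} \<le> k"
  shows "real (card Y) \<le> (\<Sum>R | R \<subseteq> D \<and> real (card R) \<le> t * real (card D). real (card C) ^ card R) * real k"
proof -
  define \<R> where "\<R> = {R. R \<subseteq> D \<and> real (card R) \<le> t * real (card D)}"
  have fin: "finite \<R>" using D by (simp add: \<R>_def)
  have finR: "finite R" if "R \<in> \<R>" for R using that rev_finite_subset[OF D] by (simp add: \<R>_def)
  have "finite (D \<rightarrow>\<^sub>E C)" using D C by (intro finite_PiE) auto
  then have finY: "finite Y" using Y by (rule rev_finite_subset)
  let ?Z = "\<lambda>(R, r). {y \<in> Y. S y = R \<and> restrict y R = r}"
  have "card Y \<le> (\<Sum>z\<in>Sigma \<R> (\<lambda>R. R \<rightarrow>\<^sub>E C). k)"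
  proof (rule card_UN_le_sum)
    show "finite (Sigma \<R> (\<lambda>R. R \<rightarrow>\<^sub>E C))"
      using fin finR C by (intro finite_SigmaI finite_PiE) auto
    show "Y \<subseteq> (\<Union>z\<in>Sigma \<R> (\<lambda>R. R \<rightarrow>\<^sub>E C). ?Z z)"
    proof
      fix y assume y: "y \<in> Y"
      have "(S y, restrict y (S y)) \<in> Sigma \<R> (\<lambda>R. R \<rightarrow>\<^sub>E C)"
        using S[OF y] y Y by (auto simp: \<R>_def PiE_def Pi_def)
      moreover have "y \<in> ?Z (S y, restrict y (S y))" using y by simp
      ultimately show "y \<in> (\<Union>z\<in>Sigma \<R> (\<lambda>R. R \<rightarrow>\<^sub>E C). ?Z z)" by blast
    qed
    show "finite (?Z z) \<and> card (?Z z) \<le> k" if "z \<in> Sigma \<R> (\<lambda>R. R \<rightarrow>\<^sub>E C)" for z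
      using that k finY by (cases z) (auto simp: \<R>_def)
  qed
  also have "\<dots> = card (Sigma \<R> (\<lambda>R. R \<rightarrow>\<^sub>E C)) * k" by simp
  also have "card (Sigma \<R> (\<lambda>R. R \<rightarrow>\<^sub>E C)) = (\<Sum>R\<in>\<R>. card (R \<rightarrow>\<^sub>E C))"
    by (rule card_SigmaI) (use fin finR C in \<open>auto intro: finite_PiE\<close>)
  also have "\<dots> = (\<Sum>R\<in>\<R>. card C ^ card R)"
    by (intro sum.cong refl) (simp add: card_PiE finR)
  finally have "real (card Y) \<le> real ((\<Sum>R\<in>\<R>. card C ^ card R) * k)" by (simp only: of_nat_le_iff)
  then show ?thesis by (simp add: \<R>_def)
qed

text \<open>Counting the related pairs in two ways: an element of \<open>\<Gamma>\<close> is related to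
  at least half of \<open>L\<close> on average.\<close>

lemma ex_popular_element:
  assumes "finite L" "finite \<Gamma>" "\<Gamma> \<noteq> {}"
    and "\<And>a. a \<in> L \<Longrightarrow> card \<Gamma> \<le> 2 * card {b \<in> \<Gamma>. R a b}"
  shows "\<exists>b\<in>\<Gamma>. card L \<le> 2 * card {a \<in> L. R a b}"
proof (rule ccontr)
  assume "\<not> ?thesis"
  then have *: "2 * card {a \<in> L. R a b} < card L" if "b \<in> \<Gamma>" for b using that by force
  have "(\<Sum>b\<in>\<Gamma>. card {a \<in> L. R a b}) = (\<Sum>b\<in>\<Gamma>. \<Sum>a\<in>L. if R a b then 1 else 0)"
    using assms by (simp add: sum.inter_filter[symmetric])
  also have "\<dots> = (\<Sum>a\<in>L. \<Sum>b\<in>\<Gamma>. if R a b then 1 else 0)" by (rule sum.swap)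
  also have "\<dots> = (\<Sum>a\<in>L. card {b \<in> \<Gamma>. R a b})"
    using assms by (simp add: sum.inter_filter[symmetric])
  finally have swap: "(\<Sum>b\<in>\<Gamma>. card {a \<in> L. R a b}) = (\<Sum>a\<in>L. card {b \<in> \<Gamma>. R a b})" .
  have "card L * card \<Gamma> = (\<Sum>a\<in>L. card \<Gamma>)" by simp
  also have "\<dots> \<le> (\<Sum>a\<in>L. 2 * card {b \<in> \<Gamma>. R a b})" using assms(4) by (rule sum_mono)
  also have "\<dots> = (\<Sum>b\<in>\<Gamma>. 2 * card {a \<in> L. R a b})" by (simp add: sum_distrib_left[symmetric] swap)
  also have "\<dots> < (\<Sum>b\<in>\<Gamma>. card L)" using assms * by (intro sum_strict_mono) auto
  finally show False by simp
qed

section \<open>Finite quotients of a profinite group\<close>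

text \<open>All that is used about profinite groups. Quotient maps from \<open>H\<close> are more
  convenient than coherent sequences: the transition maps of the inverse system can be recovered
  from \<open>q_refines\<close>, and they are onto because the quotient maps are.\<close>

locale finite_quotient_tower =
  fixes H :: "('h, 'b) monoid_scheme" and T :: "'h topology"
    and K :: "nat \<Rightarrow> nat monoid" and q :: "nat \<Rightarrow> 'h \<Rightarrow> nat"
  assumes group_H: "group H"
    and topspace_T: "topspace T = carrier H"
    and compact_T: "compact_space T"
    and group_K: "group (K m)"
    and finite_K: "finite (carrier (K m))"
    and q_hom: "q m \<in> hom H (K m)"
    and q_surj: "q m ` carrier H = carrier (K m)"
    and q_refines: "\<lbrakk>m \<le> m'; x \<in> carrier H; y \<in> carrier H; q m' x = q m' y\<rbrakk> \<Longrightarrow> q m x = q m y"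
    and fibre_open: "openin T {x \<in> carrier H. q m x = k}"
    and fibres_base: "\<lbrakk>openin T U; x \<in> U\<rbrakk> \<Longrightarrow> \<exists>m. \<forall>y\<in>carrier H. q m y = q m x \<longrightarrow> y \<in> U"

text \<open>The transition maps of an inverse system need not be onto, so the groups \<open>K n\<close>
  are replaced by the images of \<open>H\<close> in them. Compactness is Tychonoff's theorem, as
  coherence is a closed condition. The fibres form a base because a basic open set of the product
  constrains finitely many coordinates, and all of these are determined by the largest one.\<close>

lemma profinite_group_finite_quotient_tower:
  assumes "profinite_group H T"
  obtains K q where "finite_quotient_tower H T K q"
proof -
  from assms obtain K :: "nat \<Rightarrow> nat monoid" and \<pi> f where
    tg: "topological_group H T"
    and K: "\<And>n. group (K n)" "\<And>n. finite (carrier (K n))"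
    and \<pi>: "\<And>n. \<pi> n \<in> hom (K (Suc n)) (K n)"
    and f: "f \<in> iso H (inverse_limit_group K \<pi>)"
    and homeo: "homeomorphic_map T (inverse_limit_topology K \<pi>) f"
    unfolding profinite_group_def by blast
  let ?L = "inverse_limit_group K \<pi>" and ?TL = "inverse_limit_topology K \<pi>"
  let ?TP = "product_topology (\<lambda>n. discrete_topology (carrier (K n))) UNIV"
  have H: "group H" and TH: "topspace T = carrier H"
    using tg by (auto simp: topological_group_def)
  interpret H: group H by (rule H)
  have carL: "carrier ?L = {x. (\<forall>n. x n \<in> carrier (K n)) \<and> (\<forall>n. \<pi> n (x (Suc n)) = x n)}"
    by (auto simp: inverse_limit_group_def PiE_def Pi_def)
  have fhom: "f (x \<otimes>\<^bsub>H\<^esub> y) m = f x m \<otimes>\<^bsub>K m\<^esub> f y m"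
    if "x \<in> carrier H" "y \<in> carrier H" for x y m
  proof -
    have "f (x \<otimes>\<^bsub>H\<^esub> y) = f x \<otimes>\<^bsub>?L\<^esub> f y"
      using f that by (auto simp: iso_def hom_def)
    then show ?thesis by (simp add: inverse_limit_group_def)
  qed
  have fL: "f x \<in> carrier ?L" if "x \<in> carrier H" for x
    using f that by (auto simp: iso_def hom_def)
  have finj: "inj_on f (carrier H)" using f by (auto simp: iso_def bij_betw_def)
  have hom: "(\<lambda>x. f x m) \<in> hom H (K m)" for m
    using fhom fL by (auto simp: hom_def carL)
  define q where "q = (\<lambda>m x. f x m)"
  define K' where "K' = (\<lambda>m. (K m)\<lparr>carrier := q m ` carrier H\<rparr>)"
  have sub: "subgroup (q m ` carrier H) (K m)" for m
  proof -
    interpret gh: group_hom H "K m" "q m"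
      by (rule group_hom.intro[OF H K(1)]) (simp add: group_hom_axioms_def hom q_def)
    show ?thesis by (rule gh.img_is_subgroup)
  qed
  have closedL: "closedin ?TP (carrier ?L)"
  proof -
    have 1: "closedin ?TP {x \<in> topspace ?TP. \<pi> n (x (Suc n)) = x n}" for n
    proof (rule closedin_continuous_maps_eq)
      show "Hausdorff_space (discrete_topology (carrier (K n)))"
        by simp
      show "continuous_map ?TP (discrete_topology (carrier (K n))) (\<lambda>x. x n)"
        by (rule continuous_map_product_projection) simp
      have "continuous_map ?TP (discrete_topology (carrier (K (Suc n)))) (\<lambda>x. x (Suc n))"
        by (rule continuous_map_product_projection) simp
      moreover have "continuous_map (discrete_topology (carrier (K (Suc n))))
          (discrete_topology (carrier (K n))) (\<pi> n)"
        using \<pi>[of n] by (auto simp: hom_def Pi_def)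
      ultimately show "continuous_map ?TP (discrete_topology (carrier (K n))) (\<lambda>x. \<pi> n (x (Suc n)))"
        by (rule continuous_map_compose[unfolded comp_def])
    qed
    have "carrier ?L = (\<Inter>n. {x \<in> topspace ?TP. \<pi> n (x (Suc n)) = x n})"
      by (auto simp: carL PiE_def Pi_def)
    then show ?thesis using 1 by (auto intro!: closedin_Inter)
  qed
  have "compact_space ?TP"
    using K(2) by (simp add: compact_space_product_topology compact_space_discrete_topology)
  then have "compactin ?TP (carrier ?L)" using closedL by (rule closedin_compact_space)
  then have "compact_space ?TL"
    unfolding inverse_limit_topology_def by (rule compact_space_subtopology)
  then have compact: "compact_space T"
    using homeo homeomorphic_compact_space homeomorphic_map_imp_homeomorphic_space by blast
  have cont: "continuous_map T (discrete_topology (carrier (K m))) (q m)" for m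
  proof -
    have "continuous_map T ?TL f" using homeo by (rule homeomorphic_imp_continuous_map)
    then have "continuous_map T ?TP f"
      unfolding inverse_limit_topology_def by (simp add: continuous_map_in_subtopology)
    moreover have "continuous_map ?TP (discrete_topology (carrier (K m))) (\<lambda>x. x m)"
      by (rule continuous_map_product_projection) simp
    ultimately show ?thesis
      unfolding q_def by (rule continuous_map_compose[unfolded comp_def])
  qed
  have coords: "f x i = f y i"
    if "i \<le> m" "x \<in> carrier H" "y \<in> carrier H" "f x m = f y m" for x y i m
    using that(1,4)
  proof (induction m)
    case (Suc m)
    have "f z m = \<pi> m (f z (Suc m))" if "z \<in> carrier H" for z
      using fL[OF that] by (simp add: carL)
    then have "f x m = f y m" using Suc.prems that(2,3) by simp
    then show ?case using Suc by (cases "i = Suc m") auto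
  qed simp
  have "finite_quotient_tower H T K' q"
  proof (rule finite_quotient_tower.intro)
    show "group (K' m)" for m
      unfolding K'_def by (rule subgroup.subgroup_is_group[OF sub K(1)])
    show "finite (carrier (K' m))" for m
      unfolding K'_def using finite_subset[OF subgroup.subset[OF sub] K(2)] by simp
    show "q m \<in> hom H (K' m)" for m
      using hom[of m] by (auto simp: K'_def hom_def q_def)
    show "q m ` carrier H = carrier (K' m)" for m by (simp add: K'_def)
    show "q m x = q m y" if "m \<le> m'" "x \<in> carrier H" "y \<in> carrier H" "q m' x = q m' y" for m m' x y
      using coords[OF that(1-3)] that(4) unfolding q_def by blast
    show "openin T {x \<in> carrier H. q m x = k}" for m k
    proof -
      have "openin T {x \<in> topspace T. q m x \<in> {k} \<inter> carrier (K m)}"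
        by (rule openin_continuous_map_preimage[OF cont]) auto
      moreover have "{x \<in> topspace T. q m x \<in> {k} \<inter> carrier (K m)} = {x \<in> carrier H. q m x = k}"
        using hom[of m] by (auto simp: TH hom_def q_def)
      ultimately show ?thesis by simp
    qed
    show "\<exists>m. \<forall>y\<in>carrier H. q m y = q m x \<longrightarrow> y \<in> U" if U: "openin T U" "x \<in> U" for U x
    proof -
      have UH: "U \<subseteq> carrier H" using openin_subset[OF U(1)] TH by simp
      have "openin ?TL (f ` U)"
        using homeo U(1) UH TH by (metis homeomorphic_map_openness_eq)
      then obtain S where S: "openin ?TP S" "f ` U = S \<inter> carrier ?L"
        unfolding inverse_limit_topology_def openin_subtopology by auto
      have "f x \<in> S" using S(2) U(2) by auto
      then obtain W where W: "finite {i \<in> UNIV. W i \<noteq> topspace (discrete_topology (carrier (K i)))}"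
        "f x \<in> Pi\<^sub>E UNIV W" "Pi\<^sub>E UNIV W \<subseteq> S"
        using S(1) unfolding openin_product_topology_alt by blast
      define J where "J = {i. W i \<noteq> carrier (K i)}"
      have J: "finite J" using W(1) by (simp add: J_def)
      define m where "m = Max (insert 0 J)"
      have m: "i \<le> m" if "i \<in> J" for i
        unfolding m_def using J that by (intro Max_ge) auto
      show ?thesis
      proof (intro exI[of _ m] ballI impI)
        fix y assume y: "y \<in> carrier H" and e: "q m y = q m x"
        have "f y i \<in> W i" for i
        proof (cases "i \<in> J")
          case True
          then have "f y i = f x i"
            using coords[OF m[OF True] y _ e[unfolded q_def]] U(2) UH by auto
          then show ?thesis using W(2) by auto
        next
          case False
          then show ?thesis using fL[OF y] by (simp add: J_def carL)
        qed
        then have "f y \<in> S" using W(3) by auto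
        then have "f y \<in> f ` U" using S(2) fL[OF y] by auto
        then show "y \<in> U" using finj y UH by (auto simp: inj_on_def)
      qed
    qed
    show "group H" "topspace T = carrier H" "compact_space T" using H TH compact by auto
  qed
  then show ?thesis by (rule that)
qed

context finite_quotient_tower
begin

sublocale H: group H by (rule group_H)

lemma q_closed [simp]: "x \<in> carrier H \<Longrightarrow> q m x \<in> carrier (K m)"
  using q_surj by blast

lemma q_mult: "x \<in> carrier H \<Longrightarrow> y \<in> carrier H \<Longrightarrow> q m (x \<otimes>\<^bsub>H\<^esub> y) = q m x \<otimes>\<^bsub>K m\<^esub> q m y"
  using q_hom by (simp add: hom_mult)

lemma q_one: "q m \<one>\<^bsub>H\<^esub> = \<one>\<^bsub>K m\<^esub>"
  using hom_one[OF q_hom group_H group_K] .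

lemma K_cancel:
  assumes "a \<in> carrier (K m)" "b \<in> carrier (K m)" "c \<in> carrier (K m)"
  shows "a \<otimes>\<^bsub>K m\<^esub> b = a \<otimes>\<^bsub>K m\<^esub> c \<longleftrightarrow> b = c" "b \<otimes>\<^bsub>K m\<^esub> a = c \<otimes>\<^bsub>K m\<^esub> a \<longleftrightarrow> b = c"
proof -
  interpret K: group "K m" by (rule group_K)
  show "a \<otimes>\<^bsub>K m\<^esub> b = a \<otimes>\<^bsub>K m\<^esub> c \<longleftrightarrow> b = c" "b \<otimes>\<^bsub>K m\<^esub> a = c \<otimes>\<^bsub>K m\<^esub> a \<longleftrightarrow> b = c"
    using assms by simp_all
qed

lemma K_closed: "a \<in> carrier (K m) \<Longrightarrow> b \<in> carrier (K m) \<Longrightarrow> a \<otimes>\<^bsub>K m\<^esub> b \<in> carrier (K m)"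
  by (rule monoid.m_closed[OF group.is_monoid[OF group_K]])

lemma K_assoc: "a \<in> carrier (K m) \<Longrightarrow> b \<in> carrier (K m) \<Longrightarrow> c \<in> carrier (K m) \<Longrightarrow>
    a \<otimes>\<^bsub>K m\<^esub> (b \<otimes>\<^bsub>K m\<^esub> c) = (a \<otimes>\<^bsub>K m\<^esub> b) \<otimes>\<^bsub>K m\<^esub> c"
  using monoid.m_assoc[OF group.is_monoid[OF group_K]] by simp

text \<open>The transition homomorphism \<open>K m' \<rightarrow> K m\<close> for \<open>m \<le>
  m'\<close>, read off from \<open>H\<close>; the choice of \<open>x\<close> is irrelevant by
  \<open>q_refines\<close>.\<close>

definition proj :: "nat \<Rightarrow> nat \<Rightarrow> nat \<Rightarrow> nat" where
  "proj m' m k = q m (SOME x. x \<in> carrier H \<and> q m' x = k)"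

lemma proj_q:
  assumes "m \<le> m'" "x \<in> carrier H"
  shows "proj m' m (q m' x) = q m x"
proof -
  have "(SOME y. y \<in> carrier H \<and> q m' y = q m' x) \<in> carrier H \<and>
      q m' (SOME y. y \<in> carrier H \<and> q m' y = q m' x) = q m' x"
    by (rule someI[of _ x]) (use assms in auto)
  then show ?thesis unfolding proj_def using q_refines[OF assms(1)] assms(2) by blast
qed

lemma proj_closed: "m \<le> m' \<Longrightarrow> k \<in> carrier (K m') \<Longrightarrow> proj m' m k \<in> carrier (K m)"
  using q_surj[of m'] q_closed proj_q by (metis imageE)

lemma proj_mult:
  assumes "m \<le> m'" "k \<in> carrier (K m')" "l \<in> carrier (K m')"
  shows "proj m' m (k \<otimes>\<^bsub>K m'\<^esub> l) = proj m' m k \<otimes>\<^bsub>K m\<^esub> proj m' m l"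
proof -
  obtain x y where "x \<in> carrier H" "k = q m' x" "y \<in> carrier H" "l = q m' y"
    using assms q_surj by blast
  then show ?thesis
    using assms by (simp add: proj_q q_mult[symmetric])
qed

lemma union_of_fibres_open: "openin T {x \<in> carrier H. q m x \<in> C}"
proof -
  have "{x \<in> carrier H. q m x \<in> C} = (\<Union>k\<in>C. {x \<in> carrier H. q m x = k})" by auto
  then show ?thesis using fibre_open by auto
qed

text \<open>A Lebesgue number argument: finitely many fibres, each contained in a ball of radius
  \<open>r / 2\<close>, cover the compact space, and every fibre at a deeper level lies inside one
  of them.\<close>

lemma fibres_uniformly_small:
  assumes \<rho>: "continuous_pseudometric T \<rho>" and r: "r > 0"
  obtains m0 where "\<And>m x y. \<lbrakk>m0 \<le> m; x \<in> carrier H; y \<in> carrier H; q m x = q m y\<rbrakk> \<Longrightarrow> \<rho> x y < r"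
proof -
  define V where "V = (\<lambda>x. {y \<in> carrier H. \<rho> x y < r / 2})"
  have cont: "continuous_map (prod_topology T T) euclideanreal (\<lambda>(x, y). \<rho> x y)"
    using \<rho> by (simp add: continuous_pseudometric_def)
  have V: "openin T (V x)" if x: "x \<in> carrier H" for x
  proof -
    have "continuous_map T (prod_topology T T) (\<lambda>y. (x, y))"
      using x by (simp add: continuous_map_pairwise comp_def topspace_T)
    from continuous_map_compose[OF this cont]
    have "continuous_map T euclideanreal (\<lambda>y. \<rho> x y)" by (simp add: comp_def)
    then have "openin T {y \<in> topspace T. \<rho> x y \<in> {..<r / 2}}"
      by (rule openin_continuous_map_preimage) simp
    then show ?thesis by (simp add: V_def topspace_T)
  qed
  have "\<exists>m. \<forall>y\<in>carrier H. q m y = q m x \<longrightarrow> y \<in> V x" if "x \<in> carrier H" for x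
  proof (rule fibres_base[OF V[OF that]])
    show "x \<in> V x" using \<rho> r that by (simp add: V_def continuous_pseudometric_def topspace_T)
  qed
  then obtain M where M: "\<And>x y. \<lbrakk>x \<in> carrier H; y \<in> carrier H; q (M x) y = q (M x) x\<rbrakk> \<Longrightarrow> y \<in> V x"
    by metis
  define W where "W = (\<lambda>x. {y \<in> carrier H. q (M x) y = q (M x) x})"
  have "\<exists>\<F>. finite \<F> \<and> \<F> \<subseteq> W ` carrier H \<and> topspace T \<subseteq> \<Union>\<F>"
  proof (rule compactinD[OF compact_T[unfolded compact_space_def]])
    show "openin T U" if "U \<in> W ` carrier H" for U
      using that fibre_open by (auto simp: W_def)
    show "topspace T \<subseteq> \<Union> (W ` carrier H)" by (auto simp: W_def topspace_T)
  qed
  then obtain \<F> where \<F>: "finite \<F>" "\<F> \<subseteq> W ` carrier H" "topspace T \<subseteq> \<Union>\<F>"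
    by auto
  obtain Z where Z: "Z \<subseteq> carrier H" "finite Z" "\<F> = W ` Z"
    using finite_subset_image[OF \<F>(1) \<F>(2)] by (elim exE conjE) simp
  define m0 where "m0 = Max (insert 0 (M ` Z))"
  show ?thesis
  proof (rule that[of m0])
    fix m x y assume *: "m0 \<le> m" "x \<in> carrier H" "y \<in> carrier H" "q m x = q m y"
    then obtain z where z: "z \<in> Z" "x \<in> W z" using \<F>(3) Z(3) by (auto simp: topspace_T)
    have "M z \<le> m0" unfolding m0_def using Z z by (intro Max_ge) auto
    then have "q (M z) x = q (M z) y" using * by (intro q_refines[of "M z" m]) auto
    then have "y \<in> W z" using z * by (auto simp: W_def)
    have zH: "z \<in> carrier H" using z Z by auto
    have "x \<in> V z" "y \<in> V z" using z \<open>y \<in> W z\<close> zH by (auto simp: W_def intro: M)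
    then have "\<rho> z x < r / 2" "\<rho> z y < r / 2" by (auto simp: V_def)
    moreover have "\<rho> x y \<le> \<rho> x z + \<rho> z y" "\<rho> x z = \<rho> z x"
      using \<rho> * zH by (auto simp: continuous_pseudometric_def topspace_T)
    ultimately show "\<rho> x y < r" by simp
  qed
qed

lemma pseudometric_bounded:
  assumes \<rho>: "continuous_pseudometric T \<rho>"
  obtains B where "B > 0" "\<And>x y. x \<in> carrier H \<Longrightarrow> y \<in> carrier H \<Longrightarrow> \<rho> x y \<le> B"
proof -
  have "compactin (prod_topology T T) (topspace (prod_topology T T))"
    using compact_T by (simp add: compact_space_def compactin_Times)
  then have "compactin euclideanreal ((\<lambda>(x, y). \<rho> x y) ` topspace (prod_topology T T))"
    by (rule image_compactin) (use \<rho> in \<open>simp add: continuous_pseudometric_def\<close>)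
  then have "bounded ((\<lambda>(x, y). \<rho> x y) ` topspace (prod_topology T T))"
    by (simp add: compact_imp_bounded)
  then obtain B where B: "B > 0" "\<forall>z\<in>(\<lambda>(x, y). \<rho> x y) ` topspace (prod_topology T T). norm z \<le> B"
    by (auto simp: bounded_pos)
  show ?thesis by (rule that[OF B(1)]) (use B(2) in \<open>fastforce simp: topspace_T\<close>)
qed

end

section \<open>Haar measure on finite quotients\<close>

locale haar_quotient_tower = finite_quotient_tower H T K q
  for H :: "('h, 'b) monoid_scheme" and T K q +
  fixes \<mu> :: "'h measure"
  assumes haar: "haar_prob_measure H T \<mu>"
begin

sublocale prob_space \<mu>
  using haar by (simp add: haar_prob_measure_def)

lemma sets_mu: "sets \<mu> = sigma_sets (carrier H) {U. openin T U}"
proof -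
  have "{U. openin T U} \<subseteq> Pow (topspace T)" using openin_subset by blast
  then show ?thesis using haar by (simp add: haar_prob_measure_def topspace_T)
qed

lemma space_mu: "space \<mu> = carrier H"
proof -
  have "space \<mu> = space (sigma (topspace T) {U. openin T U})"
    using haar by (intro sets_eq_imp_space_eq) (simp add: haar_prob_measure_def)
  moreover have "{U. openin T U} \<subseteq> Pow (topspace T)" using openin_subset by blast
  ultimately show ?thesis by (simp add: topspace_T space_measure_of)
qed

lemma open_in_sets: "openin T U \<Longrightarrow> U \<in> sets \<mu>"
  unfolding sets_mu by (rule sigma_sets.Basic) simp

lemma q_cylinder_sets [measurable]: "{x \<in> carrier H. q m x \<in> C} \<in> sets \<mu>"
  by (rule open_in_sets[OF union_of_fibres_open])

lemma q_measurable: "q m \<in> measurable \<mu> (count_space (carrier (K m)))"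
proof (rule measurableI)
  fix A assume "A \<in> sets (count_space (carrier (K m)))"
  have "q m -` A \<inter> space \<mu> = {x \<in> carrier H. q m x \<in> A}" by (auto simp: space_mu)
  then show "q m -` A \<inter> space \<mu> \<in> sets \<mu>" using q_cylinder_sets by simp
qed (simp add: space_mu)

lemma cylinder_level_up:
  assumes "m \<le> m'"
  shows "{x \<in> carrier H. q m x \<in> C} = {x \<in> carrier H. q m' x \<in> {k. proj m' m k \<in> C}}"
  using assms by (auto simp: proj_q)

definition cylinders :: "'h set set" where
  "cylinders = {{x \<in> carrier H. q m x \<in> C} | m C. True}"

text \<open>The fibres of level \<open>m\<close> inside an open set form a cylinder, and the open set
  is the countable union of these cylinders over all levels.\<close>

lemma sets_mu_cylinders: "sets \<mu> = sigma_sets (carrier H) cylinders"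
proof
  have "U \<in> sigma_sets (carrier H) cylinders" if U: "openin T U" for U
  proof -
    have UH: "U \<subseteq> carrier H" using openin_subset[OF U] by (simp add: topspace_T)
    define C where "C = (\<lambda>m. {k. \<forall>y\<in>carrier H. q m y = k \<longrightarrow> y \<in> U})"
    have "U = (\<Union>m. {x \<in> carrier H. q m x \<in> C m})"
      using fibres_base[OF U] UH by (auto simp: C_def)
    also have "\<dots> \<in> sigma_sets (carrier H) cylinders"
      by (rule sigma_sets.Union, rule sigma_sets.Basic) (auto simp: cylinders_def)
    finally show ?thesis .
  qed
  then show "sets \<mu> \<subseteq> sigma_sets (carrier H) cylinders"
    unfolding sets_mu by (intro sigma_sets_mono) auto
  show "sigma_sets (carrier H) cylinders \<subseteq> sets \<mu>"
    unfolding space_mu[symmetric] by (intro sets.sigma_sets_subset) (auto simp: cylinders_def)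
qed

text \<open>The hypothesis on \<open>P\<close> says that left translations permute its level sets. They
  do so transitively, hence all level sets have the same Haar measure. This is applied to quotient
  maps and to patterns along an orbit.\<close>

lemma left_translation_invariant_observable_uniform:
  fixes P :: "'h \<Rightarrow> 'p"
  assumes fin: "finite (P ` carrier H)"
    and meas: "\<And>c. {x \<in> carrier H. P x = c} \<in> sets \<mu>"
    and inv: "\<And>x y z. \<lbrakk>x \<in> carrier H; y \<in> carrier H; z \<in> carrier H\<rbrakk> \<Longrightarrow>
        P (z \<otimes>\<^bsub>H\<^esub> x) = P (z \<otimes>\<^bsub>H\<^esub> y) \<longleftrightarrow> P x = P y"
  shows "measure \<mu> {x \<in> carrier H. P x \<in> C} = card (C \<inter> P ` carrier H) / card (P ` carrier H)"
proof -
  define cell where "cell = (\<lambda>c. {x \<in> carrier H. P x = c})"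
  have cell_sets: "cell c \<in> sets \<mu>" for c using meas by (simp add: cell_def)
  have translate: "w <#\<^bsub>H\<^esub> cell (P \<one>\<^bsub>H\<^esub>) = cell (P w)" if w: "w \<in> carrier H" for w
  proof
    show "w <#\<^bsub>H\<^esub> cell (P \<one>\<^bsub>H\<^esub>) \<subseteq> cell (P w)"
      using inv[OF _ _ w, of _ "\<one>\<^bsub>H\<^esub>"] w by (auto simp: l_coset_def cell_def)
    show "cell (P w) \<subseteq> w <#\<^bsub>H\<^esub> cell (P \<one>\<^bsub>H\<^esub>)"
    proof
      fix x assume "x \<in> cell (P w)"
      then have x: "x \<in> carrier H" "P x = P w" by (auto simp: cell_def)
      let ?y = "inv\<^bsub>H\<^esub> w \<otimes>\<^bsub>H\<^esub> x"
      have wy: "w \<otimes>\<^bsub>H\<^esub> ?y = x" using x w by (simp add: H.m_assoc[symmetric])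
      have "P ?y = P \<one>\<^bsub>H\<^esub>"
        using inv[of ?y "\<one>\<^bsub>H\<^esub>" w] x w wy by simp
      then have "?y \<in> cell (P \<one>\<^bsub>H\<^esub>)" using x w by (simp add: cell_def)
      then show "x \<in> w <#\<^bsub>H\<^esub> cell (P \<one>\<^bsub>H\<^esub>)" using wy by (force simp: l_coset_def)
    qed
  qed
  define r where "r = measure \<mu> (cell (P \<one>\<^bsub>H\<^esub>))"
  have r: "measure \<mu> (cell c) = r" if "c \<in> P ` carrier H" for c
  proof -
    from that obtain w where w: "w \<in> carrier H" "c = P w" by blast
    have "emeasure \<mu> (w <#\<^bsub>H\<^esub> cell (P \<one>\<^bsub>H\<^esub>)) = emeasure \<mu> (cell (P \<one>\<^bsub>H\<^esub>))"
      using haar w cell_sets by (auto simp: haar_prob_measure_def)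
    then show ?thesis using translate w by (simp add: measure_def r_def)
  qed
  have sum: "measure \<mu> {x \<in> carrier H. P x \<in> C} = card (C \<inter> P ` carrier H) * r" for C
  proof -
    have "{x \<in> carrier H. P x \<in> C} = (\<Union>c\<in>C \<inter> P ` carrier H. cell c)"
      by (auto simp: cell_def)
    also have "measure \<mu> \<dots> = (\<Sum>c\<in>C \<inter> P ` carrier H. measure \<mu> (cell c))"
      by (rule finite_measure_finite_Union)
        (use fin cell_sets in \<open>auto simp: disjoint_family_on_def cell_def\<close>)
    also have "\<dots> = (\<Sum>c\<in>C \<inter> P ` carrier H. r)" using r by (intro sum.cong) auto
    finally show ?thesis by simp
  qed
  have "card (P ` carrier H) * r = 1"
    using sum[of UNIV] prob_space by (simp add: space_mu)
  then have "r = 1 / card (P ` carrier H)" by (auto simp: eq_divide_eq mult.commute)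
  then show ?thesis unfolding sum by simp
qed

text \<open>Uniqueness of Haar measure in the form needed here. Both \<open>q m\<close> and \<open>q m
  \<circ> \<tau>\<close> are homomorphisms onto \<open>K m\<close>, so both are uniformly
  distributed; thus \<open>\<mu>\<close> and its image under \<open>\<tau>\<close> agree on
  cylinders, which form a generating family closed under intersections.\<close>

lemma haar_automorphism_invariant:
  assumes cont: "continuous_map T T \<tau>" and hom: "\<tau> \<in> hom H H" and surj: "\<tau> ` carrier H = carrier H"
  shows "\<tau> \<in> measurable \<mu> \<mu>"
    and "A \<in> sets \<mu> \<Longrightarrow> measure \<mu> {x \<in> carrier H. \<tau> x \<in> A} = measure \<mu> A"
proof -
  have \<tau>: "\<tau> x \<in> carrier H" if "x \<in> carrier H" for x using surj that by auto
  show meas: "\<tau> \<in> measurable \<mu> \<mu>"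
  proof (rule measurable_sigma_sets[OF sets_mu])
    show "{U. openin T U} \<subseteq> Pow (carrier H)" using openin_subset topspace_T by blast
    show "\<tau> \<in> space \<mu> \<rightarrow> carrier H" using \<tau> by (simp add: space_mu)
    fix U assume "U \<in> {U. openin T U}"
    then have "openin T {x \<in> topspace T. \<tau> x \<in> U}"
      using cont openin_continuous_map_preimage by blast
    moreover have "{x \<in> topspace T. \<tau> x \<in> U} = \<tau> -` U \<inter> space \<mu>"
      by (auto simp: space_mu topspace_T)
    ultimately show "\<tau> -` U \<inter> space \<mu> \<in> sets \<mu>" using open_in_sets by simp
  qed
  have "distr \<mu> \<mu> \<tau> = \<mu>"
  proof (rule measure_eqI_generator_eq[where \<Omega> = "carrier H" and E = cylinders and A = "\<lambda>_. carrier H"])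
    show "Int_stable cylinders"
    proof (rule Int_stableI)
      fix a b assume "a \<in> cylinders" "b \<in> cylinders"
      then obtain m C m' C' where ab: "a = {x \<in> carrier H. q m x \<in> C}" "b = {x \<in> carrier H. q m' x \<in> C'}"
        by (auto simp: cylinders_def)
      let ?M = "max m m'"
      have "a \<inter> b = {x \<in> carrier H. q ?M x \<in> {k. proj ?M m k \<in> C} \<inter> {k. proj ?M m' k \<in> C'}}"
        unfolding ab by (auto simp: proj_q)
      then show "a \<inter> b \<in> cylinders" unfolding cylinders_def by blast
    qed
    show "cylinders \<subseteq> Pow (carrier H)" by (auto simp: cylinders_def)
    show "sets (distr \<mu> \<mu> \<tau>) = sigma_sets (carrier H) cylinders" "sets \<mu> = sigma_sets (carrier H) cylinders"
      using sets_mu_cylinders by simp_all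
    have "carrier H = {x \<in> carrier H. q 0 x \<in> UNIV}" by simp
    then have "carrier H \<in> cylinders" unfolding cylinders_def by blast
    then show "range (\<lambda>_::nat. carrier H) \<subseteq> cylinders" by auto
    show "(\<Union>i::nat. carrier H) = carrier H" by simp
    show "emeasure (distr \<mu> \<mu> \<tau>) (carrier H) \<noteq> \<infinity>" for i :: nat
      using finite_measure.emeasure_finite[of "distr \<mu> \<mu> \<tau>"] meas
      by (metis finite_measure_distr infinity_ennreal_def)
    fix A assume "A \<in> cylinders"
    then obtain m C where A: "A = {x \<in> carrier H. q m x \<in> C}" by (auto simp: cylinders_def)
    have img: "(\<lambda>x. q m (\<tau> x)) ` carrier H = carrier (K m)"
      using surj q_surj[of m] by (metis image_image)
    have mul: "\<tau> (x \<otimes>\<^bsub>H\<^esub> y) = \<tau> x \<otimes>\<^bsub>H\<^esub> \<tau> y" if "x \<in> carrier H" "y \<in> carrier H" for x y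
      using hom that by (simp add: hom_mult)
    have "emeasure (distr \<mu> \<mu> \<tau>) A = emeasure \<mu> (\<tau> -` A \<inter> space \<mu>)"
      unfolding A by (rule emeasure_distr[OF meas]) (rule q_cylinder_sets)
    also have "\<tau> -` A \<inter> space \<mu> = {x \<in> carrier H. q m (\<tau> x) \<in> C}"
      using \<tau> by (auto simp: A space_mu)
    finally have 1: "emeasure (distr \<mu> \<mu> \<tau>) A = emeasure \<mu> {x \<in> carrier H. q m (\<tau> x) \<in> C}" .
    have "measure \<mu> {x \<in> carrier H. q m (\<tau> x) \<in> C}
        = card (C \<inter> (\<lambda>x. q m (\<tau> x)) ` carrier H) / card ((\<lambda>x. q m (\<tau> x)) ` carrier H)"
    proof (rule left_translation_invariant_observable_uniform)
      show "finite ((\<lambda>x. q m (\<tau> x)) ` carrier H)" using finite_K by (simp add: img)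
      show "{x \<in> carrier H. q m (\<tau> x) = c} \<in> sets \<mu>" for c
      proof -
        have "{x \<in> carrier H. q m (\<tau> x) = c} = \<tau> -` {x \<in> carrier H. q m x \<in> {c}} \<inter> space \<mu>"
          using \<tau> by (auto simp: space_mu)
        then show ?thesis using measurable_sets[OF meas q_cylinder_sets[of m "{c}"]] by simp
      qed
    qed (use \<tau> in \<open>simp add: mul q_mult K_cancel\<close>)
    also have "\<dots> = measure \<mu> {x \<in> carrier H. q m x \<in> C}"
      unfolding img
      by (subst left_translation_invariant_observable_uniform)
        (use q_cylinder_sets[of m "{_}"] finite_K in \<open>simp_all add: q_mult K_cancel q_surj\<close>)
    finally show "emeasure (distr \<mu> \<mu> \<tau>) A = emeasure \<mu> A"
      unfolding 1 unfolding A emeasure_eq_measure by simp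
  qed
  then have "measure \<mu> A = measure \<mu> {x \<in> carrier H. \<tau> x \<in> A}" if "A \<in> sets \<mu>" for A
  proof -
    have "measure \<mu> A = measure (distr \<mu> \<mu> \<tau>) A" using \<open>distr \<mu> \<mu> \<tau> = \<mu>\<close> by simp
    also have "\<dots> = measure \<mu> (\<tau> -` A \<inter> space \<mu>)" by (rule measure_distr[OF meas that])
    also have "\<tau> -` A \<inter> space \<mu> = {x \<in> carrier H. \<tau> x \<in> A}" by (auto simp: space_mu)
    finally show ?thesis .
  qed
  then show "A \<in> sets \<mu> \<Longrightarrow> measure \<mu> {x \<in> carrier H. \<tau> x \<in> A} = measure \<mu> A" by simp
qed

text \<open>The approximable sets form a \<open>\<sigma>\<close>-algebra that contains the cylinders.
  Asking for an approximation at all sufficiently deep levels, not merely at some level, makes it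
  possible to bring finitely many sets to a common level.\<close>

lemma approximable_by_cylinders:
  assumes "A \<in> sets \<mu>" "e > 0"
  shows "\<exists>m0. \<forall>m\<ge>m0. \<exists>C. measure \<mu> (sym_diff A {x \<in> carrier H. q m x \<in> C}) < e"
proof -
  have "\<forall>e>0. \<exists>m0. \<forall>m\<ge>m0. \<exists>C. measure \<mu> (sym_diff A {x \<in> carrier H. q m x \<in> C}) < e"
    using assms(1) unfolding sets_mu_cylinders
  proof (induction A rule: sigma_sets.induct)
    case (Basic a)
    then obtain m0 C where a: "a = {x \<in> carrier H. q m0 x \<in> C}" by (auto simp: cylinders_def)
    show ?case
    proof (intro allI impI)
      fix e :: real assume "e > 0"
      have "\<exists>C'. measure \<mu> (sym_diff a {x \<in> carrier H. q m x \<in> C'}) < e" if "m0 \<le> m" for m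
        unfolding a cylinder_level_up[OF that]
        by (rule exI[of _ "{k. proj m m0 k \<in> C}"]) (use \<open>e > 0\<close> in simp)
      then show "\<exists>m0. \<forall>m\<ge>m0. \<exists>C. measure \<mu> (sym_diff a {x \<in> carrier H. q m x \<in> C}) < e"
        by blast
    qed
  next
    case Empty
    show ?case
    proof (intro allI impI exI)
      fix e :: real and m assume "e > 0"
      then show "measure \<mu> (sym_diff {} {x \<in> carrier H. q m x \<in> {}}) < e" by simp
    qed
  next
    case (Compl a)
    have aH: "a \<subseteq> carrier H"
      using Compl.hyps sets.sets_into_space[of a \<mu>] by (simp add: sets_mu_cylinders space_mu)
    have eq: "sym_diff (carrier H - a) {x \<in> carrier H. q m x \<in> - C} = sym_diff a {x \<in> carrier H. q m x \<in> C}" for m C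
      using aH by auto
    show ?case
    proof (intro allI impI)
      fix e :: real assume "e > 0"
      then obtain m0 where m0: "\<forall>m\<ge>m0. \<exists>C. measure \<mu> (sym_diff a {x \<in> carrier H. q m x \<in> C}) < e"
        using Compl.IH by blast
      have "\<forall>m\<ge>m0. \<exists>C. measure \<mu> (sym_diff (carrier H - a) {x \<in> carrier H. q m x \<in> C}) < e"
      proof (intro allI impI)
        fix m assume "m0 \<le> m"
        with m0 obtain C where "measure \<mu> (sym_diff a {x \<in> carrier H. q m x \<in> C}) < e" by blast
        then have "measure \<mu> (sym_diff (carrier H - a) {x \<in> carrier H. q m x \<in> - C}) < e"
          unfolding eq .
        then show "\<exists>C. measure \<mu> (sym_diff (carrier H - a) {x \<in> carrier H. q m x \<in> C}) < e" ..
      qed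
      then show "\<exists>m0. \<forall>m\<ge>m0. \<exists>C. measure \<mu> (sym_diff (carrier H - a) {x \<in> carrier H. q m x \<in> C}) < e"
        by blast
    qed
  next
    case (Union a)
    have a_sets: "a i \<in> sets \<mu>" for i :: nat using Union.hyps by (simp add: sets_mu_cylinders)
    show ?case
    proof (intro allI impI)
      fix e :: real assume e: "e > 0"
      have "(\<lambda>n. measure \<mu> (\<Union>i<n. a i)) \<longlonglongrightarrow> measure \<mu> (\<Union>n. \<Union>i<n. a i)"
        by (rule finite_Lim_measure_incseq)
          (use a_sets in \<open>auto simp: incseq_def intro: order_less_le_trans\<close>)
      moreover have "(\<Union>n. \<Union>i<n. a i) = (\<Union>i. a i)" by auto
      ultimately have "(\<lambda>n. measure \<mu> (\<Union>i<n. a i)) \<longlonglongrightarrow> measure \<mu> (\<Union>i. a i)" by simp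
      then have "eventually (\<lambda>n. measure \<mu> (\<Union>i<n. a i) > measure \<mu> (\<Union>i. a i) - e / 2) sequentially"
        using e by (intro order_tendstoD) auto
      then obtain n where n: "measure \<mu> (\<Union>i<n. a i) > measure \<mu> (\<Union>i. a i) - e / 2"
        by (auto simp: eventually_sequentially)
      have tail: "measure \<mu> ((\<Union>i. a i) - (\<Union>i<n. a i)) < e / 2"
        using n by (subst finite_measure_Diff) (use a_sets in auto)
      define d where "d = e / (2 * (real n + 1))"
      have d: "d > 0" using e by (simp add: d_def)
      have "\<forall>i. \<exists>m0. \<forall>m\<ge>m0. \<exists>C. measure \<mu> (sym_diff (a i) {x \<in> carrier H. q m x \<in> C}) < d"
        using Union.IH d by blast
      from choice[OF this] obtain M where M: "\<forall>i. \<forall>m\<ge>M i. \<exists>C.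
          measure \<mu> (sym_diff (a i) {x \<in> carrier H. q m x \<in> C}) < d" ..
      show "\<exists>m0. \<forall>m\<ge>m0. \<exists>C. measure \<mu> (sym_diff (\<Union>(range a)) {x \<in> carrier H. q m x \<in> C}) < e"
      proof (intro exI[of _ "Max (insert 0 (M ` {..<n}))"] allI impI)
        fix m assume m: "Max (insert 0 (M ` {..<n})) \<le> m"
        have "M i \<le> m" if "i < n" for i
          using that by (intro order_trans[OF _ m] Max_ge) auto
        then have "\<forall>i\<in>{..<n}. \<exists>C. measure \<mu> (sym_diff (a i) {x \<in> carrier H. q m x \<in> C}) < d"
          using M by blast
        from bchoice[OF this] obtain C where
          C: "\<forall>i\<in>{..<n}. measure \<mu> (sym_diff (a i) {x \<in> carrier H. q m x \<in> C i}) < d" ..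
        let ?S = "\<lambda>i. sym_diff (a i) {x \<in> carrier H. q m x \<in> C i}"
        have S: "?S i \<in> sets \<mu>" for i using a_sets q_cylinder_sets by auto
        have "sym_diff (\<Union>(range a)) {x \<in> carrier H. q m x \<in> (\<Union>i<n. C i)}
            \<subseteq> ((\<Union>i. a i) - (\<Union>i<n. a i)) \<union> (\<Union>i<n. ?S i)" by auto
        then have 1: "measure \<mu> (sym_diff (\<Union>(range a)) {x \<in> carrier H. q m x \<in> (\<Union>i<n. C i)})
            \<le> measure \<mu> (((\<Union>i. a i) - (\<Union>i<n. a i)) \<union> (\<Union>i<n. ?S i))"
          using a_sets S by (intro finite_measure_mono) auto
        have 2: "measure \<mu> (((\<Union>i. a i) - (\<Union>i<n. a i)) \<union> (\<Union>i<n. ?S i))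
            \<le> measure \<mu> ((\<Union>i. a i) - (\<Union>i<n. a i)) + measure \<mu> (\<Union>i<n. ?S i)"
          using a_sets S by (intro measure_Un_le) auto
        have "measure \<mu> (\<Union>i<n. ?S i) \<le> (\<Sum>i<n. measure \<mu> (?S i))"
          using S by (intro finite_measure_subadditive_finite) auto
        also have "\<dots> \<le> (\<Sum>i<n. d)" using C by (intro sum_mono) (simp add: less_imp_le)
        also have "\<dots> \<le> e / 2" using e by (simp add: d_def field_simps)
        finally have "measure \<mu> (sym_diff (\<Union>(range a)) {x \<in> carrier H. q m x \<in> (\<Union>i<n. C i)}) < e"
          using tail 1 2 by linarith
        then show "\<exists>C. measure \<mu> (sym_diff (\<Union>(range a)) {x \<in> carrier H. q m x \<in> C}) < e" by blast
      qed
    qed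
  qed
  then show ?thesis using assms(2) by blast
qed

text \<open>The approximating function takes on each fibre a value that \<open>\<alpha>\<close> itself
  takes there. Consequently every function of \<open>\<alpha>\<close> that is constant on fibres
  is computed from the approximation without any error.\<close>

lemma observable_approximable:
  assumes fin: "finite A" and \<alpha>: "\<alpha> \<in> measurable \<mu> (count_space A)" and e: "e > 0"
  obtains m \<theta> where "m0 \<le> m"
    "\<And>k. k \<in> carrier (K m) \<Longrightarrow> \<exists>x\<in>carrier H. q m x = k \<and> \<theta> k = \<alpha> x"
    "measure \<mu> {x \<in> carrier H. \<alpha> x \<noteq> \<theta> (q m x)} < e"
proof -
  define cell where "cell = (\<lambda>a. {x \<in> carrier H. \<alpha> x = a})"
  have cell: "cell a \<in> sets \<mu>" if "a \<in> A" for a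
  proof -
    have "\<alpha> -` {a} \<inter> space \<mu> \<in> sets \<mu>" using that by (intro measurable_sets[OF \<alpha>]) auto
    moreover have "\<alpha> -` {a} \<inter> space \<mu> = cell a" by (auto simp: cell_def space_mu)
    ultimately show ?thesis by simp
  qed
  have \<alpha>A: "\<alpha> x \<in> A" if "x \<in> carrier H" for x
    using measurable_space[OF \<alpha>] that by (auto simp: space_mu)
  define d where "d = e / (real (card A) + 1)"
  have d: "d > 0" using e by (simp add: d_def add_nonneg_pos)
  have "\<forall>a\<in>A. \<exists>m0. \<forall>m\<ge>m0. \<exists>C. measure \<mu> (sym_diff (cell a) {x \<in> carrier H. q m x \<in> C}) < d"
    using approximable_by_cylinders[OF cell d] by blast
  from bchoice[OF this] obtain M where M: "\<forall>a\<in>A. \<forall>m\<ge>M a. \<exists>C.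
      measure \<mu> (sym_diff (cell a) {x \<in> carrier H. q m x \<in> C}) < d" ..
  define m where "m = Max (insert m0 (M ` A))"
  have m: "m0 \<le> m" "\<And>a. a \<in> A \<Longrightarrow> M a \<le> m"
    using fin by (auto simp: m_def intro!: Max_ge)
  then have "\<forall>a\<in>A. \<exists>C. measure \<mu> (sym_diff (cell a) {x \<in> carrier H. q m x \<in> C}) < d"
    using M by blast
  from bchoice[OF this] obtain C where
    C: "\<forall>a\<in>A. measure \<mu> (sym_diff (cell a) {x \<in> carrier H. q m x \<in> C a}) < d" ..
  \<comment> \<open>On the fibre over \<open>k\<close> prefer a value of \<open>\<alpha>\<close> whose approximating cylinder contains
    the fibre, and take any value on the fibre if there is none.\<close>
  have ex: "\<exists>x. x \<in> carrier H \<and> q m x = k \<and>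
      ((\<exists>y\<in>carrier H. q m y = k \<and> k \<in> C (\<alpha> y)) \<longrightarrow> k \<in> C (\<alpha> x))"
    if "k \<in> carrier (K m)" for k
  proof (cases "\<exists>y\<in>carrier H. q m y = k \<and> k \<in> C (\<alpha> y)")
    case False
    have "k \<in> q m ` carrier H" using that by (simp add: q_surj)
    then obtain z where "z \<in> carrier H" "q m z = k" by auto
    with False show ?thesis by blast
  qed blast
  have "\<forall>k\<in>carrier (K m). \<exists>x. x \<in> carrier H \<and> q m x = k \<and>
      ((\<exists>y\<in>carrier H. q m y = k \<and> k \<in> C (\<alpha> y)) \<longrightarrow> k \<in> C (\<alpha> x))"
    by (intro ballI ex)
  from bchoice[OF this] obtain X' where X': "\<forall>k\<in>carrier (K m). X' k \<in> carrier H \<and> q m (X' k) = k \<and>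
      ((\<exists>y\<in>carrier H. q m y = k \<and> k \<in> C (\<alpha> y)) \<longrightarrow> k \<in> C (\<alpha> (X' k)))" ..
  define \<theta> where "\<theta> = (\<lambda>k. \<alpha> (X' k))"
  let ?S = "\<lambda>a. sym_diff (cell a) {x \<in> carrier H. q m x \<in> C a}"
  have S: "?S a \<in> sets \<mu>" if "a \<in> A" for a using cell[OF that] q_cylinder_sets by auto
  have sub: "{x \<in> carrier H. \<alpha> x \<noteq> \<theta> (q m x)} \<subseteq> (\<Union>a\<in>A. ?S a)"
  proof
    fix x assume x: "x \<in> {x \<in> carrier H. \<alpha> x \<noteq> \<theta> (q m x)}"
    let ?k = "q m x"
    show "x \<in> (\<Union>a\<in>A. ?S a)"
    proof (cases "?k \<in> C (\<alpha> x)")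
      case True
      then have "?k \<in> C (\<alpha> (X' ?k))" using X'[rule_format, of ?k] x by auto
      moreover have "\<alpha> (X' ?k) \<in> A" using X'[rule_format, of ?k] x \<alpha>A by auto
      moreover have "x \<notin> cell (\<alpha> (X' ?k))" using x by (simp add: cell_def \<theta>_def)
      ultimately show ?thesis using x by blast
    next
      case False
      then have "x \<in> ?S (\<alpha> x)" using x by (simp add: cell_def)
      then show ?thesis using x \<alpha>A by blast
    qed
  qed
  have "measure \<mu> {x \<in> carrier H. \<alpha> x \<noteq> \<theta> (q m x)} \<le> measure \<mu> (\<Union>a\<in>A. ?S a)"
    by (rule finite_measure_mono[OF sub]) (use fin S in auto)
  also have "\<dots> \<le> (\<Sum>a\<in>A. measure \<mu> (?S a))"
    by (rule finite_measure_subadditive_finite) (use fin S in auto)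
  also have "\<dots> \<le> (\<Sum>a\<in>A. d)" using C by (intro sum_mono) (simp add: less_imp_le)
  also have "\<dots> < e" using e by (simp add: d_def field_simps add_nonneg_pos)
  finally have less: "measure \<mu> {x \<in> carrier H. \<alpha> x \<noteq> \<theta> (q m x)} < e" .
  show ?thesis
    by (rule that[of m \<theta>]) (use m X' less in \<open>auto simp: \<theta>_def\<close>)
qed

end

section \<open>Sofic approximations and negligible sets of sites\<close>

locale sofic_profinite_action = haar_quotient_tower H T K q \<mu>
  for H :: "('h, 'b) monoid_scheme" and T K q and \<mu> :: "'h measure" +
  fixes G :: "('g, 'a) monoid_scheme" and act :: "'g \<Rightarrow> 'h \<Rightarrow> 'h"
    and D :: "nat \<Rightarrow> 'd set" and \<sigma> :: "nat \<Rightarrow> 'g \<Rightarrow> 'd \<Rightarrow> 'd"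
  assumes group_G: "group G"
    and action: "acts_by_continuous_automorphisms G H T act"
    and sofic: "sofic_approximation G D \<sigma>"
begin

sublocale G: group G by (rule group_G)

sublocale act: group_action G "carrier H" act
  using action by (simp add: acts_by_continuous_automorphisms_def)

lemma act_closed [simp]: "g \<in> carrier G \<Longrightarrow> x \<in> carrier H \<Longrightarrow> act g x \<in> carrier H"
  using act.element_image by blast

lemma act_one [simp]: "x \<in> carrier H \<Longrightarrow> act \<one>\<^bsub>G\<^esub> x = x"
  using act.id_eq_one by (metis restrict_apply')

lemma act_act: "g \<in> carrier G \<Longrightarrow> h \<in> carrier G \<Longrightarrow> x \<in> carrier H \<Longrightarrow>
    act g (act h x) = act (g \<otimes>\<^bsub>G\<^esub> h) x"
  using act.composition_rule by simp

lemma act_mult: "g \<in> carrier G \<Longrightarrow> x \<in> carrier H \<Longrightarrow> y \<in> carrier H \<Longrightarrow>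
    act g (x \<otimes>\<^bsub>H\<^esub> y) = act g x \<otimes>\<^bsub>H\<^esub> act g y"
  using action by (auto simp: acts_by_continuous_automorphisms_def hom_def)

lemma act_H_one: "g \<in> carrier G \<Longrightarrow> act g \<one>\<^bsub>H\<^esub> = \<one>\<^bsub>H\<^esub>"
  using action group_H by (auto simp: acts_by_continuous_automorphisms_def intro: hom_one)

lemma act_continuous: "g \<in> carrier G \<Longrightarrow> continuous_map T T (act g)"
  using action by (auto simp: acts_by_continuous_automorphisms_def)

lemma act_invariant:
  assumes "g \<in> carrier G"
  shows "act g \<in> measurable \<mu> \<mu>"
    and "A \<in> sets \<mu> \<Longrightarrow> measure \<mu> {x \<in> carrier H. act g x \<in> A} = measure \<mu> A"
proof -
  have *: "act g \<in> hom H H" "act g ` carrier H = carrier H"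
    using action assms act.surj_prop by (auto simp: acts_by_continuous_automorphisms_def)
  show "act g \<in> measurable \<mu> \<mu>"
    and "A \<in> sets \<mu> \<Longrightarrow> measure \<mu> {x \<in> carrier H. act g x \<in> A} = measure \<mu> A"
    using haar_automorphism_invariant[OF act_continuous[OF assms] *] by blast+
qed

lemma finite_D [simp]: "finite (D n)"
  using sofic by (simp add: sofic_approximation_def)

lemma sigma_permutes: "g \<in> carrier G \<Longrightarrow> \<sigma> n g permutes D n"
  using sofic by (simp add: sofic_approximation_def)

lemma sigma_closed [simp]: "g \<in> carrier G \<Longrightarrow> i \<in> D n \<Longrightarrow> \<sigma> n g i \<in> D n"
  using permutes_in_image[OF sigma_permutes] by blast

lemma sigma_one [simp]: "\<sigma> n \<one>\<^bsub>G\<^esub> i = i"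
  using sofic by (simp add: sofic_approximation_def)

lemma card_sigma_preimage:
  assumes "g \<in> carrier G"
  shows "card {i \<in> D n. P (\<sigma> n g i)} = card {i \<in> D n. P i}"
proof (rule bij_betw_same_card[of "\<sigma> n g"])
  have b: "bij_betw (\<sigma> n g) (D n) (D n)" by (rule permutes_imp_bij[OF sigma_permutes[OF assms]])
  show "bij_betw (\<sigma> n g) {i \<in> D n. P (\<sigma> n g i)} {i \<in> D n. P i}"
    using b by (auto simp: bij_betw_def inj_on_def)
qed

lemma eventually_D_large: "eventually (\<lambda>n. c \<le> real (card (D n))) sequentially"
proof -
  have "filterlim (\<lambda>n. real (card (D n))) at_top sequentially"
    using sofic filterlim_compose[OF filterlim_real_sequentially]
    by (auto simp: sofic_approximation_def)
  then show ?thesis by (simp add: filterlim_at_top)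
qed

lemma eventually_D_pos: "eventually (\<lambda>n. card (D n) > 0) sequentially"
  using eventually_D_large[of 1] by eventually_elim auto

text \<open>Almost all sites are unaffected as \<open>n\<close> tends to infinity. Stated with
  inequalities between cardinalities instead of a limit of quotients, so that finite unions and
  inclusions need no division.\<close>

definition negligible :: "(nat \<Rightarrow> 'd \<Rightarrow> bool) \<Rightarrow> bool" where
  "negligible P \<longleftrightarrow>
     (\<forall>e>0. eventually (\<lambda>n. real (card {i \<in> D n. P n i}) \<le> e * real (card (D n))) sequentially)"

lemma negligibleD:
  "negligible P \<Longrightarrow> e > 0 \<Longrightarrow>
    eventually (\<lambda>n. real (card {i \<in> D n. P n i}) \<le> e * real (card (D n))) sequentially"
  by (simp add: negligible_def)

lemma negligible_subset:
  assumes "negligible P" "\<And>n i. i \<in> D n \<Longrightarrow> Q n i \<Longrightarrow> P n i"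
  shows "negligible Q"
  unfolding negligible_def
proof (intro allI impI)
  fix e :: real assume "e > 0"
  from negligibleD[OF assms(1) this]
  show "eventually (\<lambda>n. real (card {i \<in> D n. Q n i}) \<le> e * real (card (D n))) sequentially"
  proof eventually_elim
    case (elim n)
    have "card {i \<in> D n. Q n i} \<le> card {i \<in> D n. P n i}"
      by (rule card_mono) (use assms(2) in auto)
    then show ?case using elim by linarith
  qed
qed

lemma negligible_disj:
  assumes "negligible P" "negligible Q"
  shows "negligible (\<lambda>n i. P n i \<or> Q n i)"
  unfolding negligible_def
proof (intro allI impI)
  fix e :: real assume "e > 0"
  then have "e / 2 > 0" by simp
  from negligibleD[OF assms(1) this] negligibleD[OF assms(2) this]
  show "eventually (\<lambda>n. real (card {i \<in> D n. P n i \<or> Q n i}) \<le> e * real (card (D n))) sequentially"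
  proof eventually_elim
    case (elim n)
    have "{i \<in> D n. P n i \<or> Q n i} = {i \<in> D n. P n i} \<union> {i \<in> D n. Q n i}" by auto
    then have "card {i \<in> D n. P n i \<or> Q n i} \<le> card {i \<in> D n. P n i} + card {i \<in> D n. Q n i}"
      using card_Un_le by metis
    then show ?case using elim by linarith
  qed
qed

lemma negligible_bex:
  assumes "finite I" "\<And>j. j \<in> I \<Longrightarrow> negligible (P j)"
  shows "negligible (\<lambda>n i. \<exists>j\<in>I. P j n i)"
  using assms
proof (induction I)
  case empty then show ?case by (simp add: negligible_def)
next
  case (insert j I)
  have "negligible (\<lambda>n i. P j n i \<or> (\<exists>j\<in>I. P j n i))"
    using insert by (intro negligible_disj) auto
  then show ?case by (simp add: bex_simps)
qed

lemma negligible_preimage: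
  assumes "negligible P" "g \<in> carrier G"
  shows "negligible (\<lambda>n i. P n (\<sigma> n g i))"
  using assms(1) unfolding negligible_def card_sigma_preimage[OF assms(2)] .

lemma negligible_complement:
  assumes "(\<lambda>n. card {i \<in> D n. P n i} / card (D n)) \<longlonglongrightarrow> 1"
  shows "negligible (\<lambda>n i. \<not> P n i)"
  unfolding negligible_def
proof (intro allI impI)
  fix e :: real assume "e > 0"
  then have "eventually (\<lambda>n. 1 - e < card {i \<in> D n. P n i} / card (D n)) sequentially"
    using assms by (intro order_tendstoD) auto
  with eventually_D_pos
  show "eventually (\<lambda>n. real (card {i \<in> D n. \<not> P n i}) \<le> e * real (card (D n))) sequentially"
  proof eventually_elim
    case (elim n)
    have "{i \<in> D n. \<not> P n i} = D n - {i \<in> D n. P n i}" by auto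
    then have "card {i \<in> D n. \<not> P n i} = card (D n) - card {i \<in> D n. P n i}"
      by (simp add: card_Diff_subset)
    moreover have "card {i \<in> D n. P n i} \<le> card (D n)" by (rule card_mono) auto
    moreover have "(1 - e) * card (D n) < card {i \<in> D n. P n i}"
      using elim by (simp add: pos_less_divide_eq)
    ultimately show ?case by (simp add: of_nat_diff algebra_simps)
  qed
qed

text \<open>Seen from the site \<open>i\<close>, the elements of \<open>E\<close> act like a free group
  action.\<close>

definition good :: "'g set \<Rightarrow> nat \<Rightarrow> 'd \<Rightarrow> bool" where
  "good E n i \<longleftrightarrow> (\<forall>g\<in>E. \<forall>h\<in>E. \<sigma> n g (\<sigma> n h i) = \<sigma> n (g \<otimes>\<^bsub>G\<^esub> h) i) \<and> inj_on (\<lambda>g. \<sigma> n g i) E"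

lemma negligible_not_multiplicative:
  assumes "g \<in> carrier G" "h \<in> carrier G"
  shows "negligible (\<lambda>n i. \<sigma> n g (\<sigma> n h i) \<noteq> \<sigma> n (g \<otimes>\<^bsub>G\<^esub> h) i)"
  using sofic assms by (intro negligible_complement) (simp add: sofic_approximation_def)

text \<open>Injectivity at \<open>i\<close> holds because \<open>\<sigma> g i = \<sigma> h i\<close>
  would make \<open>\<sigma> h i\<close> a fixed point of \<open>\<sigma> (g h\<inverse>)\<close>,
  unless multiplicativity fails at \<open>i\<close>.\<close>

lemma negligible_not_good:
  assumes "finite E" "E \<subseteq> carrier G"
  shows "negligible (\<lambda>n i. \<not> good E n i)"
proof -
  have E: "g \<in> carrier G" if "g \<in> E" for g using assms that by auto
  have 1: "negligible (\<lambda>n i. \<exists>g\<in>E. \<exists>h\<in>E. \<sigma> n g (\<sigma> n h i) \<noteq> \<sigma> n (g \<otimes>\<^bsub>G\<^esub> h) i)"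
    using assms E by (intro negligible_bex negligible_not_multiplicative) auto
  have 2: "negligible (\<lambda>n i. \<exists>g\<in>E. \<exists>h\<in>E. g \<noteq> h \<and> \<sigma> n g i = \<sigma> n h i)"
  proof (intro negligible_bex assms(1))
    fix g h assume gh: "g \<in> E" "h \<in> E"
    show "negligible (\<lambda>n i. g \<noteq> h \<and> \<sigma> n g i = \<sigma> n h i)"
    proof (cases "g = h")
      case True then show ?thesis by (simp add: negligible_def)
    next
      case False
      define k where "k = g \<otimes>\<^bsub>G\<^esub> inv\<^bsub>G\<^esub> h"
      have k: "k \<in> carrier G" "k \<otimes>\<^bsub>G\<^esub> h = g" using gh E by (auto simp: k_def G.m_assoc)
      then have k1: "k \<noteq> \<one>\<^bsub>G\<^esub>" using False gh E by auto
      have "negligible (\<lambda>n i. \<not> \<sigma> n k i \<noteq> i)"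
        using sofic k k1 by (intro negligible_complement) (simp add: sofic_approximation_def)
      from negligible_preimage[OF this E[OF gh(2)]]
      have "negligible (\<lambda>n i. \<sigma> n k (\<sigma> n h i) = \<sigma> n h i)" by simp
      from negligible_disj[OF this negligible_not_multiplicative[OF k(1) E[OF gh(2)]]]
      show ?thesis by (rule negligible_subset) (auto simp: k)
    qed
  qed
  show ?thesis
    by (rule negligible_subset[OF negligible_disj[OF 1 2]]) (auto simp: good_def inj_on_def)
qed

section \<open>Near models and their growth rate\<close>

text \<open>The colours seen from the site \<open>i\<close> through the window \<open>F\<close> form a
  piece of the orbit of a point.\<close>

definition realised :: "nat \<Rightarrow> 'g set \<Rightarrow> nat \<Rightarrow> ('d \<Rightarrow> nat) \<Rightarrow> 'd \<Rightarrow> bool" where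
  "realised m F n a i \<longleftrightarrow> (\<exists>x\<in>carrier H. \<forall>f\<in>F. a (\<sigma> n f i) = q m (act f x))"

text \<open>Symbolic counterparts of the approximately equivariant maps: no metric, no measure, and an
  arbitrary colouring on a small set of sites.\<close>

definition near_models :: "nat \<Rightarrow> 'g set \<Rightarrow> real \<Rightarrow> nat \<Rightarrow> ('d \<Rightarrow> nat) set" where
  "near_models m F \<epsilon> n =
     {a \<in> D n \<rightarrow>\<^sub>E carrier (K m). real (card {i \<in> D n. \<not> realised m F n a i}) \<le> \<epsilon> * real (card (D n))}"

definition projected_models :: "nat \<Rightarrow> nat \<Rightarrow> 'g set \<Rightarrow> real \<Rightarrow> nat \<Rightarrow> ('d \<Rightarrow> nat) set" where
  "projected_models m m' F \<epsilon> n = (\<lambda>a. compose (D n) (proj m' m) a) ` near_models m' F \<epsilon> n"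

definition model_growth :: "nat \<Rightarrow> nat \<Rightarrow> 'g set \<Rightarrow> real \<Rightarrow> ereal" where
  "model_growth m m' F \<epsilon> =
     limsup (\<lambda>n. log_count (enat (card (projected_models m m' F \<epsilon> n))) / ereal (card (D n)))"

definition model_entropy :: "nat \<Rightarrow> ereal" where
  "model_entropy m =
     (INF (m', F, \<epsilon>) \<in> {m..} \<times> finite_subsets (carrier G) \<times> {0<..}. model_growth m m' F \<epsilon>)"

lemma model_entropy_le:
  "\<lbrakk>m \<le> m'; finite F; F \<subseteq> carrier G; \<epsilon> > 0\<rbrakk> \<Longrightarrow> model_entropy m \<le> model_growth m m' F \<epsilon>"
  unfolding model_entropy_def
  by (rule INF_lower2[of "(m', F, \<epsilon>)"]) (auto simp: finite_subsets_def)

lemma le_model_entropy: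
  assumes "\<And>m' F \<epsilon>. \<lbrakk>m \<le> m'; finite F; F \<subseteq> carrier G; \<epsilon> > 0\<rbrakk> \<Longrightarrow> u \<le> model_growth m m' F \<epsilon>"
  shows "u \<le> model_entropy m"
  unfolding model_entropy_def
proof (rule INF_greatest, clarsimp simp: finite_subsets_def)
  fix m' F and \<epsilon> :: real
  assume "m \<le> m'" "0 < \<epsilon>" "finite F" "F \<subseteq> carrier G"
  then show "u \<le> model_growth m m' F \<epsilon>" by (intro assms)
qed

lemma near_models_PiE: "near_models m F \<epsilon> n \<subseteq> D n \<rightarrow>\<^sub>E carrier (K m)"
  by (auto simp: near_models_def)

lemma finite_near_models [simp]: "finite (near_models m F \<epsilon> n)"
  by (rule finite_subset[OF near_models_PiE]) (intro finite_PiE, auto simp: finite_K)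

lemma finite_projected_models [simp]: "finite (projected_models m m' F \<epsilon> n)"
  by (simp add: projected_models_def)

lemma projected_models_PiE:
  "m \<le> m' \<Longrightarrow> projected_models m m' F \<epsilon> n \<subseteq> D n \<rightarrow>\<^sub>E carrier (K m)"
  using near_models_PiE[of m' F \<epsilon> n] proj_closed[of m m']
  by (auto simp: projected_models_def compose_def PiE_iff subset_iff)

section \<open>Topological entropy is at most model entropy\<close>

text \<open>The pairs separated by \<open>q m\<close> form a compact set, covered by the open
  conditions that some group element moves a pair to a distance greater than \<open>1 / (k +
  1)\<close>; finitely many of these suffice.\<close>

lemma pseudometric_generates_levels:
  assumes \<rho>: "continuous_pseudometric T \<rho>" and gen: "generating_pseudometric G T act \<rho>"
  obtains E r where "finite E" "E \<subseteq> carrier G" "r > 0"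
    "\<And>x y. \<lbrakk>x \<in> carrier H; y \<in> carrier H; \<And>e. e \<in> E \<Longrightarrow> \<rho> (act e x) (act e y) < r\<rbrakk> \<Longrightarrow> q m x = q m y"
proof -
  let ?TT = "prod_topology T T"
  define Z where "Z = {z \<in> topspace ?TT. q m (fst z) \<noteq> q m (snd z)}"
  define U where "U = (\<lambda>(g, k). {z \<in> topspace ?TT. \<rho> (act g (fst z)) (act g (snd z)) \<in> {1 / real (Suc k)<..}})"
  have cont: "continuous_map ?TT euclideanreal (\<lambda>(x, y). \<rho> x y)"
    using \<rho> by (simp add: continuous_pseudometric_def)
  have U: "openin ?TT (U (g, k))" if g: "g \<in> carrier G" for g k
  proof -
    have "continuous_map ?TT T (\<lambda>z. act g (fst z))" "continuous_map ?TT T (\<lambda>z. act g (snd z))"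
      using continuous_map_compose[OF continuous_map_fst act_continuous[OF g]]
        continuous_map_compose[OF continuous_map_snd act_continuous[OF g]]
      by (simp_all add: comp_def)
    then have "continuous_map ?TT ?TT (\<lambda>z. (act g (fst z), act g (snd z)))"
      by (simp add: continuous_map_pairwise comp_def)
    from continuous_map_compose[OF this cont]
    have "continuous_map ?TT euclideanreal (\<lambda>z. \<rho> (act g (fst z)) (act g (snd z)))"
      by (simp add: comp_def)
    from openin_continuous_map_preimage[OF this, of "{1 / real (Suc k)<..}"]
    show ?thesis by (simp add: U_def)
  qed
  have "closedin ?TT Z"
  proof -
    let ?W = "\<lambda>k. {x \<in> carrier H. q m x = k} \<times> {x \<in> carrier H. q m x = k}"
    have "openin ?TT (?W k)" for k by (simp add: openin_prod_Times_iff fibre_open)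
    then have "openin ?TT (\<Union>k. ?W k)" by (intro openin_Union) blast
    moreover have "topspace ?TT - Z = (\<Union>k. ?W k)"
      unfolding Z_def topspace_prod_topology topspace_T by auto
    moreover have "Z \<subseteq> topspace ?TT" unfolding Z_def by blast
    ultimately show ?thesis by (simp add: closedin_def)
  qed
  moreover have "compact_space ?TT" using compact_T by (simp add: compact_space_prod_topology)
  ultimately have "compactin ?TT Z" using closedin_compact_space by blast
  then have "\<exists>\<F>. finite \<F> \<and> \<F> \<subseteq> U ` (carrier G \<times> UNIV) \<and> Z \<subseteq> \<Union>\<F>"
  proof (rule compactinD)
    show "openin ?TT V" if "V \<in> U ` (carrier G \<times> UNIV)" for V using that U by auto
    show "Z \<subseteq> \<Union> (U ` (carrier G \<times> UNIV))"
    proof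
      fix z assume z: "z \<in> Z"
      then have "fst z \<in> topspace T" "snd z \<in> topspace T" "fst z \<noteq> snd z" by (auto simp: Z_def)
      then obtain g where g: "g \<in> carrier G" "0 < \<rho> (act g (fst z)) (act g (snd z))"
        using gen unfolding generating_pseudometric_def by blast
      then obtain k where "1 / real (Suc k) < \<rho> (act g (fst z)) (act g (snd z))"
        using reals_Archimedean by (auto simp: inverse_eq_divide)
      then have "z \<in> U (g, k)" using z by (auto simp: U_def Z_def)
      then show "z \<in> \<Union> (U ` (carrier G \<times> UNIV))" using g by blast
    qed
  qed
  then obtain \<F> where \<F>: "finite \<F>" "\<F> \<subseteq> U ` (carrier G \<times> UNIV)" "Z \<subseteq> \<Union>\<F>" by auto
  from finite_subset_image[OF \<F>(1,2)]
  obtain J where J: "finite J" "J \<subseteq> carrier G \<times> UNIV" "\<F> = U ` J" by auto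
  define k0 where "k0 = Max (insert 0 (snd ` J))"
  show ?thesis
  proof (rule that[of "fst ` J" "1 / real (Suc k0)"])
    fix x y assume xy: "x \<in> carrier H" "y \<in> carrier H"
      and close: "\<And>e. e \<in> fst ` J \<Longrightarrow> \<rho> (act e x) (act e y) < 1 / real (Suc k0)"
    show "q m x = q m y"
    proof (rule ccontr)
      assume "q m x \<noteq> q m y"
      then have "(x, y) \<in> Z" using xy by (simp add: Z_def topspace_T)
      then obtain V where "V \<in> \<F>" "(x, y) \<in> V" using \<F>(3) by blast
      then obtain z where "z \<in> J" "(x, y) \<in> U z" using J(3) by blast
      then obtain g k where gk: "(g, k) \<in> J" "(x, y) \<in> U (g, k)" by (cases z) auto
      have "k \<le> k0" unfolding k0_def using J(1) gk by (intro Max_ge) force+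
      then have "1 / real (Suc k0) \<le> 1 / real (Suc k)" by (simp add: frac_le)
      also have "\<dots> < \<rho> (act g x) (act g y)" using gk by (simp add: U_def)
      finally show False using close[of g] gk by force
    qed
  qed (use J in auto)
qed

lemma pseudometricD:
  assumes "continuous_pseudometric T \<rho>"
  shows "x \<in> carrier H \<Longrightarrow> y \<in> carrier H \<Longrightarrow> 0 \<le> \<rho> x y"
    and "x \<in> carrier H \<Longrightarrow> \<rho> x x = 0"
    and "x \<in> carrier H \<Longrightarrow> y \<in> carrier H \<Longrightarrow> \<rho> x y = \<rho> y x"
    and "x \<in> carrier H \<Longrightarrow> y \<in> carrier H \<Longrightarrow> z \<in> carrier H \<Longrightarrow> \<rho> x z \<le> \<rho> x y + \<rho> y z"
  using assms by (simp_all add: continuous_pseudometric_def topspace_T)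

text \<open>Markov's inequality for the squared distances.\<close>

lemma rho_2_few_far:
  assumes "rho_2 \<rho> A \<phi> \<psi> < \<delta>" "finite A" "s > 0"
  shows "real (card {i \<in> A. s \<le> \<rho> (\<phi> i) (\<psi> i)}) \<le> (\<delta> / s)\<^sup>2 * real (card A)"
proof (cases "A = {}")
  case False
  then have A: "real (card A) > 0" using assms by (simp add: card_gt_0_iff)
  let ?B = "{i \<in> A. s \<le> \<rho> (\<phi> i) (\<psi> i)}"
  let ?q = "(\<Sum>i\<in>A. (\<rho> (\<phi> i) (\<psi> i))\<^sup>2) / card A"
  have "0 \<le> ?q" by (intro divide_nonneg_nonneg sum_nonneg) auto
  moreover have "(sqrt ?q)\<^sup>2 < \<delta>\<^sup>2"
    using assms(1) \<open>0 \<le> ?q\<close> by (intro power_strict_mono) (auto simp: rho_2_def)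
  ultimately have "?q < \<delta>\<^sup>2" by simp
  then have *: "(\<Sum>i\<in>A. (\<rho> (\<phi> i) (\<psi> i))\<^sup>2) < \<delta>\<^sup>2 * card A" using A by (simp add: field_simps)
  have "real (card ?B) * s\<^sup>2 = (\<Sum>i\<in>?B. s\<^sup>2)" by simp
  also have "\<dots> \<le> (\<Sum>i\<in>?B. (\<rho> (\<phi> i) (\<psi> i))\<^sup>2)"
    using assms by (intro sum_mono power_mono) auto
  also have "\<dots> \<le> (\<Sum>i\<in>A. (\<rho> (\<phi> i) (\<psi> i))\<^sup>2)" using assms by (intro sum_mono2) auto
  finally have "real (card ?B) * s\<^sup>2 \<le> \<delta>\<^sup>2 * card A" using * by simp
  then show ?thesis using assms by (simp add: power_divide field_simps)
qed simp

text \<open>An approximately equivariant \<open>\<phi>\<close> satisfies \<open>q m (\<phi> (f i)) = q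
  m (f (\<phi> i))\<close> at most sites \<open>i\<close>, so the point \<open>\<phi> i\<close>
  itself realises the pattern at \<open>i\<close>. To see the equality, compare both sides along a
  finite set \<open>E\<close> that determines \<open>q m\<close>: for \<open>e\<close> in
  \<open>E\<close>, the points \<open>e (\<phi> (f i))\<close> and \<open>e f (\<phi> i)\<close>
  are both close to \<open>\<phi> (e f i)\<close>. This is why the window \<open>F'\<close>
  consists of \<open>E\<close> and \<open>E F\<close>.\<close>

lemma sofic_Map_near_models:
  assumes \<rho>: "continuous_pseudometric T \<rho>" and gen: "generating_pseudometric G T act \<rho>"
    and F: "finite F" "F \<subseteq> carrier G" and \<epsilon>: "\<epsilon> > 0"
  obtains \<delta> F' where "\<delta> > 0" "finite F'" "F' \<subseteq> carrier G"
    "eventually (\<lambda>n. \<forall>\<phi>\<in>sofic_Map T act \<rho> F' \<delta> (D n) (\<sigma> n).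
       (\<lambda>i\<in>D n. q m (\<phi> i)) \<in> near_models m F \<epsilon> n) sequentially"
proof -
  obtain E r where E: "finite E" "E \<subseteq> carrier G" "r > 0"
    and sep: "\<And>x y. \<lbrakk>x \<in> carrier H; y \<in> carrier H; \<And>e. e \<in> E \<Longrightarrow> \<rho> (act e x) (act e y) < r\<rbrakk> \<Longrightarrow> q m x = q m y"
    using pseudometric_generates_levels[OF \<rho> gen, of m] by metis
  define F' where "F' = E \<union> (\<lambda>(e, f). e \<otimes>\<^bsub>G\<^esub> f) ` (E \<times> F)"
  have F': "finite F'" "F' \<subseteq> carrier G" using E F by (auto simp: F'_def)
  define N where "N = real (card E * card F) + 1"
  have N: "N > 0" by (simp add: N_def add_nonneg_pos)
  define \<delta> where "\<delta> = (r / 2) * sqrt (\<epsilon> / (4 * N))"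
  have \<delta>: "\<delta> > 0" "(\<delta> / (r / 2))\<^sup>2 = \<epsilon> / (4 * N)"
    using E \<epsilon> N by (auto simp: \<delta>_def power2_eq_square)
  have neg: "negligible (\<lambda>n i. \<exists>e\<in>E. \<exists>f\<in>F. \<sigma> n e (\<sigma> n f i) \<noteq> \<sigma> n (e \<otimes>\<^bsub>G\<^esub> f) i)"
    using E F by (intro negligible_bex negligible_not_multiplicative) auto
  have "eventually (\<lambda>n. \<forall>\<phi>\<in>sofic_Map T act \<rho> F' \<delta> (D n) (\<sigma> n).
       (\<lambda>i\<in>D n. q m (\<phi> i)) \<in> near_models m F \<epsilon> n) sequentially"
    using negligibleD[OF neg, of "\<epsilon> / 2"]
  proof (rule eventually_rev_mp, goal_cases)
    case 1 then show ?case using \<epsilon> by simp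
  next
    case 2
    show ?case
    proof (intro always_eventually allI impI ballI)
      fix n \<phi>
      let ?D = "D n" and ?N = "real (card (D n))"
      assume bad: "real (card {i \<in> ?D. \<exists>e\<in>E. \<exists>f\<in>F. \<sigma> n e (\<sigma> n f i) \<noteq> \<sigma> n (e \<otimes>\<^bsub>G\<^esub> f) i}) \<le> \<epsilon> / 2 * ?N"
        and \<phi>: "\<phi> \<in> sofic_Map T act \<rho> F' \<delta> ?D (\<sigma> n)"
      let ?a = "\<lambda>i\<in>?D. q m (\<phi> i)"
      have \<phi>H: "\<phi> i \<in> carrier H" if "i \<in> ?D" for i
        using \<phi> that by (auto simp: sofic_Map_def topspace_T)
      define far where "far = (\<lambda>g i. r / 2 \<le> \<rho> (\<phi> (\<sigma> n g i)) (act g (\<phi> i)))"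
      have far: "real (card {i \<in> ?D. far g i}) \<le> \<epsilon> / (4 * N) * ?N" if "g \<in> F'" for g
        using rho_2_few_far[of \<rho> ?D "\<lambda>i. \<phi> (\<sigma> n g i)" "\<lambda>i. act g (\<phi> i)" \<delta> "r / 2"] \<phi> that E(3) \<delta>(2)
        by (simp add: sofic_Map_def far_def)
      have real: "realised m F n ?a i"
        if i: "i \<in> ?D" and mult: "\<forall>e\<in>E. \<forall>f\<in>F. \<sigma> n e (\<sigma> n f i) = \<sigma> n (e \<otimes>\<^bsub>G\<^esub> f) i"
          and near: "\<forall>e\<in>E. \<forall>f\<in>F. \<not> far e (\<sigma> n f i) \<and> \<not> far (e \<otimes>\<^bsub>G\<^esub> f) i" for i
        unfolding realised_def
      proof (intro bexI[of _ "\<phi> i"] ballI)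
        fix f assume f: "f \<in> F"
        then have fG: "f \<in> carrier G" using F by auto
        have "q m (\<phi> (\<sigma> n f i)) = q m (act f (\<phi> i))"
        proof (rule sep)
          fix e assume e: "e \<in> E"
          then have eG: "e \<in> carrier G" using E by auto
          let ?z = "\<phi> (\<sigma> n (e \<otimes>\<^bsub>G\<^esub> f) i)"
          have zH: "?z \<in> carrier H" using \<phi>H i eG fG by simp
          have "\<rho> ?z (act e (\<phi> (\<sigma> n f i))) < r / 2" "\<rho> ?z (act e (act f (\<phi> i))) < r / 2"
            using mult near e f \<phi>H[OF i] eG fG by (auto simp: far_def act_act not_le)
          moreover have "\<rho> (act e (\<phi> (\<sigma> n f i))) (act e (act f (\<phi> i)))
              \<le> \<rho> (act e (\<phi> (\<sigma> n f i))) ?z + \<rho> ?z (act e (act f (\<phi> i)))"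
            by (rule pseudometricD(4)[OF \<rho>]) (use \<phi>H i eG fG in auto)
          moreover have "\<rho> (act e (\<phi> (\<sigma> n f i))) ?z = \<rho> ?z (act e (\<phi> (\<sigma> n f i)))"
            by (rule pseudometricD(3)[OF \<rho>]) (use \<phi>H i eG fG in auto)
          ultimately show "\<rho> (act e (\<phi> (\<sigma> n f i))) (act e (act f (\<phi> i))) < r" by linarith
        qed (use \<phi>H i fG in auto)
        then show "?a (\<sigma> n f i) = q m (act f (\<phi> i))" using i fG by simp
      qed (rule \<phi>H[OF i])
      let ?Bm = "{i \<in> ?D. \<exists>e\<in>E. \<exists>f\<in>F. \<sigma> n e (\<sigma> n f i) \<noteq> \<sigma> n (e \<otimes>\<^bsub>G\<^esub> f) i}"
      let ?B = "\<lambda>(e, f). {i \<in> ?D. far e (\<sigma> n f i)} \<union> {i \<in> ?D. far (e \<otimes>\<^bsub>G\<^esub> f) i}"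
      have B: "real (card (?B z)) \<le> \<epsilon> / (2 * N) * ?N" if "z \<in> E \<times> F" for z
      proof -
        obtain e f where z: "z = (e, f)" "e \<in> E" "f \<in> F" using \<open>z \<in> E \<times> F\<close> by auto
        have fG: "f \<in> carrier G" using z F by auto
        have "card (?B z) \<le> card {i \<in> ?D. far e (\<sigma> n f i)} + card {i \<in> ?D. far (e \<otimes>\<^bsub>G\<^esub> f) i}"
          unfolding z by (simp add: card_Un_le)
        moreover have "e \<in> F'" "e \<otimes>\<^bsub>G\<^esub> f \<in> F'" using z by (auto simp: F'_def)
        ultimately show ?thesis
          using far[of e] far[of "e \<otimes>\<^bsub>G\<^esub> f"] card_sigma_preimage[OF fG, of n "far e"]
          by (simp add: field_simps)
      qed
      have sub: "{i \<in> ?D. \<not> realised m F n ?a i} \<subseteq> ?Bm \<union> (\<Union>z\<in>E \<times> F. ?B z)"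
      proof
        fix i assume "i \<in> {i \<in> ?D. \<not> realised m F n ?a i}"
        then show "i \<in> ?Bm \<union> (\<Union>z\<in>E \<times> F. ?B z)" using real[of i] by fastforce
      qed
      have "card {i \<in> ?D. \<not> realised m F n ?a i} \<le> card (?Bm \<union> (\<Union>z\<in>E \<times> F. ?B z))"
        by (rule card_mono[OF _ sub]) (use E F in auto)
      also have "\<dots> \<le> card ?Bm + card (\<Union>z\<in>E \<times> F. ?B z)" by (rule card_Un_le)
      finally have 1: "card {i \<in> ?D. \<not> realised m F n ?a i} \<le> card ?Bm + card (\<Union>z\<in>E \<times> F. ?B z)" .
      have "card (\<Union>z\<in>E \<times> F. ?B z) \<le> (\<Sum>z\<in>E \<times> F. card (?B z))"
        by (rule card_UN_le) (use E F in auto)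
      then have "real (card (\<Union>z\<in>E \<times> F. ?B z)) \<le> real (\<Sum>z\<in>E \<times> F. card (?B z))"
        by (simp only: of_nat_le_iff)
      also have "\<dots> = (\<Sum>z\<in>E \<times> F. real (card (?B z)))" by (rule of_nat_sum)
      also have "\<dots> \<le> (\<Sum>z\<in>E \<times> F. \<epsilon> / (2 * N) * ?N)" by (rule sum_mono) (rule B)
      also have "\<dots> = (real (card E * card F) / N) * (\<epsilon> / 2 * ?N)" by (simp add: card_cartesian_product)
      also have "\<dots> \<le> 1 * (\<epsilon> / 2 * ?N)"
        using \<epsilon> N by (intro mult_right_mono) (auto simp: N_def)
      finally have "real (card {i \<in> ?D. \<not> realised m F n ?a i}) \<le> \<epsilon> * ?N" using 1 bad by linarith
      then show "?a \<in> near_models m F \<epsilon> n" using \<phi>H by (simp add: near_models_def)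
    qed
  qed
  then show ?thesis by (rule that[OF \<delta>(1) F'])
qed

text \<open>If the fibres of \<open>q m\<close> have diameter less than \<open>\<kappa>\<close>, then
  \<open>\<kappa>\<close>-separated maps have different projections to level \<open>m\<close>, and
  these projections are projected near models.\<close>

lemma topological_entropy_le_model_entropy:
  assumes \<rho>: "continuous_pseudometric T \<rho>" and gen: "generating_pseudometric G T act \<rho>"
  shows "topological_sofic_entropy G T act \<rho> D \<sigma> \<le> (SUP m. model_entropy m)"
  unfolding topological_sofic_entropy_def
proof (rule SUP_least)
  fix \<kappa> :: real assume "\<kappa> \<in> {0<..}"
  then have \<kappa>: "\<kappa> > 0" by simp
  obtain m where m: "\<And>m' x y. \<lbrakk>m \<le> m'; x \<in> carrier H; y \<in> carrier H; q m' x = q m' y\<rbrakk> \<Longrightarrow> \<rho> x y < \<kappa>"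
    using fibres_uniformly_small[OF \<rho> \<kappa>] by blast
  let ?L = "\<lambda>\<delta> F. limsup (\<lambda>n. log_count (separation_number (rho_inf \<rho> (D n)) \<kappa>
                (sofic_Map T act \<rho> F \<delta> (D n) (\<sigma> n))) / ereal (card (D n)))"
  have "(INF \<delta>\<in>{0<..}. INF F\<in>finite_subsets (carrier G). ?L \<delta> F) \<le> model_entropy m"
  proof (rule le_model_entropy)
    fix m' F and \<epsilon> :: real assume m': "m \<le> m'" and F: "finite F" "F \<subseteq> carrier G" "\<epsilon> > 0"
    obtain \<delta> F' where \<delta>: "\<delta> > 0" and F': "finite F'" "F' \<subseteq> carrier G"
      and ev: "eventually (\<lambda>n. \<forall>\<phi>\<in>sofic_Map T act \<rho> F' \<delta> (D n) (\<sigma> n).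
       (\<lambda>i\<in>D n. q m' (\<phi> i)) \<in> near_models m' F \<epsilon> n) sequentially"
      using sofic_Map_near_models[OF \<rho> gen F, of m'] by blast
    have "?L \<delta> F' \<le> model_growth m m' F \<epsilon>"
      unfolding model_growth_def
    proof (rule Limsup_mono)
      show "eventually (\<lambda>n. log_count (separation_number (rho_inf \<rho> (D n)) \<kappa>
                (sofic_Map T act \<rho> F' \<delta> (D n) (\<sigma> n))) / ereal (card (D n))
          \<le> log_count (enat (card (projected_models m m' F \<epsilon> n))) / ereal (card (D n))) sequentially"
        using ev eventually_D_pos
      proof eventually_elim
        case (elim n)
        let ?M = "sofic_Map T act \<rho> F' \<delta> (D n) (\<sigma> n)"
        have "separation_number (rho_inf \<rho> (D n)) \<kappa> ?M \<le> enat (card (projected_models m m' F \<epsilon> n))"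
          unfolding separation_number_def
        proof (rule Sup_least, clarify)
          fix S assume S: "finite S" "S \<subseteq> ?M" "pairwise (\<lambda>\<phi> \<psi>. \<kappa> \<le> rho_inf \<rho> (D n) \<phi> \<psi>) S"
          have H: "\<phi> i \<in> carrier H" if "\<phi> \<in> S" "i \<in> D n" for \<phi> i
            using that S(2) by (auto simp: sofic_Map_def topspace_T)
          define p where "p = (\<lambda>\<phi>. compose (D n) (proj m' m) (\<lambda>i\<in>D n. q m' (\<phi> i)))"
          have "inj_on p S"
          proof (rule inj_onI, rule ccontr)
            fix \<phi> \<psi> assume \<phi>\<psi>: "\<phi> \<in> S" "\<psi> \<in> S" "p \<phi> = p \<psi>" "\<phi> \<noteq> \<psi>"
            have "\<rho> (\<phi> i) (\<psi> i) < \<kappa>" if i: "i \<in> D n" for i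
            proof -
              have "p \<phi> i = p \<psi> i" using \<phi>\<psi> by simp
              then have "q m (\<phi> i) = q m (\<psi> i)"
                using H \<phi>\<psi> i m' by (simp add: p_def compose_eq proj_q)
              then show ?thesis using m[of m] H \<phi>\<psi> i by simp
            qed
            then have "rho_inf \<rho> (D n) \<phi> \<psi> < \<kappa>"
              unfolding rho_inf_def using elim(2) by (subst Max_less_iff) (auto simp: card_gt_0_iff)
            moreover have "\<kappa> \<le> rho_inf \<rho> (D n) \<phi> \<psi>" using S(3) \<phi>\<psi> by (auto simp: pairwise_def)
            ultimately show False by simp
          qed
          moreover have "p ` S \<subseteq> projected_models m m' F \<epsilon> n"
            using elim(1) S(2) by (auto simp: p_def projected_models_def)
          ultimately have "card S \<le> card (projected_models m m' F \<epsilon> n)"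
            by (intro card_inj_on_le[of p]) auto
          then show "enat (card S) \<le> enat (card (projected_models m m' F \<epsilon> n))" by simp
        qed
        then show ?case using elim(2) by (intro log_count_per_site_mono)
      qed
    qed
    moreover have "(INF \<delta>\<in>{0<..}. INF F\<in>finite_subsets (carrier G). ?L \<delta> F) \<le> ?L \<delta> F'"
      by (rule INF_lower2[of \<delta>], use \<delta> in simp, rule INF_lower)
        (use F' in \<open>simp add: finite_subsets_def\<close>)
    ultimately show "(INF \<delta>\<in>{0<..}. INF F\<in>finite_subsets (carrier G). ?L \<delta> F) \<le> model_growth m m' F \<epsilon>"
      by (rule order_trans[rotated])
  qed
  also have "\<dots> \<le> (SUP m. model_entropy m)" by (rule SUP_upper) simp
  finally show "(INF \<delta>\<in>{0<..}. INF F\<in>finite_subsets (carrier G). ?L \<delta> F) \<le> (SUP m. model_entropy m)" .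
qed

section \<open>Model entropy is at most topological entropy\<close>

text \<open>An unrealised site receives the neutral element as a default value.\<close>

definition lift :: "nat \<Rightarrow> 'g set \<Rightarrow> nat \<Rightarrow> ('d \<Rightarrow> nat) \<Rightarrow> 'd \<Rightarrow> 'h" where
  "lift m F n a = (\<lambda>i\<in>D n. if realised m F n a i
     then SOME x. x \<in> carrier H \<and> (\<forall>f\<in>F. a (\<sigma> n f i) = q m (act f x)) else \<one>\<^bsub>H\<^esub>)"

lemma lift_realised:
  assumes "realised m F n a i" "i \<in> D n"
  shows "lift m F n a i \<in> carrier H" "\<And>f. f \<in> F \<Longrightarrow> a (\<sigma> n f i) = q m (act f (lift m F n a i))"
proof -
  have "\<exists>x. x \<in> carrier H \<and> (\<forall>f\<in>F. a (\<sigma> n f i) = q m (act f x))"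
    using assms(1) by (auto simp: realised_def)
  note ex = someI_ex[OF this]
  have "lift m F n a i = (SOME x. x \<in> carrier H \<and> (\<forall>f\<in>F. a (\<sigma> n f i) = q m (act f x)))"
    using assms by (simp add: lift_def)
  note * = ex[folded this]
  show "lift m F n a i \<in> carrier H" "\<And>f. f \<in> F \<Longrightarrow> a (\<sigma> n f i) = q m (act f (lift m F n a i))"
    using * by blast+
qed

lemma lift_closed: "i \<in> D n \<Longrightarrow> lift m F n a i \<in> carrier H"
  using lift_realised(1)[of m F n a i] by (cases "realised m F n a i") (simp_all add: lift_def)

text \<open>The sites from which the window meets an unrealised site. Off this set the lift is
  equivariant up to \<open>q m\<close>.\<close>

definition boundary :: "nat \<Rightarrow> 'g set \<Rightarrow> nat \<Rightarrow> ('d \<Rightarrow> nat) \<Rightarrow> 'd set" where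
  "boundary m F n a = {i \<in> D n. \<exists>f\<in>F. \<not> realised m F n a (\<sigma> n f i)}"

lemma card_boundary:
  assumes "finite F" "F \<subseteq> carrier G" "a \<in> near_models m F \<epsilon> n"
  shows "real (card (boundary m F n a)) \<le> real (card F) * \<epsilon> * real (card (D n))"
proof -
  let ?B = "\<lambda>f. {i \<in> D n. \<not> realised m F n a (\<sigma> n f i)}"
  have "card (boundary m F n a) = card (\<Union>f\<in>F. ?B f)"
    by (rule arg_cong[of _ _ card]) (auto simp: boundary_def)
  also have "\<dots> \<le> (\<Sum>f\<in>F. card (?B f))" by (rule card_UN_le) fact
  also have "\<dots> = (\<Sum>f\<in>F. card {i \<in> D n. \<not> realised m F n a i})"
    by (rule sum.cong[OF refl], rule card_sigma_preimage) (use assms in auto)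
  also have "\<dots> = card F * card {i \<in> D n. \<not> realised m F n a i}" by simp
  finally have "real (card (boundary m F n a)) \<le> real (card F * card {i \<in> D n. \<not> realised m F n a i})"
    by (simp only: of_nat_le_iff)
  also have "\<dots> = real (card F) * real (card {i \<in> D n. \<not> realised m F n a i})" by simp
  also have "\<dots> \<le> real (card F) * (\<epsilon> * real (card (D n)))"
    using assms(3) by (intro mult_left_mono) (auto simp: near_models_def)
  finally show ?thesis by (simp add: mult.assoc)
qed

text \<open>Both sites \<open>i\<close> and \<open>f i\<close> are realised; the window contains the
  identity, so the lift projects back to the colouring at \<open>f i\<close>, and the pattern at
  \<open>i\<close> gives the second equation.\<close>

lemma lift_off_boundary:
  assumes F: "F \<subseteq> carrier G" "\<one>\<^bsub>G\<^esub> \<in> F" and i: "i \<in> D n" "i \<notin> boundary m F n a" and f: "f \<in> F"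
  shows "q m (lift m F n a (\<sigma> n f i)) = a (\<sigma> n f i)" "q m (act f (lift m F n a i)) = a (\<sigma> n f i)"
proof -
  have r: "realised m F n a (\<sigma> n g i)" if "g \<in> F" for g
    using i that by (auto simp: boundary_def)
  have fi: "\<sigma> n f i \<in> D n" using F f i by auto
  show "q m (lift m F n a (\<sigma> n f i)) = a (\<sigma> n f i)"
    using lift_realised(2)[OF r[OF f] fi F(2)] lift_closed[OF fi] by simp
  show "q m (act f (lift m F n a i)) = a (\<sigma> n f i)"
    using lift_realised(2)[OF r[OF F(2)]] i f by simp
qed

lemma lift_in_sofic_Map:
  assumes \<rho>: "continuous_pseudometric T \<rho>" and F: "F \<subseteq> carrier G" "\<one>\<^bsub>G\<^esub> \<in> F"
    and small: "\<And>x y. \<lbrakk>x \<in> carrier H; y \<in> carrier H; q m x = q m y\<rbrakk> \<Longrightarrow> \<rho> x y < \<delta> / 2"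
    and B: "B > 0" "\<And>x y. x \<in> carrier H \<Longrightarrow> y \<in> carrier H \<Longrightarrow> \<rho> x y \<le> B"
    and \<delta>: "\<delta> > 0" and D: "card (D n) > 0" and E: "E \<subseteq> F"
    and bd: "B\<^sup>2 * real (card (boundary m F n a)) \<le> \<delta>\<^sup>2 / 4 * real (card (D n))"
  shows "lift m F n a \<in> sofic_Map T act \<rho> E \<delta> (D n) (\<sigma> n)"
proof -
  let ?\<phi> = "lift m F n a" and ?S = "boundary m F n a" and ?N = "real (card (D n))"
  have "rho_2 \<rho> (D n) (\<lambda>i. ?\<phi> (\<sigma> n f i)) (\<lambda>i. act f (?\<phi> i)) < \<delta>" if "f \<in> E" for f
  proof -
    have f: "f \<in> F" "f \<in> carrier G" using that E F by auto
    let ?r = "\<lambda>i. (\<rho> (?\<phi> (\<sigma> n f i)) (act f (?\<phi> i)))\<^sup>2"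
    have H: "?\<phi> (\<sigma> n f i) \<in> carrier H" "act f (?\<phi> i) \<in> carrier H" if "i \<in> D n" for i
      using that f lift_closed by auto
    have "(\<Sum>i\<in>D n. ?r i) \<le> (\<Sum>i\<in>D n. \<delta>\<^sup>2 / 4 + (if i \<in> ?S then B\<^sup>2 else 0))"
    proof (rule sum_mono)
      fix i assume i: "i \<in> D n"
      have pos: "0 \<le> \<rho> (?\<phi> (\<sigma> n f i)) (act f (?\<phi> i))" by (rule pseudometricD(1)[OF \<rho> H[OF i]])
      show "?r i \<le> \<delta>\<^sup>2 / 4 + (if i \<in> ?S then B\<^sup>2 else 0)"
      proof (cases "i \<in> ?S")
        case True
        have "?r i \<le> B\<^sup>2" using B(2)[OF H[OF i]] pos by (intro power_mono)
        then show ?thesis using True by (simp add: add_increasing)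
      next
        case False
        have "\<rho> (?\<phi> (\<sigma> n f i)) (act f (?\<phi> i)) < \<delta> / 2"
          by (rule small[OF H[OF i]]) (simp add: lift_off_boundary[OF F i False f(1)])
        then have "?r i \<le> (\<delta> / 2)\<^sup>2" using pos by (intro power_mono) auto
        then show ?thesis using False by (simp add: power_divide)
      qed
    qed
    also have "\<dots> = ?N * (\<delta>\<^sup>2 / 4) + B\<^sup>2 * real (card ?S)"
    proof -
      have "{i \<in> D n. i \<in> ?S} = ?S" by (auto simp: boundary_def)
      then have "(\<Sum>i\<in>D n. if i \<in> ?S then B\<^sup>2 else 0) = B\<^sup>2 * real (card ?S)"
        by (simp add: sum.inter_filter[symmetric])
      then show ?thesis by (simp add: sum.distrib)
    qed
    also have "\<dots> \<le> ?N * (\<delta>\<^sup>2 / 2)" using bd by (simp add: field_simps)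
    also have "\<dots> < ?N * \<delta>\<^sup>2" using D \<delta> by simp
    finally have "(\<Sum>i\<in>D n. ?r i) / ?N < \<delta>\<^sup>2" using D by (simp add: field_simps)
    then have "sqrt ((\<Sum>i\<in>D n. ?r i) / ?N) < sqrt (\<delta>\<^sup>2)" by (simp only: real_sqrt_less_iff)
    then show ?thesis using \<delta> by (simp add: rho_2_def)
  qed
  moreover have "?\<phi> \<in> D n \<rightarrow>\<^sub>E topspace T"
    using lift_closed by (auto simp: topspace_T) (auto simp: lift_def)
  ultimately show ?thesis by (simp add: sofic_Map_def)
qed

text \<open>Choose one near model for every projected near model and lift it. Sort the projected near
  models by the boundary and by their colours on the boundary. Two different members of one class
  differ at a site off the boundary, where the lifts have different images under \<open>q
  m\<close>. A generating pseudometric sees this difference only after moving by some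
  \<open>e\<close> in \<open>E\<close>; but off the boundary \<open>e (\<phi> i)\<close> is close
  to \<open>\<phi> (e i)\<close>, so the lifts are far apart at the site \<open>e i\<close>. Hence
  the lifts of a class are separated, and there are few classes.\<close>

lemma model_entropy_le_topological_entropy:
  assumes \<rho>: "continuous_pseudometric T \<rho>" and gen: "generating_pseudometric G T act \<rho>"
  shows "model_entropy m \<le> topological_sofic_entropy G T act \<rho> D \<sigma>"
proof (rule ereal_le_epsilon2)
  fix c :: real assume c: "c > 0"
  obtain E r where E: "finite E" "E \<subseteq> carrier G" "r > 0"
    and sep: "\<And>x y. \<lbrakk>x \<in> carrier H; y \<in> carrier H; \<And>e. e \<in> E \<Longrightarrow> \<rho> (act e x) (act e y) < r\<rbrakk> \<Longrightarrow> q m x = q m y"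
    using pseudometric_generates_levels[OF \<rho> gen, of m] by metis
  obtain B where B: "B > 0" "\<And>x y. x \<in> carrier H \<Longrightarrow> y \<in> carrier H \<Longrightarrow> \<rho> x y \<le> B"
    using pseudometric_bounded[OF \<rho>] by metis
  obtain t where t: "t > 0" and count: "\<And>A :: 'd set. finite A \<Longrightarrow>
      (\<Sum>S | S \<subseteq> A \<and> real (card S) \<le> t * real (card A). real (card (carrier (K m))) ^ card S) \<le> exp (c * real (card A))"
    using few_small_modifications[OF c, of "real (card (carrier (K m)))"] by auto
  let ?L = "\<lambda>\<delta> F. limsup (\<lambda>n. log_count (separation_number (rho_inf \<rho> (D n)) (r / 2)
                (sofic_Map T act \<rho> F \<delta> (D n) (\<sigma> n))) / ereal (card (D n)))"
  have main: "model_entropy m \<le> ?L \<delta> F0 + ereal c"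
    if \<delta>: "\<delta> > 0" and F0: "finite F0" "F0 \<subseteq> carrier G" for \<delta> F0
  proof -
    have "min (\<delta> / 2) (r / 4) > 0" using \<delta> E by simp
    then obtain m0 where m0: "\<And>m x y. \<lbrakk>m0 \<le> m; x \<in> carrier H; y \<in> carrier H; q m x = q m y\<rbrakk> \<Longrightarrow> \<rho> x y < min (\<delta> / 2) (r / 4)"
      using fibres_uniformly_small[OF \<rho>] by metis
    \<comment> \<open>Deep enough for the lift to be \<open>\<delta>\<close>-equivariant and for each of the two
      comparisons of \<open>e (\<phi> i)\<close> with \<open>\<phi> (e i)\<close> to cost less than \<open>r / 4\<close>.\<close>
    define m' where "m' = max m m0"
    have m': "m \<le> m'" by (simp add: m'_def)
    have small: "\<rho> x y < \<delta> / 2" "\<rho> x y < r / 4" if "x \<in> carrier H" "y \<in> carrier H" "q m' x = q m' y" for x y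
      using m0[of m' x y] that by (auto simp: m'_def)
    define F where "F = insert \<one>\<^bsub>G\<^esub> (F0 \<union> E)"
    have F: "finite F" "F \<subseteq> carrier G" "\<one>\<^bsub>G\<^esub> \<in> F" "F0 \<subseteq> F" "E \<subseteq> F"
      using F0 E by (auto simp: F_def)
    define \<epsilon> where "\<epsilon> = min t (\<delta>\<^sup>2 / (4 * B\<^sup>2)) / (real (card F) + 1)"
    have cF: "real (card F) + 1 > 0" by (simp add: add_nonneg_pos)
    have \<epsilon>: "\<epsilon> > 0" using t \<delta> B cF by (simp add: \<epsilon>_def)
    have "real (card F) * \<epsilon> \<le> (real (card F) + 1) * \<epsilon>" using \<epsilon> by (simp add: mult_right_mono)
    also have "\<dots> = min t (\<delta>\<^sup>2 / (4 * B\<^sup>2))" using cF by (simp add: \<epsilon>_def)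
    finally have F\<epsilon>: "real (card F) * \<epsilon> \<le> t" "real (card F) * \<epsilon> \<le> \<delta>\<^sup>2 / (4 * B\<^sup>2)" by auto
    have "model_entropy m \<le> model_growth m m' F \<epsilon>" using m' F \<epsilon> by (intro model_entropy_le)
    also have "\<dots> \<le> ?L \<delta> F0 + ereal c"
      unfolding model_growth_def
    proof (rule limsup_le_limsup_add)
      show "eventually (\<lambda>n. log_count (enat (card (projected_models m m' F \<epsilon> n))) / ereal (card (D n))
        \<le> log_count (separation_number (rho_inf \<rho> (D n)) (r / 2)
                (sofic_Map T act \<rho> F0 \<delta> (D n) (\<sigma> n))) / ereal (card (D n)) + ereal c) sequentially"
        using eventually_D_pos
      proof eventually_elim
        case (elim n)
        let ?N = "real (card (D n))"
        let ?Map = "sofic_Map T act \<rho> F0 \<delta> (D n) (\<sigma> n)"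
        let ?Y = "projected_models m m' F \<epsilon> n"
        have "\<forall>y\<in>?Y. \<exists>a. a \<in> near_models m' F \<epsilon> n \<and> y = compose (D n) (proj m' m) a"
          by (auto simp: projected_models_def)
        from bchoice[OF this] obtain pre where
          pre: "\<forall>y\<in>?Y. pre y \<in> near_models m' F \<epsilon> n \<and> y = compose (D n) (proj m' m) (pre y)" ..
        define S where "S = (\<lambda>y. boundary m' F n (pre y))"
        define \<phi> where "\<phi> = (\<lambda>y. lift m' F n (pre y))"
        have S: "S y \<subseteq> D n" "real (card (S y)) \<le> t * ?N" "B\<^sup>2 * real (card (S y)) \<le> \<delta>\<^sup>2 / 4 * ?N"
          if "y \<in> ?Y" for y
        proof -
          have 1: "real (card (S y)) \<le> real (card F) * \<epsilon> * ?N"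
            unfolding S_def by (rule card_boundary) (use F pre that in auto)
          show "S y \<subseteq> D n" by (auto simp: S_def boundary_def)
          show "real (card (S y)) \<le> t * ?N"
            using 1 mult_right_mono[OF F\<epsilon>(1), of ?N] by linarith
          have "real (card (S y)) \<le> \<delta>\<^sup>2 / (4 * B\<^sup>2) * ?N"
            using 1 mult_right_mono[OF F\<epsilon>(2), of ?N] by linarith
          then show "B\<^sup>2 * real (card (S y)) \<le> \<delta>\<^sup>2 / 4 * ?N"
            using B(1) by (simp add: field_simps)
        qed
        have \<phi>Map: "\<phi> y \<in> ?Map" if "y \<in> ?Y" for y
          unfolding \<phi>_def
          by (rule lift_in_sofic_Map[OF \<rho> F(2,3) small(1) B \<delta> elim F(4)])
            (use S(3)[OF that] in \<open>simp_all add: S_def\<close>)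
        have \<phi>H: "\<phi> y i \<in> carrier H" if "i \<in> D n" for y i
          using lift_closed[OF that] by (simp add: \<phi>_def)
        have far: "r / 2 \<le> rho_inf \<rho> (D n) (\<phi> y) (\<phi> z)"
          if yz: "y \<in> ?Y" "z \<in> ?Y" "y \<noteq> z" "S y = S z" "restrict y (S y) = restrict z (S y)" for y z
        proof -
          have "y \<in> D n \<rightarrow>\<^sub>E carrier (K m)" "z \<in> D n \<rightarrow>\<^sub>E carrier (K m)"
            using projected_models_PiE[OF m', of F \<epsilon> n] yz(1,2) by blast+
          then obtain i where i: "i \<in> D n" "y i \<noteq> z i" using yz(3) PiE_ext by blast
          have iS: "i \<notin> S y" using i(2) yz(5) by (metis restrict_apply')
          have val: "q m (\<phi> w i) = w i" "\<And>e. e \<in> E \<Longrightarrow> q m' (\<phi> w (\<sigma> n e i)) = q m' (act e (\<phi> w i))"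
            if w: "w \<in> ?Y" "i \<notin> S w" for w
          proof -
            note off = lift_off_boundary[OF F(2,3) i(1) w(2)[unfolded S_def], folded \<phi>_def]
            have "q m' (\<phi> w i) = pre w i" using off(1)[OF F(3)] by (simp add: \<phi>_def)
            then have "q m (\<phi> w i) = proj m' m (pre w i)"
              using proj_q[OF m' \<phi>H[OF i(1), of w]] by simp
            also have "\<dots> = w i" using pre w(1) i(1) by (metis compose_eq)
            finally show "q m (\<phi> w i) = w i" .
            show "q m' (\<phi> w (\<sigma> n e i)) = q m' (act e (\<phi> w i))" if "e \<in> E" for e
              using off[of e] that F(5) by (auto simp: \<phi>_def)
          qed
          have "q m (\<phi> y i) \<noteq> q m (\<phi> z i)"
            using val(1)[OF yz(1)] val(1)[OF yz(2)] iS yz(4) i(2) by simp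
          then obtain e where e: "e \<in> E" "\<not> \<rho> (act e (\<phi> y i)) (act e (\<phi> z i)) < r"
            using sep[OF \<phi>H[OF i(1)] \<phi>H[OF i(1)]] by blast
          have eG: "e \<in> carrier G" using e E by auto
          let ?j = "\<sigma> n e i"
          have j: "?j \<in> D n" using eG i by simp
          have H: "act e (\<phi> y i) \<in> carrier H" "act e (\<phi> z i) \<in> carrier H" "\<phi> y ?j \<in> carrier H" "\<phi> z ?j \<in> carrier H"
            using eG \<phi>H i j by auto
          have vy: "q m' (\<phi> y ?j) = q m' (act e (\<phi> y i))" and vz: "q m' (\<phi> z ?j) = q m' (act e (\<phi> z i))"
            using val(2)[OF yz(1) _ e(1)] val(2)[OF yz(2) _ e(1)] iS yz(4) by simp_all
          have "\<rho> (act e (\<phi> y i)) (\<phi> y ?j) < r / 4" by (rule small(2)[OF H(1,3) vy[symmetric]])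
          moreover have "\<rho> (\<phi> z ?j) (act e (\<phi> z i)) < r / 4" by (rule small(2)[OF H(4,2) vz])
          moreover have "\<rho> (act e (\<phi> y i)) (act e (\<phi> z i))
              \<le> \<rho> (act e (\<phi> y i)) (\<phi> y ?j) + \<rho> (\<phi> y ?j) (act e (\<phi> z i))"
            by (rule pseudometricD(4)[OF \<rho>]) (use H in auto)
          moreover have "\<rho> (\<phi> y ?j) (act e (\<phi> z i)) \<le> \<rho> (\<phi> y ?j) (\<phi> z ?j) + \<rho> (\<phi> z ?j) (act e (\<phi> z i))"
            by (rule pseudometricD(4)[OF \<rho>]) (use H in auto)
          ultimately have "r / 2 \<le> \<rho> (\<phi> y ?j) (\<phi> z ?j)" using e(2) by linarith
          also have "\<dots> \<le> rho_inf \<rho> (D n) (\<phi> y) (\<phi> z)"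
            unfolding rho_inf_def using j by (intro Max_ge) auto
          finally show ?thesis .
        qed
        define cls where "cls = (\<lambda>R s. {y \<in> ?Y. S y = R \<and> restrict y R = s})"
        have cls: "enat (card (cls R s)) \<le> separation_number (rho_inf \<rho> (D n)) (r / 2) ?Map" for R s
        proof -
          have far': "r / 2 \<le> rho_inf \<rho> (D n) (\<phi> y) (\<phi> z)"
            if "y \<in> cls R s" "z \<in> cls R s" "y \<noteq> z" for y z
            using that by (intro far) (auto simp: cls_def)
          have self: "rho_inf \<rho> (D n) (\<phi> y) (\<phi> y) = 0" for y
          proof -
            have "(\<lambda>i. \<rho> (\<phi> y i) (\<phi> y i)) ` D n = {0}"
              using elim pseudometricD(2)[OF \<rho>] \<phi>H by (auto simp: card_gt_0_iff image_iff)
            then show ?thesis by (simp add: rho_inf_def)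
          qed
          have inj: "inj_on \<phi> (cls R s)"
          proof (rule inj_onI, rule ccontr)
            fix y z assume "y \<in> cls R s" "z \<in> cls R s" "\<phi> y = \<phi> z" "y \<noteq> z"
            then show False using far'[of y z] self[of z] E(3) by simp
          qed
          have "finite (cls R s)" by (simp add: cls_def)
          then have "enat (card (\<phi> ` cls R s)) \<le> separation_number (rho_inf \<rho> (D n)) (r / 2) ?Map"
            by (intro enat_card_le_separation_number)
              (use \<phi>Map far' in \<open>auto simp: pairwise_def cls_def\<close>)
          then show ?thesis by (simp add: card_image[OF inj])
        qed
        show ?case
        proof (cases "separation_number (rho_inf \<rho> (D n)) (r / 2) ?Map")
          case (enat k)
          have "real (card ?Y) \<le> (\<Sum>R | R \<subseteq> D n \<and> real (card R) \<le> t * ?N. real (card (carrier (K m))) ^ card R) * real k"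
          proof (rule card_le_small_modifications)
            show "?Y \<subseteq> D n \<rightarrow>\<^sub>E carrier (K m)" by (rule projected_models_PiE[OF m'])
            show "card {y \<in> ?Y. S y = R \<and> restrict y R = s} \<le> k" for R s
              using cls[of R s] enat by (simp add: cls_def)
          qed (use S finite_K in auto)
          also have "\<dots> \<le> exp (c * ?N) * real k" by (intro mult_right_mono count) auto
          finally have "real (card ?Y) \<le> exp (c * ?N) * real k" .
          from log_count_per_site_le[OF elim this, of "separation_number (rho_inf \<rho> (D n)) (r / 2) ?Map"]
          show ?thesis using enat by simp
        next
          case infinity
          have "log_count \<infinity> / ereal ?N = \<infinity>" using elim by (simp add: log_count_def)
          then show ?thesis using infinity by simp
        qed
      qed
    qed
    finally show ?thesis .
  qed
  have "model_entropy m - ereal c \<le> (INF \<delta>\<in>{0<..}. INF F\<in>finite_subsets (carrier G). ?L \<delta> F)"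
    using main by (intro INF_greatest) (auto simp: ereal_minus_le finite_subsets_def)
  also have "\<dots> \<le> topological_sofic_entropy G T act \<rho> D \<sigma>"
    unfolding topological_sofic_entropy_def by (rule SUP_upper) (use E in simp)
  finally show "model_entropy m \<le> topological_sofic_entropy G T act \<rho> D \<sigma> + ereal c"
    by (simp add: ereal_minus_le)
qed

section \<open>Measured entropy is at most model entropy\<close>

lemma observable_orbit_cell:
  assumes \<alpha>: "\<alpha> \<in> measurable \<mu> (count_space A)" and F: "finite F" "F \<subseteq> carrier G" and p: "p \<in> F \<rightarrow>\<^sub>E A"
  shows "{x \<in> space \<mu>. \<forall>f\<in>F. \<alpha> (act f x) = p f} \<in> sets \<mu>"
proof -
  have "{x \<in> space \<mu>. \<alpha> (act f x) = p f} \<in> sets \<mu>" if f: "f \<in> F" for f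
  proof -
    have m: "(\<lambda>x. \<alpha> (act f x)) \<in> measurable \<mu> (count_space A)"
      using measurable_compose[OF act_invariant(1) \<alpha>] f F by auto
    have "(\<lambda>x. \<alpha> (act f x)) -` {p f} \<inter> space \<mu> \<in> sets \<mu>"
      by (rule measurable_sets[OF m]) (use p f in auto)
    moreover have "(\<lambda>x. \<alpha> (act f x)) -` {p f} \<inter> space \<mu> = {x \<in> space \<mu>. \<alpha> (act f x) = p f}" by auto
    ultimately show ?thesis by simp
  qed
  then show ?thesis using F(1) by (rule sets.sets_Collect_finite_All)
qed

text \<open>The definition of microstates compares frequencies of single patterns; this sums the errors
  over a set of patterns.\<close>

lemma microstate_event_frequency:
  assumes A: "finite A" and \<alpha>: "\<alpha> \<in> measurable \<mu> (count_space A)" and F: "finite F" "F \<subseteq> carrier G"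
    and \<epsilon>: "\<epsilon> \<ge> 0" and a: "a \<in> microstates act \<mu> A \<alpha> F \<epsilon> (D n) (\<sigma> n)" and Q: "Q \<subseteq> F \<rightarrow>\<^sub>E A"
  shows "\<bar>measure \<mu> {x \<in> carrier H. (\<lambda>f\<in>F. \<alpha> (act f x)) \<in> Q}
      - card {i \<in> D n. (\<lambda>f\<in>F. a (\<sigma> n f i)) \<in> Q} / card (D n)\<bar> \<le> real (card (F \<rightarrow>\<^sub>E A)) * \<epsilon>"
proof -
  have finP: "finite (F \<rightarrow>\<^sub>E A)" using A F by (intro finite_PiE) auto
  then have finQ: "finite Q" using Q by (rule rev_finite_subset)
  let ?X = "\<lambda>p. {x \<in> space \<mu>. \<forall>f\<in>F. \<alpha> (act f x) = p f}"
  let ?I = "\<lambda>p. {i \<in> D n. \<forall>f\<in>F. a (\<sigma> n f i) = p f}"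
  have restr: "(\<lambda>f\<in>F. v f) = p \<longleftrightarrow> (\<forall>f\<in>F. v f = p f)" if "p \<in> Q" for p v
  proof
    assume "(\<lambda>f\<in>F. v f) = p" then show "\<forall>f\<in>F. v f = p f" by auto
  next
    assume "\<forall>f\<in>F. v f = p f"
    moreover have "p \<in> F \<rightarrow>\<^sub>E A" using that Q by blast
    ultimately show "(\<lambda>f\<in>F. v f) = p" by (auto simp: PiE_iff intro: extensionalityI[of _ F])
  qed
  have inQ: "(\<lambda>f\<in>F. v f) \<in> Q \<longleftrightarrow> (\<exists>p\<in>Q. \<forall>f\<in>F. v f = p f)" for v
  proof
    assume "(\<lambda>f\<in>F. v f) \<in> Q"
    then show "\<exists>p\<in>Q. \<forall>f\<in>F. v f = p f" by (rule bexI[rotated]) simp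
  next
    assume "\<exists>p\<in>Q. \<forall>f\<in>F. v f = p f"
    then obtain p where p: "p \<in> Q" "\<forall>f\<in>F. v f = p f" by blast
    then have "(\<lambda>f\<in>F. v f) = p" using restr by blast
    then show "(\<lambda>f\<in>F. v f) \<in> Q" using p(1) by simp
  qed
  have X: "{x \<in> carrier H. (\<lambda>f\<in>F. \<alpha> (act f x)) \<in> Q} = (\<Union>p\<in>Q. ?X p)"
    by (auto simp: space_mu inQ)
  have I: "{i \<in> D n. (\<lambda>f\<in>F. a (\<sigma> n f i)) \<in> Q} = (\<Union>p\<in>Q. ?I p)"
    by (auto simp: inQ)
  have sep: "p = p'" if "p \<in> Q" "p' \<in> Q" "\<forall>f\<in>F. v f = p f" "\<forall>f\<in>F. v f = p' f" for p p' v
    using restr[OF that(1), of v] restr[OF that(2), of v] that(3,4) by simp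
  have mX: "measure \<mu> (\<Union>p\<in>Q. ?X p) = (\<Sum>p\<in>Q. measure \<mu> (?X p))"
  proof (rule finite_measure_finite_Union[OF finQ])
    show "?X ` Q \<subseteq> sets \<mu>" using observable_orbit_cell[OF \<alpha> F] Q by blast
    show "disjoint_family_on ?X Q"
      unfolding disjoint_family_on_def
    proof (intro ballI impI)
      fix p p' assume p: "p \<in> Q" "p' \<in> Q" "p \<noteq> p'"
      show "?X p \<inter> ?X p' = {}"
        using sep[OF p(1,2)] p(3) by (intro equals0I) (metis (mono_tags, lifting) IntE mem_Collect_eq)
    qed
  qed
  have cI: "card (\<Union>p\<in>Q. ?I p) = (\<Sum>p\<in>Q. card (?I p))"
  proof (rule card_UN_disjoint[OF finQ])
    show "\<forall>p\<in>Q. finite (?I p)" by simp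
    show "\<forall>p\<in>Q. \<forall>p'\<in>Q. p \<noteq> p' \<longrightarrow> ?I p \<inter> ?I p' = {}"
    proof (intro ballI impI)
      fix p p' assume p: "p \<in> Q" "p' \<in> Q" "p \<noteq> p'"
      show "?I p \<inter> ?I p' = {}"
        using sep[OF p(1,2)] p(3) by (intro equals0I) (metis (mono_tags, lifting) IntE mem_Collect_eq)
    qed
  qed
  have "\<bar>measure \<mu> (\<Union>p\<in>Q. ?X p) - card (\<Union>p\<in>Q. ?I p) / card (D n)\<bar>
      = \<bar>\<Sum>p\<in>Q. measure \<mu> (?X p) - card (?I p) / card (D n)\<bar>"
    unfolding mX cI by (simp add: sum_subtractf sum_divide_distrib)
  also have "\<dots> \<le> (\<Sum>p\<in>Q. \<bar>measure \<mu> (?X p) - card (?I p) / card (D n)\<bar>)" by (rule sum_abs)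
  also have "\<dots> \<le> (\<Sum>p\<in>Q. \<epsilon>)"
  proof (rule sum_mono)
    fix p assume "p \<in> Q"
    then have "p \<in> F \<rightarrow>\<^sub>E A" using Q by blast
    then show "\<bar>measure \<mu> (?X p) - card (?I p) / card (D n)\<bar> \<le> \<epsilon>"
      using a unfolding microstates_def by blast
  qed
  also have "\<dots> = real (card Q) * \<epsilon>" by simp
  also have "\<dots> \<le> real (card (F \<rightarrow>\<^sub>E A)) * \<epsilon>"
    using card_mono[OF finP Q] \<epsilon> by (intro mult_right_mono) auto
  finally show ?thesis unfolding X I .
qed

text \<open>For the refinement \<open>(\<beta>, q m')\<close> of \<open>\<beta>\<close>, the
  \<open>\<beta>\<close>-part of a microstate is known from the projection \<open>e a\<close> of
  its \<open>q m'\<close>-part to level \<open>m\<close>, except on the set \<open>S a\<close> of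
  sites where the approximation \<open>\<theta>\<close> of \<open>\<beta>\<close> fails. The
  frequency of such sites is close to the measure of the corresponding event, hence small. The
  identity is added to the window in order to speak about the colour of a site itself.\<close>

lemma measured_entropy_le_model_entropy:
  "measured_sofic_entropy G act \<mu> D \<sigma> \<le> (SUP m. model_entropy m)"
  unfolding measured_sofic_entropy_def
proof (rule SUP_least, clarify)
  fix B \<beta> assume "(B, \<beta>) \<in> finite_observables \<mu>"
  then have B: "finite B" and \<beta>: "\<beta> \<in> measurable \<mu> (count_space B)"
    by (auto simp: finite_observables_def)
  have \<beta>B: "\<beta> x \<in> B" if "x \<in> carrier H" for x
    using measurable_space[OF \<beta>] that by (simp add: space_mu)
  let ?L = "\<lambda>A \<alpha> \<gamma> \<epsilon> F. limsup (\<lambda>n. log_count (enat (card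
                        ((\<lambda>a. compose (D n) \<gamma> a) ` microstates act \<mu> A \<alpha> F \<epsilon> (D n) (\<sigma> n))))
                      / ereal (card (D n)))"
  let ?I = "INF (A, \<alpha>, \<gamma>)\<in>refinements \<mu> B \<beta>. INF \<epsilon>\<in>{0<..}. INF F\<in>finite_subsets (carrier G). ?L A \<alpha> \<gamma> \<epsilon> F"
  show "?I \<le> (SUP m. model_entropy m)"
  proof (rule ereal_le_epsilon2)
    fix c :: real assume c: "c > 0"
    obtain t where t: "t > 0" and count: "\<And>A :: 'd set. finite A \<Longrightarrow>
        (\<Sum>S | S \<subseteq> A \<and> real (card S) \<le> t * real (card A). real (card B) ^ card S) \<le> exp (c * real (card A))"
      using few_small_modifications[OF c, of "real (card B)"] by auto
    have "t / 2 > 0" using t by simp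
    then obtain m \<theta> where \<theta>: "measure \<mu> {x \<in> carrier H. \<beta> x \<noteq> \<theta> (q m x)} < t / 2"
      using observable_approximable[OF B \<beta>, of "t / 2" 0] by blast
    have main: "?I \<le> model_growth m m' F \<epsilon> + ereal c"
      if m': "m \<le> m'" and F: "finite F" "F \<subseteq> carrier G" and \<epsilon>: "\<epsilon> > 0" for m' F \<epsilon>
    proof -
      define A where "A = prod_encode ` (B \<times> carrier (K m'))"
      define \<alpha> where "\<alpha> = (\<lambda>x. prod_encode (\<beta> x, q m' x))"
      define \<gamma> where "\<gamma> = (\<lambda>k. fst (prod_decode k))"
      define \<eta> where "\<eta> = (\<lambda>k. snd (prod_decode k))"
      have A: "finite A" using B finite_K by (simp add: A_def)
      have \<alpha>A: "\<alpha> x \<in> A" if "x \<in> carrier H" for x using \<beta>B that by (simp add: A_def \<alpha>_def)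
      have \<gamma>\<alpha>: "\<gamma> (\<alpha> x) = \<beta> x" "\<eta> (\<alpha> x) = q m' x" for x by (simp_all add: \<gamma>_def \<eta>_def \<alpha>_def)
      have \<gamma>A: "\<gamma> k \<in> B" "\<eta> k \<in> carrier (K m')" if "k \<in> A" for k
        using that by (auto simp: A_def \<gamma>_def \<eta>_def)
      have \<alpha>_meas: "\<alpha> \<in> measurable \<mu> (count_space A)"
      proof (subst measurable_count_space_eq2[OF A], intro conjI ballI)
        show "\<alpha> \<in> space \<mu> \<rightarrow> A" using \<alpha>A by (simp add: space_mu)
        fix k assume "k \<in> A"
        then obtain b l where k: "k = prod_encode (b, l)" "b \<in> B" by (auto simp: A_def)
        have "\<alpha> -` {k} \<inter> space \<mu> = (\<beta> -` {b} \<inter> space \<mu>) \<inter> {x \<in> carrier H. q m' x \<in> {l}}"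
          by (auto simp: k \<alpha>_def space_mu)
        moreover have "\<beta> -` {b} \<inter> space \<mu> \<in> sets \<mu>"
          by (rule measurable_sets[OF \<beta>]) (use k in auto)
        ultimately show "\<alpha> -` {k} \<inter> space \<mu> \<in> sets \<mu>"
          using sets.Int[OF _ q_cylinder_sets[of m' "{l}"]] by simp
      qed
      have ref: "(A, \<alpha>, \<gamma>) \<in> refinements \<mu> B \<beta>"
        using A \<alpha>_meas \<gamma>A(1) \<gamma>\<alpha>(1) by (simp add: refinements_def finite_observables_def)
      define F' where "F' = insert \<one>\<^bsub>G\<^esub> F"
      have F': "finite F'" "F' \<subseteq> carrier G" "\<one>\<^bsub>G\<^esub> \<in> F'" "F \<subseteq> F'" using F by (auto simp: F'_def)
      define P where "P = real (card (F' \<rightarrow>\<^sub>E A))"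
      define \<epsilon>1 where "\<epsilon>1 = min \<epsilon> (t / 2) / (P + 1)"
      have P: "P + 1 > 0" by (simp add: P_def add_nonneg_pos)
      have \<epsilon>1: "\<epsilon>1 > 0" using \<epsilon> t P by (simp add: \<epsilon>1_def)
      have "P * \<epsilon>1 \<le> (P + 1) * \<epsilon>1" using \<epsilon>1 by (simp add: mult_right_mono)
      also have "\<dots> = min \<epsilon> (t / 2)" using P by (simp add: \<epsilon>1_def)
      finally have P\<epsilon>: "P * \<epsilon>1 \<le> \<epsilon>" "P * \<epsilon>1 \<le> t / 2" by auto
      have "?I \<le> ?L A \<alpha> \<gamma> \<epsilon>1 F'"
      proof (rule INF_lower2[OF ref], unfold prod.case, rule INF_lower2[of \<epsilon>1])
        show "(INF F\<in>finite_subsets (carrier G). ?L A \<alpha> \<gamma> \<epsilon>1 F) \<le> ?L A \<alpha> \<gamma> \<epsilon>1 F'"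
          by (rule INF_lower) (simp add: finite_subsets_def F')
      qed (simp add: \<epsilon>1)
      also have "\<dots> \<le> model_growth m m' F \<epsilon> + ereal c"
        unfolding model_growth_def
      proof (rule limsup_le_limsup_add)
        show "eventually (\<lambda>n. log_count (enat (card ((\<lambda>a. compose (D n) \<gamma> a) `
              microstates act \<mu> A \<alpha> F' \<epsilon>1 (D n) (\<sigma> n)))) / ereal (card (D n))
            \<le> log_count (enat (card (projected_models m m' F \<epsilon> n))) / ereal (card (D n)) + ereal c) sequentially"
          using eventually_D_pos
        proof eventually_elim
          case (elim n)
          let ?N = "real (card (D n))"
          let ?M = "microstates act \<mu> A \<alpha> F' \<epsilon>1 (D n) (\<sigma> n)"
          let ?Y = "(\<lambda>a. compose (D n) \<gamma> a) ` ?M"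
          define e where "e = (\<lambda>a. compose (D n) (proj m' m) (\<lambda>i\<in>D n. \<eta> (a i)))"
          define S where "S = (\<lambda>a. {i \<in> D n. \<gamma> (a i) \<noteq> \<theta> (e a i)})"
          have aA: "a i \<in> A" if "a \<in> ?M" "i \<in> D n" for a i
            using that by (auto simp: microstates_def)
          have pat: "(\<lambda>f\<in>F'. a (\<sigma> n f i)) \<in> F' \<rightarrow>\<^sub>E A" if "a \<in> ?M" "i \<in> D n" for a i
            using aA[OF that(1)] that(2) F'(2) by (auto simp: subset_iff)
          have e_models: "e a \<in> projected_models m m' F \<epsilon> n" if a: "a \<in> ?M" for a
          proof -
            let ?c = "\<lambda>i\<in>D n. \<eta> (a i)"
            define Q where "Q = {p \<in> F' \<rightarrow>\<^sub>E A. \<not> (\<exists>x\<in>carrier H. \<forall>f\<in>F'. p f = \<alpha> (act f x))}"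
            have none: "{x \<in> carrier H. (\<lambda>f\<in>F'. \<alpha> (act f x)) \<in> Q} = {}" by (auto simp: Q_def)
            have "real (card {i \<in> D n. (\<lambda>f\<in>F'. a (\<sigma> n f i)) \<in> Q}) / ?N \<le> P * \<epsilon>1"
              using microstate_event_frequency[OF A \<alpha>_meas F'(1,2) less_imp_le[OF \<epsilon>1] a, of Q]
              unfolding none by (simp add: Q_def P_def)
            then have "real (card {i \<in> D n. (\<lambda>f\<in>F'. a (\<sigma> n f i)) \<in> Q}) \<le> \<epsilon> * ?N"
              using P\<epsilon>(1) elim by (simp add: pos_divide_le_eq) (meson mult_right_mono of_nat_0_le_iff order_trans)
            moreover have "{i \<in> D n. \<not> realised m' F n ?c i} \<subseteq> {i \<in> D n. (\<lambda>f\<in>F'. a (\<sigma> n f i)) \<in> Q}"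
            proof
              fix i assume i: "i \<in> {i \<in> D n. \<not> realised m' F n ?c i}"
              have "\<not> (\<forall>f\<in>F'. a (\<sigma> n f i) = \<alpha> (act f x))" if x: "x \<in> carrier H" for x
              proof
                assume *: "\<forall>f\<in>F'. a (\<sigma> n f i) = \<alpha> (act f x)"
                have "?c (\<sigma> n f i) = q m' (act f x)" if "f \<in> F" for f
                  using * that F' i \<gamma>\<alpha>(2) by (auto simp: subset_iff)
                then have "realised m' F n ?c i" unfolding realised_def using x by blast
                then show False using i by simp
              qed
              then show "i \<in> {i \<in> D n. (\<lambda>f\<in>F'. a (\<sigma> n f i)) \<in> Q}"
                using i pat[OF a] by (auto simp: Q_def)
            qed
            then have "card {i \<in> D n. \<not> realised m' F n ?c i} \<le> card {i \<in> D n. (\<lambda>f\<in>F'. a (\<sigma> n f i)) \<in> Q}"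
              by (rule card_mono[rotated]) simp
            ultimately have "?c \<in> near_models m' F \<epsilon> n"
              using aA[OF a] \<gamma>A(2) by (auto simp: near_models_def)
            then show ?thesis by (simp add: projected_models_def e_def)
          qed
          have S_small: "real (card (S a)) \<le> t * ?N" if a: "a \<in> ?M" for a
          proof -
            define Q where "Q = {p \<in> F' \<rightarrow>\<^sub>E A. \<gamma> (p \<one>\<^bsub>G\<^esub>) \<noteq> \<theta> (proj m' m (\<eta> (p \<one>\<^bsub>G\<^esub>)))}"
            have "{x \<in> carrier H. (\<lambda>f\<in>F'. \<alpha> (act f x)) \<in> Q} = {x \<in> carrier H. \<beta> x \<noteq> \<theta> (q m x)}"
              using F' \<alpha>A m' by (auto simp: Q_def \<gamma>\<alpha> proj_q subset_iff)
            moreover have "{i \<in> D n. (\<lambda>f\<in>F'. a (\<sigma> n f i)) \<in> Q} = S a"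
              using F' pat[OF a] by (auto simp: Q_def S_def e_def compose_eq)
            ultimately have "real (card (S a)) / ?N \<le> t / 2 + P * \<epsilon>1"
              using microstate_event_frequency[OF A \<alpha>_meas F'(1,2) less_imp_le[OF \<epsilon>1] a, of Q] \<theta>
              by (simp add: Q_def P_def)
            also have "\<dots> \<le> t" using P\<epsilon>(2) by simp
            finally show ?thesis using elim by (simp add: pos_divide_le_eq)
          qed
          have "\<forall>y\<in>?Y. \<exists>a. a \<in> ?M \<and> y = compose (D n) \<gamma> a" by blast
          from bchoice[OF this] obtain pre where pre: "\<forall>y\<in>?Y. pre y \<in> ?M \<and> y = compose (D n) \<gamma> (pre y)" ..
          have YB: "?Y \<subseteq> D n \<rightarrow>\<^sub>E B"
            using aA \<gamma>A(1) by (auto simp: compose_def)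
          have "real (card ?Y) \<le> (\<Sum>R | R \<subseteq> D n \<and> real (card R) \<le> t * ?N. real (card B) ^ card R)
              * real (card (projected_models m m' F \<epsilon> n))"
          proof (rule card_le_small_modifications[where S = "\<lambda>y. S (pre y)"])
            show "S (pre y) \<subseteq> D n \<and> real (card (S (pre y))) \<le> t * ?N" if "y \<in> ?Y" for y
              using S_small pre that by (auto simp: S_def)
            show "card {y \<in> ?Y. S (pre y) = R \<and> restrict y R = s} \<le> card (projected_models m m' F \<epsilon> n)"
              if "R \<subseteq> D n" for R s
            proof (rule card_inj_on_le[of "\<lambda>y. e (pre y)"])
              show "(\<lambda>y. e (pre y)) ` {y \<in> ?Y. S (pre y) = R \<and> restrict y R = s} \<subseteq> projected_models m m' F \<epsilon> n"
                using e_models pre by auto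
              show "inj_on (\<lambda>y. e (pre y)) {y \<in> ?Y. S (pre y) = R \<and> restrict y R = s}"
              proof (rule inj_onI)
                fix y z
                assume "y \<in> {y \<in> ?Y. S (pre y) = R \<and> restrict y R = s}"
                  "z \<in> {y \<in> ?Y. S (pre y) = R \<and> restrict y R = s}" and ee: "e (pre y) = e (pre z)"
                then have y: "y \<in> ?Y" "S (pre y) = R" "restrict y R = s"
                  and z: "z \<in> ?Y" "S (pre z) = R" "restrict z R = s" by simp_all
                have off: "w i = \<theta> (e (pre w) i)" if "w \<in> ?Y" "S (pre w) = R" "i \<in> D n" "i \<notin> R" for w i
                proof -
                  have "w i = \<gamma> (pre w i)" using pre that(1,3) by (metis compose_eq)
                  then show ?thesis using that by (auto simp: S_def)
                qed
                show "y = z"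
                proof (rule PiE_ext)
                  show "y \<in> D n \<rightarrow>\<^sub>E B" "z \<in> D n \<rightarrow>\<^sub>E B" using YB y(1) z(1) by blast+
                  fix i assume i: "i \<in> D n"
                  show "y i = z i"
                  proof (cases "i \<in> R")
                    case True
                    then show ?thesis using y(3) z(3) by (metis restrict_apply')
                  next
                    case False
                    then show ?thesis using off[OF y(1,2) i] off[OF z(1,2) i] ee by simp
                  qed
                qed
              qed
            qed simp
          qed (use B YB in auto)
          also have "\<dots> \<le> exp (c * ?N) * real (card (projected_models m m' F \<epsilon> n))"
            by (intro mult_right_mono count) auto
          finally show ?case by (intro log_count_per_site_le[OF elim]) auto
        qed
      qed
      finally show ?thesis .
    qed
    have "?I - ereal c \<le> model_entropy m"
      using main by (intro le_model_entropy) (simp add: ereal_minus_le)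
    also have "\<dots> \<le> (SUP m. model_entropy m)" by (rule SUP_upper) simp
    finally show "?I \<le> (SUP m. model_entropy m) + ereal c" by (simp add: ereal_minus_le)
  qed
qed

section \<open>Perturbations built from homoclinic points\<close>

text \<open>Otherwise the group elements that do not bring \<open>h\<close> into the open kernel of
  \<open>q m\<close> could be enumerated injectively, against convergence to the identity.\<close>

lemma homoclinic_finite_support:
  assumes h: "h \<in> homoclinic_group G H T act"
  shows "finite {g \<in> carrier G. q m (act g h) \<noteq> \<one>\<^bsub>K m\<^esub>}"
proof (rule ccontr)
  assume "infinite {g \<in> carrier G. q m (act g h) \<noteq> \<one>\<^bsub>K m\<^esub>}"
  then obtain g :: "nat \<Rightarrow> 'g" where g: "inj g" "range g \<subseteq> {g \<in> carrier G. q m (act g h) \<noteq> \<one>\<^bsub>K m\<^esub>}"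
    using infinite_countable_subset by blast
  then have "limitin T (\<lambda>n. act (g n) h) \<one>\<^bsub>H\<^esub> sequentially"
    using h unfolding homoclinic_group_def by blast
  then have "eventually (\<lambda>n. act (g n) h \<in> {x \<in> carrier H. q m x = \<one>\<^bsub>K m\<^esub>}) sequentially"
    unfolding limitin_def using fibre_open[of m "\<one>\<^bsub>K m\<^esub>"] q_one H.one_closed by blast
  then obtain n where "q m (act (g n) h) = \<one>\<^bsub>K m\<^esub>" by (auto simp: eventually_sequentially)
  then show False using g(2) by auto
qed

lemma homoclinic_realises_patterns:
  assumes dense: "T closure_of (homoclinic_group G H T act) = topspace T"
    and F: "finite F" "F \<subseteq> carrier G" and x: "x \<in> carrier H"
  obtains h where "h \<in> homoclinic_group G H T act" "\<And>f. f \<in> F \<Longrightarrow> q m (act f h) = q m (act f x)"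
proof -
  let ?W = "\<lambda>f. {y \<in> topspace T. act f y \<in> {z \<in> carrier H. q m z = q m (act f x)}}"
  have "openin T (?W f)" if "f \<in> F" for f
    using that F by (intro openin_continuous_map_preimage[OF act_continuous] fibre_open) auto
  then have "openin T ((\<Inter>f\<in>F. ?W f) \<inter> topspace T)" by (intro openin_INT F(1))
  moreover have "x \<in> (\<Inter>f\<in>F. ?W f) \<inter> topspace T" using x F by (auto simp: topspace_T subset_iff)
  moreover have "x \<in> T closure_of (homoclinic_group G H T act)" using x dense by (simp add: topspace_T)
  ultimately obtain h where "h \<in> homoclinic_group G H T act" "h \<in> (\<Inter>f\<in>F. ?W f) \<inter> topspace T"
    unfolding in_closure_of by blast
  then show ?thesis by (intro that[of h]) auto
qed

definition pattern :: "nat \<Rightarrow> 'g set \<Rightarrow> 'h \<Rightarrow> 'g \<Rightarrow> nat" where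
  "pattern m F x = (\<lambda>f\<in>F. q m (act f x))"

definition local_pattern :: "'g set \<Rightarrow> nat \<Rightarrow> ('d \<Rightarrow> nat) \<Rightarrow> 'd \<Rightarrow> 'g \<Rightarrow> nat" where
  "local_pattern F n a i = (\<lambda>f\<in>F. a (\<sigma> n f i))"

lemma realised_iff: "realised m F n a i \<longleftrightarrow> local_pattern F n a i \<in> pattern m F ` carrier H"
proof
  assume "realised m F n a i"
  then obtain x where "x \<in> carrier H" "\<forall>f\<in>F. a (\<sigma> n f i) = q m (act f x)" by (auto simp: realised_def)
  then show "local_pattern F n a i \<in> pattern m F ` carrier H"
    by (intro image_eqI[of _ _ x]) (auto simp: local_pattern_def pattern_def)
next
  assume "local_pattern F n a i \<in> pattern m F ` carrier H"
  then obtain x where x: "x \<in> carrier H" "local_pattern F n a i = pattern m F x" by blast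
  have "a (\<sigma> n f i) = q m (act f x)" if "f \<in> F" for f
    using fun_cong[OF x(2), of f] that by (simp add: local_pattern_def pattern_def)
  then show "realised m F n a i" using x(1) by (auto simp: realised_def)
qed

lemma pattern_PiE: "F \<subseteq> carrier G \<Longrightarrow> pattern m F ` carrier H \<subseteq> F \<rightarrow>\<^sub>E carrier (K m)"
  unfolding pattern_def
  by (intro image_subsetI) (simp add: restrict_PiE_iff subset_iff)

lemma finite_patterns: "finite F \<Longrightarrow> F \<subseteq> carrier G \<Longrightarrow> finite (pattern m F ` carrier H)"
  by (rule finite_subset[OF pattern_PiE]) (simp_all add: finite_PiE finite_K)

lemma pattern_mult:
  assumes "F \<subseteq> carrier G" "x \<in> carrier H" "y \<in> carrier H"
  shows "pattern m F (x \<otimes>\<^bsub>H\<^esub> y) = (\<lambda>f\<in>F. pattern m F x f \<otimes>\<^bsub>K m\<^esub> pattern m F y f)"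
  unfolding pattern_def
proof (rule restrict_ext)
  fix f assume f: "f \<in> F"
  then have "f \<in> carrier G" using assms(1) by blast
  then show "q m (act f (x \<otimes>\<^bsub>H\<^esub> y))
      = (\<lambda>f\<in>F. q m (act f x)) f \<otimes>\<^bsub>K m\<^esub> (\<lambda>f\<in>F. q m (act f y)) f"
    using f assms(2,3) by (simp add: act_mult q_mult)
qed

text \<open>The realised patterns form a group under pointwise multiplication, being an image of
  \<open>H\<close>.\<close>

lemma unique_pattern_quotient:
  assumes F: "F \<subseteq> carrier G" and r: "r \<in> pattern m F ` carrier H" and p: "p \<in> pattern m F ` carrier H"
  shows "card {s \<in> pattern m F ` carrier H. (\<lambda>f\<in>F. r f \<otimes>\<^bsub>K m\<^esub> s f) = p} = 1"
proof -
  obtain x y where x: "x \<in> carrier H" "r = pattern m F x" and y: "y \<in> carrier H" "p = pattern m F y"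
    using r p by blast
  let ?z = "inv\<^bsub>H\<^esub> x \<otimes>\<^bsub>H\<^esub> y"
  have z: "?z \<in> carrier H" using x y by simp
  have ok: "(\<lambda>f\<in>F. r f \<otimes>\<^bsub>K m\<^esub> pattern m F ?z f) = p"
    using pattern_mult[OF F x(1) z, of m] x y by (simp add: H.m_assoc[symmetric])
  have "s = pattern m F ?z" if s: "s \<in> pattern m F ` carrier H" "(\<lambda>f\<in>F. r f \<otimes>\<^bsub>K m\<^esub> s f) = p" for s
  proof (rule PiE_ext)
    show "s \<in> F \<rightarrow>\<^sub>E carrier (K m)" "pattern m F ?z \<in> F \<rightarrow>\<^sub>E carrier (K m)"
      using pattern_PiE[OF F, of m] s(1) z by blast+
    fix f assume f: "f \<in> F"
    have "r f \<otimes>\<^bsub>K m\<^esub> s f = r f \<otimes>\<^bsub>K m\<^esub> pattern m F ?z f"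
      using fun_cong[OF trans[OF s(2) ok[symmetric]], of f] f by simp
    moreover have "r f \<in> carrier (K m)" "s f \<in> carrier (K m)" "pattern m F ?z f \<in> carrier (K m)"
      using pattern_PiE[OF F, of m] r s(1) z f by blast+
    ultimately show "s f = pattern m F ?z f" by (simp add: K_cancel)
  qed
  then have "{s \<in> pattern m F ` carrier H. (\<lambda>f\<in>F. r f \<otimes>\<^bsub>K m\<^esub> s f) = p} = {pattern m F ?z}"
    using ok z by blast
  then show ?thesis by simp
qed

lemma measure_pattern:
  assumes F: "finite F" "F \<subseteq> carrier G" and p: "p \<in> F \<rightarrow>\<^sub>E carrier (K m)"
  shows "measure \<mu> {x \<in> space \<mu>. \<forall>f\<in>F. q m (act f x) = p f}
    = (if p \<in> pattern m F ` carrier H then 1 / card (pattern m F ` carrier H) else 0)"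
proof -
  have eq: "pattern m F x = c \<longleftrightarrow> (\<forall>f\<in>F. q m (act f x) = c f)" if "c \<in> F \<rightarrow>\<^sub>E carrier (K m)" for x c
  proof
    assume "\<forall>f\<in>F. q m (act f x) = c f"
    then show "pattern m F x = c"
      using that by (auto simp: pattern_def PiE_iff intro: extensionalityI[of _ F])
  qed (auto simp: pattern_def)
  have "measure \<mu> {x \<in> carrier H. pattern m F x \<in> {p}}
      = card ({p} \<inter> pattern m F ` carrier H) / card (pattern m F ` carrier H)"
  proof (rule left_translation_invariant_observable_uniform)
    show "finite (pattern m F ` carrier H)" by (rule finite_patterns[OF F])
    show "{x \<in> carrier H. pattern m F x = c} \<in> sets \<mu>" for c
    proof (cases "c \<in> F \<rightarrow>\<^sub>E carrier (K m)")
      case True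
      have "{x \<in> carrier H. pattern m F x = c} = {x \<in> space \<mu>. \<forall>f\<in>F. q m (act f x) = c f}"
        using eq[OF True] by (simp add: space_mu)
      then show ?thesis using observable_orbit_cell[OF q_measurable F True] by simp
    next
      case False
      then have "{x \<in> carrier H. pattern m F x = c} = {}" using pattern_PiE[OF F(2), of m] by blast
      then show ?thesis by (metis sets.empty_sets)
    qed
    fix x y z assume xyz: "x \<in> carrier H" "y \<in> carrier H" "z \<in> carrier H"
    show "pattern m F (z \<otimes>\<^bsub>H\<^esub> x) = pattern m F (z \<otimes>\<^bsub>H\<^esub> y) \<longleftrightarrow> pattern m F x = pattern m F y"
    proof
      assume e: "pattern m F (z \<otimes>\<^bsub>H\<^esub> x) = pattern m F (z \<otimes>\<^bsub>H\<^esub> y)"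
      show "pattern m F x = pattern m F y"
        unfolding pattern_def
      proof (rule restrict_ext)
        fix f assume f: "f \<in> F"
        then have fG: "f \<in> carrier G" using F by auto
        have "q m (act f (z \<otimes>\<^bsub>H\<^esub> x)) = q m (act f (z \<otimes>\<^bsub>H\<^esub> y))"
          using fun_cong[OF e, of f] f by (simp add: pattern_def)
        then show "q m (act f x) = q m (act f y)"
          using xyz fG by (simp add: act_mult q_mult K_cancel)
      qed
    next
      assume "pattern m F x = pattern m F y"
      then show "pattern m F (z \<otimes>\<^bsub>H\<^esub> x) = pattern m F (z \<otimes>\<^bsub>H\<^esub> y)"
        using xyz F by (simp add: pattern_mult)
    qed
  qed
  moreover have "{x \<in> carrier H. pattern m F x \<in> {p}} = {x \<in> space \<mu>. \<forall>f\<in>F. q m (act f x) = p f}"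
    using eq[OF p] by (simp add: space_mu)
  ultimately show ?thesis by simp
qed

definition pointwise :: "nat \<Rightarrow> nat \<Rightarrow> ('d \<Rightarrow> nat) \<Rightarrow> ('d \<Rightarrow> nat) \<Rightarrow> 'd \<Rightarrow> nat" where
  "pointwise m n a b = (\<lambda>i\<in>D n. a i \<otimes>\<^bsub>K m\<^esub> b i)"

lemma pointwise_closed:
  "a \<in> D n \<rightarrow>\<^sub>E carrier (K m) \<Longrightarrow> b \<in> D n \<rightarrow>\<^sub>E carrier (K m) \<Longrightarrow> pointwise m n a b \<in> D n \<rightarrow>\<^sub>E carrier (K m)"
  unfolding pointwise_def restrict_PiE_iff by (intro ballI K_closed) (erule (1) PiE_mem)+

lemma pointwise_assoc:
  assumes "a \<in> D n \<rightarrow>\<^sub>E carrier (K m)" "b \<in> D n \<rightarrow>\<^sub>E carrier (K m)" "c \<in> D n \<rightarrow>\<^sub>E carrier (K m)"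
  shows "pointwise m n a (pointwise m n b c) = pointwise m n (pointwise m n a b) c"
  unfolding pointwise_def
proof (rule restrict_ext)
  fix i assume i: "i \<in> D n"
  have "a i \<in> carrier (K m)" "b i \<in> carrier (K m)" "c i \<in> carrier (K m)"
    using assms[THEN PiE_mem, OF i] by blast+
  then show "a i \<otimes>\<^bsub>K m\<^esub> (\<lambda>i\<in>D n. b i \<otimes>\<^bsub>K m\<^esub> c i) i = (\<lambda>i\<in>D n. a i \<otimes>\<^bsub>K m\<^esub> b i) i \<otimes>\<^bsub>K m\<^esub> c i"
    using i by (simp add: K_assoc)
qed

lemma local_pattern_pointwise:
  assumes "F \<subseteq> carrier G" "i \<in> D n"
  shows "local_pattern F n (pointwise m n a b) i
    = (\<lambda>f\<in>F. local_pattern F n a i f \<otimes>\<^bsub>K m\<^esub> local_pattern F n b i f)"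
  unfolding local_pattern_def
proof (rule restrict_ext)
  fix f assume f: "f \<in> F"
  then have "\<sigma> n f i \<in> D n" using assms by (intro sigma_closed) blast+
  then show "pointwise m n a b (\<sigma> n f i)
      = (\<lambda>f\<in>F. a (\<sigma> n f i)) f \<otimes>\<^bsub>K m\<^esub> (\<lambda>f\<in>F. b (\<sigma> n f i)) f"
    using f by (simp add: pointwise_def)
qed

lemma realised_pointwise:
  assumes F: "F \<subseteq> carrier G" and i: "i \<in> D n" and r: "realised m F n a i" "realised m F n b i"
  shows "realised m F n (pointwise m n a b) i"
proof -
  from r obtain x y where x: "x \<in> carrier H" "local_pattern F n a i = pattern m F x"
    and y: "y \<in> carrier H" "local_pattern F n b i = pattern m F y"
    unfolding realised_iff by blast
  have "local_pattern F n (pointwise m n a b) i = pattern m F (x \<otimes>\<^bsub>H\<^esub> y)"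
    using local_pattern_pointwise[OF F i] pattern_mult[OF F x(1) y(1)] x y by simp
  then show ?thesis unfolding realised_iff using x y by blast
qed

text \<open>The colourings by which near models will be multiplied. They form a finite group under
  \<open>pointwise\<close>, whose uniform distribution takes the place of independent random
  choices at the sites.\<close>

definition perturbations :: "nat \<Rightarrow> 'g set \<Rightarrow> 'g set \<Rightarrow> nat \<Rightarrow> ('d \<Rightarrow> nat) set" where
  "perturbations m F V n =
     {b \<in> D n \<rightarrow>\<^sub>E carrier (K m). \<forall>i\<in>D n. good V n i \<longrightarrow> realised m F n b i}"

lemma finite_perturbations: "finite (perturbations m F V n)"
proof -
  have "finite (D n \<rightarrow>\<^sub>E carrier (K m))" by (intro finite_PiE) (auto simp: finite_K)
  then show ?thesis by (rule rev_finite_subset) (auto simp: perturbations_def)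
qed

lemma perturbations_nonempty:
  assumes F: "F \<subseteq> carrier G"
  shows "perturbations m F V n \<noteq> {}"
proof -
  have "(\<lambda>i\<in>D n. \<one>\<^bsub>K m\<^esub>) \<in> perturbations m F V n"
    unfolding perturbations_def realised_def
  proof (intro CollectI conjI ballI impI bexI[of _ "\<one>\<^bsub>H\<^esub>"])
    show "(\<lambda>i\<in>D n. \<one>\<^bsub>K m\<^esub>) \<in> D n \<rightarrow>\<^sub>E carrier (K m)"
      using group_K by (auto simp: group.is_monoid monoid.one_closed)
    fix i f assume "i \<in> D n" "f \<in> F"
    then show "(\<lambda>i\<in>D n. \<one>\<^bsub>K m\<^esub>) (\<sigma> n f i) = q m (act f \<one>\<^bsub>H\<^esub>)"
      using F by (auto simp: act_H_one q_one)
  qed simp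
  then show ?thesis by blast
qed

lemma pointwise_perturbations:
  assumes F: "F \<subseteq> carrier G" and "b \<in> perturbations m F V n" "c \<in> perturbations m F V n"
  shows "pointwise m n b c \<in> perturbations m F V n"
  unfolding perturbations_def
proof (intro CollectI conjI ballI impI)
  show "pointwise m n b c \<in> D n \<rightarrow>\<^sub>E carrier (K m)"
    by (rule pointwise_closed) (use assms in \<open>simp_all add: perturbations_def\<close>)
  fix i assume "i \<in> D n" "good V n i"
  then show "realised m F n (pointwise m n b c) i"
    using assms(2,3) by (intro realised_pointwise[OF F]) (simp_all add: perturbations_def)
qed

lemma pointwise_perturbation_bij:
  assumes F: "F \<subseteq> carrier G" and c: "c \<in> perturbations m F V n"
  shows "bij_betw (\<lambda>b. pointwise m n b c) (perturbations m F V n) (perturbations m F V n)"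
proof -
  let ?\<Gamma> = "perturbations m F V n"
  have inj: "inj_on (\<lambda>b. pointwise m n b c) ?\<Gamma>"
  proof (rule inj_onI)
    fix b b' assume b: "b \<in> ?\<Gamma>" "b' \<in> ?\<Gamma>" and e: "pointwise m n b c = pointwise m n b' c"
    have P: "b \<in> D n \<rightarrow>\<^sub>E carrier (K m)" "b' \<in> D n \<rightarrow>\<^sub>E carrier (K m)" "c \<in> D n \<rightarrow>\<^sub>E carrier (K m)"
      using b c by (simp_all add: perturbations_def)
    show "b = b'"
    proof (rule PiE_ext[OF P(1,2)])
      fix i assume i: "i \<in> D n"
      have "b i \<otimes>\<^bsub>K m\<^esub> c i = b' i \<otimes>\<^bsub>K m\<^esub> c i"
        using fun_cong[OF e, of i] i by (simp add: pointwise_def)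
      moreover have "b i \<in> carrier (K m)" "b' i \<in> carrier (K m)" "c i \<in> carrier (K m)"
        using P[THEN PiE_mem, OF i] by blast+
      ultimately show "b i = b' i" by (simp add: K_cancel)
    qed
  qed
  moreover have "(\<lambda>b. pointwise m n b c) ` ?\<Gamma> = ?\<Gamma>"
    by (rule endo_inj_surj[OF finite_perturbations _ inj]) (use pointwise_perturbations[OF F _ c] in blast)
  ultimately show ?thesis by (simp add: bij_betw_def)
qed

text \<open>Given a good site \<open>i\<close> and a homoclinic point \<open>h\<close>, copy the orbit
  of \<open>h\<close> around \<open>i\<close>: the site \<open>j\<close> with \<open>s j =
  i\<close> is coloured by \<open>q m (s\<inverse> h)\<close>, for \<open>s\<inverse>\<close> in
  the finite set \<open>W\<close> where this is nontrivial. At a good site \<open>i'\<close> with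
  \<open>u i' = i\<close> the pattern of this colouring is that of the point \<open>u\<inverse>
  h\<close>; at a good site that no element of \<open>U\<close> carries to \<open>i\<close> it is
  trivial. So the colouring is realised at all good sites. As there are only finitely many
  patterns, finitely many homoclinic points suffice, and \<open>U\<close>, \<open>V\<close> do not
  depend on \<open>n\<close> and \<open>i\<close>.\<close>

lemma homoclinic_local_perturbations:
  assumes dense: "T closure_of (homoclinic_group G H T act) = topspace T"
    and F: "finite F" "F \<subseteq> carrier G"
  obtains U V where "finite U" "finite V" "U \<subseteq> carrier G" "V \<subseteq> carrier G"
    "\<And>n i p. \<lbrakk>i \<in> D n; good V n i; p \<in> pattern m F ` carrier H\<rbrakk> \<Longrightarrow>
       \<exists>b\<in>perturbations m F V n. local_pattern F n b i = p \<and>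
         (\<forall>i'\<in>D n. good V n i' \<longrightarrow> i \<notin> (\<lambda>u. \<sigma> n u i') ` U \<longrightarrow> (\<forall>f\<in>F. b (\<sigma> n f i') = \<one>\<^bsub>K m\<^esub>))"
proof -
  let ?P = "pattern m F ` carrier H"
  have "\<forall>p\<in>?P. \<exists>h. h \<in> homoclinic_group G H T act \<and> pattern m F h = p"
  proof
    fix p assume "p \<in> ?P"
    then obtain x where x: "x \<in> carrier H" "p = pattern m F x" by blast
    obtain h where h: "h \<in> homoclinic_group G H T act" "\<And>f. f \<in> F \<Longrightarrow> q m (act f h) = q m (act f x)"
      using homoclinic_realises_patterns[OF dense F x(1), of m] by blast
    have "pattern m F h = p" unfolding x(2) pattern_def by (rule restrict_ext) (rule h(2))
    then show "\<exists>h. h \<in> homoclinic_group G H T act \<and> pattern m F h = p" using h(1) by blast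
  qed
  from bchoice[OF this] obtain h where
    h: "\<forall>p\<in>?P. h p \<in> homoclinic_group G H T act \<and> pattern m F (h p) = p" ..
  have hH: "h p \<in> carrier H" if "p \<in> ?P" for p
    using h that by (auto simp: homoclinic_group_def)
  define W where "W = (\<Union>p\<in>?P. {g \<in> carrier G. q m (act g (h p)) \<noteq> \<one>\<^bsub>K m\<^esub>})"
  have W: "finite W" "W \<subseteq> carrier G"
  proof -
    show "finite W"
      unfolding W_def
    proof (rule finite_UN_I[OF finite_patterns[OF F]])
      fix p assume "p \<in> ?P"
      then show "finite {g \<in> carrier G. q m (act g (h p)) \<noteq> \<one>\<^bsub>K m\<^esub>}"
        using h homoclinic_finite_support by blast
    qed
    show "W \<subseteq> carrier G" unfolding W_def by blast
  qed
  \<comment> \<open>\<open>S\<close> leads from the sites of a copy to its centre, and \<open>U\<close> from the sites whose window meets the copy.\<close>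
  define S where "S = (\<lambda>g. inv\<^bsub>G\<^esub> g) ` W"
  have S: "finite S" "S \<subseteq> carrier G" using W by (auto simp: S_def)
  define U where "U = insert \<one>\<^bsub>G\<^esub> ((\<lambda>(s, f). s \<otimes>\<^bsub>G\<^esub> f) ` (S \<times> F))"
  have U: "finite U" "U \<subseteq> carrier G" using S F by (auto simp: U_def)
  define V where "V = U \<union> S \<union> F"
  have V: "finite V" "V \<subseteq> carrier G" using S F U by (auto simp: V_def)
  show ?thesis
  proof (rule that[OF U(1) V(1) U(2) V(2)])
    fix n i p assume i: "i \<in> D n" and gi: "good V n i" and p: "p \<in> ?P"
    define b where "b = (\<lambda>j\<in>D n. if \<exists>s\<in>S. \<sigma> n s j = i
        then q m (act (inv\<^bsub>G\<^esub> (SOME s. s \<in> S \<and> \<sigma> n s j = i)) (h p)) else \<one>\<^bsub>K m\<^esub>)"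
    have hp: "h p \<in> carrier H" by (rule hH[OF p])
    have oneK: "\<one>\<^bsub>K m\<^esub> \<in> carrier (K m)" using group_K by (simp add: group.is_monoid monoid.one_closed)
    have some: "(SOME s. s \<in> S \<and> \<sigma> n s j = i) \<in> S \<and> \<sigma> n (SOME s. s \<in> S \<and> \<sigma> n s j = i) j = i"
      if "\<exists>s\<in>S. \<sigma> n s j = i" for j
      by (rule someI_ex) (use that in blast)
    have bK: "b \<in> D n \<rightarrow>\<^sub>E carrier (K m)"
    proof (rule PiE_I)
      fix j assume "j \<in> D n"
      then show "b j \<in> carrier (K m)"
        using some[of j] S(2) hp oneK by (auto simp: b_def subset_iff)
    qed (simp add: b_def)
    have near: "b (\<sigma> n f i') = q m (act f (act (inv\<^bsub>G\<^esub> u) (h p)))"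
      if i': "i' \<in> D n" "good V n i'" and u: "u \<in> U" "\<sigma> n u i' = i" and f: "f \<in> F" for i' u f
    proof -
      let ?j = "\<sigma> n f i'"
      have fG: "f \<in> carrier G" and uG: "u \<in> carrier G" using f F u U by auto
      have j: "?j \<in> D n" using fG i' by simp
      have mult: "\<sigma> n s ?j = \<sigma> n (s \<otimes>\<^bsub>G\<^esub> f) i'" if "s \<in> S" for s
        using i'(2) that f by (simp add: good_def V_def)
      show ?thesis
      proof (cases "\<exists>s\<in>S. \<sigma> n s ?j = i")
        case True
        define s where "s = (SOME s. s \<in> S \<and> \<sigma> n s ?j = i)"
        have s: "s \<in> S" "\<sigma> n s ?j = i" using some[OF True] by (auto simp: s_def)
        have sG: "s \<in> carrier G" using s S by auto
        \<comment> \<open>Both \<open>s f\<close> and \<open>u\<close> carry \<open>i'\<close> to \<open>i\<close>, so they coincide by freeness at \<open>i'\<close>.\<close>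
        have "s \<otimes>\<^bsub>G\<^esub> f \<in> V" "u \<in> V" using s(1) f u by (auto simp: V_def U_def)
        moreover have "\<sigma> n (s \<otimes>\<^bsub>G\<^esub> f) i' = \<sigma> n u i'" using mult[OF s(1)] s(2) u(2) by simp
        ultimately have "s \<otimes>\<^bsub>G\<^esub> f = u" using i'(2) by (auto simp: good_def inj_on_def)
        then have "f \<otimes>\<^bsub>G\<^esub> inv\<^bsub>G\<^esub> u = inv\<^bsub>G\<^esub> s"
          using sG fG by (auto simp: G.inv_mult_group G.m_assoc[symmetric])
        moreover have "b ?j = q m (act (inv\<^bsub>G\<^esub> s) (h p))" using True j by (simp add: b_def s_def)
        ultimately show ?thesis using fG uG hp by (simp add: act_act)
      next
        case False
        have "q m (act (f \<otimes>\<^bsub>G\<^esub> inv\<^bsub>G\<^esub> u) (h p)) = \<one>\<^bsub>K m\<^esub>"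
        proof (rule ccontr)
          assume "q m (act (f \<otimes>\<^bsub>G\<^esub> inv\<^bsub>G\<^esub> u) (h p)) \<noteq> \<one>\<^bsub>K m\<^esub>"
          then have "f \<otimes>\<^bsub>G\<^esub> inv\<^bsub>G\<^esub> u \<in> W" using p fG uG by (auto simp: W_def)
          then have s: "inv\<^bsub>G\<^esub> (f \<otimes>\<^bsub>G\<^esub> inv\<^bsub>G\<^esub> u) \<in> S" by (simp add: S_def)
          have "inv\<^bsub>G\<^esub> (f \<otimes>\<^bsub>G\<^esub> inv\<^bsub>G\<^esub> u) \<otimes>\<^bsub>G\<^esub> f = u"
            using fG uG by (simp add: G.inv_mult_group G.m_assoc)
          then have "\<sigma> n (inv\<^bsub>G\<^esub> (f \<otimes>\<^bsub>G\<^esub> inv\<^bsub>G\<^esub> u)) ?j = i" using mult[OF s] u(2) by simp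
          then show False using False s by blast
        qed
        then show ?thesis using False j fG uG hp by (simp add: b_def act_act)
      qed
    qed
    have away: "b (\<sigma> n f i') = \<one>\<^bsub>K m\<^esub>"
      if i': "i' \<in> D n" "good V n i'" and u: "i \<notin> (\<lambda>u. \<sigma> n u i') ` U" and f: "f \<in> F" for i' f
    proof -
      have "\<sigma> n s (\<sigma> n f i') \<noteq> i" if s: "s \<in> S" for s
      proof
        assume e: "\<sigma> n s (\<sigma> n f i') = i"
        have "\<sigma> n s (\<sigma> n f i') = \<sigma> n (s \<otimes>\<^bsub>G\<^esub> f) i'" using i'(2) s f by (simp add: good_def V_def)
        moreover have "s \<otimes>\<^bsub>G\<^esub> f \<in> U" using s f by (auto simp: U_def)
        ultimately show False using u e by auto
      qed
      moreover have "\<sigma> n f i' \<in> D n" using f F i' by auto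
      ultimately show ?thesis by (auto simp: b_def)
    qed
    have "realised m F n b i'" if i': "i' \<in> D n" "good V n i'" for i'
    proof (cases "i \<in> (\<lambda>u. \<sigma> n u i') ` U")
      case True
      then obtain u where u: "u \<in> U" "\<sigma> n u i' = i" by blast
      have "act (inv\<^bsub>G\<^esub> u) (h p) \<in> carrier H" using u U hp by auto
      then show ?thesis unfolding realised_def using near[OF i' u] by blast
    next
      case False
      have "b (\<sigma> n f i') = q m (act f \<one>\<^bsub>H\<^esub>)" if "f \<in> F" for f
        using away[OF i' False that] that F by (auto simp: act_H_one q_one)
      then show ?thesis unfolding realised_def by blast
    qed
    then have "b \<in> perturbations m F V n" using bK by (simp add: perturbations_def)
    moreover have "local_pattern F n b i = p"
    proof -
      have "local_pattern F n b i = pattern m F (h p)"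
        unfolding local_pattern_def pattern_def
      proof (rule restrict_ext)
        fix f assume f: "f \<in> F"
        show "b (\<sigma> n f i) = q m (act f (h p))"
          using near[OF i gi, of "\<one>\<^bsub>G\<^esub>" f] f hp by (simp add: U_def)
      qed
      then show ?thesis using h p by simp
    qed
    ultimately show "\<exists>b\<in>perturbations m F V n. local_pattern F n b i = p \<and>
         (\<forall>i'\<in>D n. good V n i' \<longrightarrow> i \<notin> (\<lambda>u. \<sigma> n u i') ` U \<longrightarrow> (\<forall>f\<in>F. b (\<sigma> n f i') = \<one>\<^bsub>K m\<^esub>))"
      using away by blast
  qed
qed

section \<open>Model entropy is at most measured entropy\<close>

text \<open>Summed over sites, the amount by which the number of occurrences of the pattern
  \<open>p\<close> exceeds its share under the uniform distribution.\<close>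

definition deviation :: "nat \<Rightarrow> 'g set \<Rightarrow> nat \<Rightarrow> ('g \<Rightarrow> nat) \<Rightarrow> ('d \<Rightarrow> nat) \<Rightarrow> 'd \<Rightarrow> real" where
  "deviation m F n p a i =
     (if local_pattern F n a i = p then 1 else 0) - 1 / card (pattern m F ` carrier H)"

lemma abs_deviation_le: "\<bar>deviation m F n p a i\<bar> \<le> 1"
proof -
  have "0 \<le> 1 / real (card (pattern m F ` carrier H))" "1 / real (card (pattern m F ` carrier H)) \<le> 1"
    by (simp_all add: divide_le_eq)
  then show ?thesis by (simp add: deviation_def)
qed

text \<open>For every pattern \<open>s\<close> there is a perturbation \<open>c s\<close> with pattern
  \<open>s\<close> at \<open>i\<close> and trivial pattern at \<open>i'\<close>. The sum over the
  group is unchanged when \<open>b\<close> is replaced by \<open>b c s\<close>; this leaves the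
  deviation at \<open>i'\<close> alone, whereas averaging over \<open>s\<close> makes the pattern
  at \<open>i\<close> run through all patterns once, so that the deviations at \<open>i\<close>
  cancel.\<close>

lemma deviations_uncorrelated:
  assumes F: "finite F" "F \<subseteq> carrier G"
    and a: "a \<in> D n \<rightarrow>\<^sub>E carrier (K m)" and i: "i \<in> D n" "good V n i" "realised m F n a i"
    and i': "i' \<in> D n" and p: "p \<in> pattern m F ` carrier H"
    and loc: "\<And>s. s \<in> pattern m F ` carrier H \<Longrightarrow>
       \<exists>c\<in>perturbations m F V n. local_pattern F n c i = s \<and> (\<forall>f\<in>F. c (\<sigma> n f i') = \<one>\<^bsub>K m\<^esub>)"
  shows "(\<Sum>b\<in>perturbations m F V n.
     deviation m F n p (pointwise m n a b) i * deviation m F n p (pointwise m n a b) i') = 0"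
proof -
  let ?\<Gamma> = "perturbations m F V n" and ?P = "pattern m F ` carrier H"
  let ?Y = "\<lambda>i b. deviation m F n p (pointwise m n a b) i"
  have P: "finite ?P" "?P \<noteq> {}" "card ?P > 0"
    using finite_patterns[OF F, of m] p by (auto simp: card_gt_0_iff)
  have \<Gamma>: "b \<in> D n \<rightarrow>\<^sub>E carrier (K m)" if "b \<in> ?\<Gamma>" for b using that by (simp add: perturbations_def)
  have "\<forall>s\<in>?P. \<exists>c. c \<in> ?\<Gamma> \<and> local_pattern F n c i = s \<and> (\<forall>f\<in>F. c (\<sigma> n f i') = \<one>\<^bsub>K m\<^esub>)"
    using loc by blast
  from bchoice[OF this] obtain c where
    c: "\<forall>s\<in>?P. c s \<in> ?\<Gamma> \<and> local_pattern F n (c s) i = s \<and> (\<forall>f\<in>F. c s (\<sigma> n f i') = \<one>\<^bsub>K m\<^esub>)" ..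
  have far: "?Y i' (pointwise m n b (c s)) = ?Y i' b" if b: "b \<in> ?\<Gamma>" and s: "s \<in> ?P" for b s
  proof -
    have "local_pattern F n (pointwise m n a (pointwise m n b (c s))) i' = local_pattern F n (pointwise m n a b) i'"
      unfolding local_pattern_def
    proof (rule restrict_ext)
      fix f assume f: "f \<in> F"
      then have j: "\<sigma> n f i' \<in> D n" using F i' by (intro sigma_closed) blast+
      have "b (\<sigma> n f i') \<in> carrier (K m)" by (rule PiE_mem[OF \<Gamma>[OF b] j])
      moreover have "c s (\<sigma> n f i') = \<one>\<^bsub>K m\<^esub>" using c s f by blast
      ultimately show "pointwise m n a (pointwise m n b (c s)) (\<sigma> n f i') = pointwise m n a b (\<sigma> n f i')"
        using j by (simp add: pointwise_def monoid.r_one[OF group.is_monoid[OF group_K]])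
    qed
    then show ?thesis by (simp add: deviation_def)
  qed
  \<comment> \<open>As \<open>s\<close> runs through all patterns, the pattern of \<open>a b (c s)\<close> at \<open>i\<close>
    takes each value once, in particular \<open>p\<close>.\<close>
  have near: "(\<Sum>s\<in>?P. ?Y i (pointwise m n b (c s))) = 0" if b: "b \<in> ?\<Gamma>" for b
  proof -
    let ?r = "local_pattern F n (pointwise m n a b) i"
    have "realised m F n b i" using b i by (simp add: perturbations_def)
    then have r: "?r \<in> ?P" using realised_pointwise[OF F(2) i(1,3)] by (simp add: realised_iff)
    have "local_pattern F n (pointwise m n a (pointwise m n b (c s))) i = (\<lambda>f\<in>F. ?r f \<otimes>\<^bsub>K m\<^esub> s f)"
      if s: "s \<in> ?P" for s
    proof -
      have cs: "c s \<in> ?\<Gamma>" "local_pattern F n (c s) i = s" using c s by blast+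
      show ?thesis
        unfolding pointwise_assoc[OF a \<Gamma>[OF b] \<Gamma>[OF cs(1)]] local_pattern_pointwise[OF F(2) i(1)] cs(2) ..
    qed
    then have "(\<Sum>s\<in>?P. ?Y i (pointwise m n b (c s)))
        = (\<Sum>s\<in>?P. (if (\<lambda>f\<in>F. ?r f \<otimes>\<^bsub>K m\<^esub> s f) = p then 1 else 0) - 1 / card ?P)"
      unfolding deviation_def by (intro sum.cong refl) simp
    also have "\<dots> = real (card {s \<in> ?P. (\<lambda>f\<in>F. ?r f \<otimes>\<^bsub>K m\<^esub> s f) = p}) - 1"
      using P by (simp add: sum_subtractf sum.inter_filter[symmetric])
    also have "\<dots> = 0" using unique_pattern_quotient[OF F(2) r p] by simp
    finally show ?thesis .
  qed
  have "real (card ?P) * (\<Sum>b\<in>?\<Gamma>. ?Y i b * ?Y i' b) = (\<Sum>s\<in>?P. \<Sum>b\<in>?\<Gamma>. ?Y i b * ?Y i' b)" by simp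
  also have "\<dots> = (\<Sum>s\<in>?P. \<Sum>b\<in>?\<Gamma>. ?Y i (pointwise m n b (c s)) * ?Y i' b)"
  proof (rule sum.cong[OF refl])
    fix s assume s: "s \<in> ?P"
    then have cs: "c s \<in> ?\<Gamma>" using c by blast
    have "(\<Sum>b\<in>?\<Gamma>. ?Y i b * ?Y i' b)
        = (\<Sum>b\<in>?\<Gamma>. ?Y i (pointwise m n b (c s)) * ?Y i' (pointwise m n b (c s)))"
      by (rule sum.reindex_bij_betw[OF pointwise_perturbation_bij[OF F(2) cs], symmetric])
    also have "\<dots> = (\<Sum>b\<in>?\<Gamma>. ?Y i (pointwise m n b (c s)) * ?Y i' b)"
      by (rule sum.cong) (simp_all add: far[OF _ s])
    finally show "(\<Sum>b\<in>?\<Gamma>. ?Y i b * ?Y i' b) = (\<Sum>b\<in>?\<Gamma>. ?Y i (pointwise m n b (c s)) * ?Y i' b)" .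
  qed
  also have "\<dots> = (\<Sum>b\<in>?\<Gamma>. \<Sum>s\<in>?P. ?Y i (pointwise m n b (c s)) * ?Y i' b)" by (rule sum.swap)
  also have "\<dots> = (\<Sum>b\<in>?\<Gamma>. (\<Sum>s\<in>?P. ?Y i (pointwise m n b (c s))) * ?Y i' b)"
    by (simp add: sum_distrib_right)
  also have "\<dots> = 0" using near by simp
  finally show ?thesis using P(3) by simp
qed

text \<open>After expanding the square, only the at most \<open>card (D n) * card U\<close> pairs of
  sites connected by an element of \<open>U\<close> contribute.\<close>

lemma deviation_second_moment:
  assumes F: "finite F" "F \<subseteq> carrier G" and U: "finite U"
    and a: "a \<in> D n \<rightarrow>\<^sub>E carrier (K m)" and p: "p \<in> pattern m F ` carrier H"
    and J: "J \<subseteq> D n" "\<And>i. i \<in> J \<Longrightarrow> good V n i \<and> realised m F n a i"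
    and loc: "\<And>i s. \<lbrakk>i \<in> D n; good V n i; s \<in> pattern m F ` carrier H\<rbrakk> \<Longrightarrow>
       \<exists>b\<in>perturbations m F V n. local_pattern F n b i = s \<and>
         (\<forall>i'\<in>D n. good V n i' \<longrightarrow> i \<notin> (\<lambda>u. \<sigma> n u i') ` U \<longrightarrow> (\<forall>f\<in>F. b (\<sigma> n f i') = \<one>\<^bsub>K m\<^esub>))"
  shows "(\<Sum>b\<in>perturbations m F V n. (\<Sum>i\<in>J. deviation m F n p (pointwise m n a b) i)\<^sup>2)
    \<le> real (card (D n)) * real (card U) * real (card (perturbations m F V n))"
proof -
  let ?\<Gamma> = "perturbations m F V n"
  let ?Y = "\<lambda>i b. deviation m F n p (pointwise m n a b) i"
  have finJ: "finite J" using J(1) finite_D by (rule finite_subset)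
  let ?near = "\<lambda>i'. (\<lambda>u. \<sigma> n u i') ` U"
  have pair: "(\<Sum>b\<in>?\<Gamma>. ?Y i b * ?Y i' b) \<le> (if i \<in> ?near i' then real (card ?\<Gamma>) else 0)"
    if "i \<in> J" "i' \<in> J" for i i'
  proof (cases "i \<in> ?near i'")
    case True
    have "(\<Sum>b\<in>?\<Gamma>. ?Y i b * ?Y i' b) \<le> (\<Sum>b\<in>?\<Gamma>. 1)"
    proof (rule sum_mono)
      fix b
      have "?Y i b * ?Y i' b \<le> \<bar>?Y i b\<bar> * \<bar>?Y i' b\<bar>" by (metis abs_ge_self abs_mult)
      also have "\<dots> \<le> 1 * 1" by (intro mult_mono abs_deviation_le) auto
      finally show "?Y i b * ?Y i' b \<le> 1" by simp
    qed
    then show ?thesis using True by simp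
  next
    case False
    have D: "i \<in> D n" "i' \<in> D n" using that J(1) by blast+
    have g: "good V n i" "realised m F n a i" "good V n i'" using J(2)[OF that(1)] J(2)[OF that(2)] by blast+
    have "(\<Sum>b\<in>?\<Gamma>. ?Y i b * ?Y i' b) = 0"
    proof (rule deviations_uncorrelated[OF F a D(1) g(1,2) D(2) p])
      fix s assume "s \<in> pattern m F ` carrier H"
      from loc[OF D(1) g(1) this] obtain b where "b \<in> ?\<Gamma>" "local_pattern F n b i = s"
        "\<forall>i'\<in>D n. good V n i' \<longrightarrow> i \<notin> ?near i' \<longrightarrow> (\<forall>f\<in>F. b (\<sigma> n f i') = \<one>\<^bsub>K m\<^esub>)" by blast
      then show "\<exists>c\<in>?\<Gamma>. local_pattern F n c i = s \<and> (\<forall>f\<in>F. c (\<sigma> n f i') = \<one>\<^bsub>K m\<^esub>)"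
        using D(2) g(3) False by blast
    qed
    then show ?thesis using False by simp
  qed
  have "(\<Sum>b\<in>?\<Gamma>. (\<Sum>i\<in>J. ?Y i b)\<^sup>2) = (\<Sum>b\<in>?\<Gamma>. \<Sum>i'\<in>J. \<Sum>i\<in>J. ?Y i b * ?Y i' b)"
    unfolding power2_eq_square sum_product by (intro sum.cong refl sum.swap)
  also have "\<dots> = (\<Sum>i'\<in>J. \<Sum>b\<in>?\<Gamma>. \<Sum>i\<in>J. ?Y i b * ?Y i' b)" by (rule sum.swap)
  also have "\<dots> = (\<Sum>i'\<in>J. \<Sum>i\<in>J. \<Sum>b\<in>?\<Gamma>. ?Y i b * ?Y i' b)" by (intro sum.cong refl sum.swap)
  also have "\<dots> \<le> (\<Sum>i'\<in>J. \<Sum>i\<in>J. if i \<in> ?near i' then real (card ?\<Gamma>) else 0)"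
    by (intro sum_mono pair)
  also have "\<dots> \<le> (\<Sum>i'\<in>J. real (card U) * real (card ?\<Gamma>))"
  proof (rule sum_mono)
    fix i'
    have "(\<Sum>i\<in>J. if i \<in> ?near i' then real (card ?\<Gamma>) else 0)
        = real (card (J \<inter> ?near i')) * real (card ?\<Gamma>)"
      using finJ by (simp add: sum.If_cases)
    also have "card (J \<inter> ?near i') \<le> card U"
      using card_mono[of "?near i'" "J \<inter> ?near i'"] card_image_le[OF U, of "\<lambda>u. \<sigma> n u i'"] U by force
    finally show "(\<Sum>i\<in>J. if i \<in> ?near i' then real (card ?\<Gamma>) else 0) \<le> real (card U) * real (card ?\<Gamma>)"
      by (simp add: mult_right_mono)
  qed
  also have "\<dots> = real (card J) * (real (card U) * real (card ?\<Gamma>))" by simp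
  also have "\<dots> \<le> real (card (D n)) * (real (card U) * real (card ?\<Gamma>))"
    using card_mono[OF finite_D J(1)] by (intro mult_right_mono) auto
  finally show ?thesis by (simp add: mult.assoc)
qed

text \<open>The sites outside \<open>J\<close> change the frequency of any pattern by at most
  \<open>\<epsilon> / 2\<close>, and the deviation from the uniform distribution inside
  \<open>J\<close> contributes the other half. A pattern that no point realises can occur outside
  \<open>J\<close> only.\<close>

lemma perturbation_microstate:
  assumes F: "finite F" "F \<subseteq> carrier G" and a: "a \<in> D n \<rightarrow>\<^sub>E carrier (K m)" and N: "card (D n) > 0"
    and J: "J \<subseteq> D n" "\<And>i. i \<in> J \<Longrightarrow> realised m F n a i"
    and small: "real (card (D n - J)) \<le> \<epsilon> / 2 * real (card (D n))"
    and even: "\<And>p. p \<in> pattern m F ` carrier H \<Longrightarrow>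
      \<bar>\<Sum>i\<in>J. deviation m F n p a i\<bar> \<le> \<epsilon> / 2 * real (card (D n))"
  shows "a \<in> microstates act \<mu> (carrier (K m)) (q m) F \<epsilon> (D n) (\<sigma> n)"
  unfolding microstates_def
proof (intro CollectI conjI ballI a)
  fix p assume p: "p \<in> F \<rightarrow>\<^sub>E carrier (K m)"
  let ?P = "pattern m F ` carrier H" and ?N = "real (card (D n))"
  let ?C = "{i \<in> D n. local_pattern F n a i = p}"
  have C: "{i \<in> D n. \<forall>f\<in>F. a (\<sigma> n f i) = p f} = ?C"
  proof -
    have "local_pattern F n a i = p \<longleftrightarrow> (\<forall>f\<in>F. a (\<sigma> n f i) = p f)" for i
      using p by (auto simp: local_pattern_def PiE_iff intro: extensionalityI[of _ F])
    then show ?thesis by simp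
  qed
  have finJ: "finite J" using J(1) finite_D by (rule finite_subset)
  have split: "card ?C = card (?C \<inter> J) + card (?C - J)"
    by (rule card_Int_Diff) simp
  have rest: "card (?C - J) \<le> card (D n - J)" by (rule card_mono) auto
  have DJ: "real (card (D n)) = real (card J) + real (card (D n - J))"
    using card_Int_Diff[OF finite_D, of n J] J(1) by (simp add: Int_absorb1)
  have "\<bar>(if p \<in> ?P then 1 / card ?P else 0) - card ?C / ?N\<bar> \<le> \<epsilon>"
  proof (cases "p \<in> ?P")
    case True
    let ?c = "1 / real (card ?P)"
    have c: "0 \<le> ?c" "?c \<le> 1" by (simp_all add: divide_le_eq)
    have "(\<Sum>i\<in>J. deviation m F n p a i) = real (card (?C \<inter> J)) - real (card J) * ?c"
    proof -
      have "{i \<in> J. local_pattern F n a i = p} = ?C \<inter> J" using J(1) by blast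
      then show ?thesis
        unfolding deviation_def using finJ by (simp add: sum_subtractf sum.inter_filter[symmetric])
    qed
    then have dev: "\<bar>real (card (?C \<inter> J)) - real (card J) * ?c\<bar> \<le> \<epsilon> / 2 * ?N" using even[OF True] by simp
    have "0 \<le> real (card (D n - J)) * ?c" "real (card (D n - J)) * ?c \<le> real (card (D n - J)) * 1"
      by (rule mult_nonneg_nonneg[OF _ c(1)], simp, rule mult_left_mono[OF c(2)], simp)
    moreover have "?N * ?c = real (card J) * ?c + real (card (D n - J)) * ?c"
      unfolding DJ by (rule distrib_right)
    ultimately have "\<bar>?N * ?c - card ?C\<bar> \<le> \<epsilon> * ?N"
      using dev split rest small by linarith
    moreover have "?c - card ?C / ?N = (?N * ?c - card ?C) / ?N"
    proof -
      have "u - v / w = (w * u - v) / w" if "w > 0" for u v w :: real using that by (simp add: field_simps)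
      then show ?thesis using N by simp
    qed
    ultimately have "\<bar>?c - card ?C / ?N\<bar> \<le> \<epsilon>" using N by (simp add: abs_divide pos_divide_le_eq)
    then show ?thesis using True by simp
  next
    case False
    then have "?C \<inter> J = {}" using J(2) by (auto simp: realised_iff)
    then have "real (card ?C) \<le> \<epsilon> / 2 * ?N" using split rest small by simp
    moreover have "0 \<le> \<epsilon> / 2 * ?N" using small by linarith
    ultimately have "real (card ?C) \<le> \<epsilon> * ?N" by simp
    then show ?thesis using False N by (simp add: pos_divide_le_eq)
  qed
  then show "\<bar>measure \<mu> {x \<in> space \<mu>. \<forall>f\<in>F. q m (act f x) = p f}
      - card {i \<in> D n. \<forall>f\<in>F. a (\<sigma> n f i) = p f} / card (D n)\<bar> \<le> \<epsilon>"
    unfolding C measure_pattern[OF F p] .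
qed

text \<open>Chebyshev's inequality, for each of the finitely many patterns. Neither \<open>V\<close>
  nor the threshold for \<open>n\<close> depends on the near model, so the bound holds for all
  near models at once.\<close>

lemma most_perturbations_microstates:
  assumes dense: "T closure_of (homoclinic_group G H T act) = topspace T"
    and F: "finite F" "F \<subseteq> carrier G" and \<epsilon>: "\<epsilon> > 0"
  obtains V where "eventually (\<lambda>n. \<forall>a\<in>near_models m F (\<epsilon> / 4) n.
     card (perturbations m F V n) \<le> 2 * card {b \<in> perturbations m F V n.
       pointwise m n a b \<in> microstates act \<mu> (carrier (K m)) (q m) F \<epsilon> (D n) (\<sigma> n)}) sequentially"
proof -
  obtain U V where U: "finite U" and V: "finite V" "V \<subseteq> carrier G" and loc:
    "\<And>n i p. \<lbrakk>i \<in> D n; good V n i; p \<in> pattern m F ` carrier H\<rbrakk> \<Longrightarrow>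
       \<exists>b\<in>perturbations m F V n. local_pattern F n b i = p \<and>
         (\<forall>i'\<in>D n. good V n i' \<longrightarrow> i \<notin> (\<lambda>u. \<sigma> n u i') ` U \<longrightarrow> (\<forall>f\<in>F. b (\<sigma> n f i') = \<one>\<^bsub>K m\<^esub>))"
    by (rule homoclinic_local_perturbations[OF dense F, of m]) blast
  let ?P = "pattern m F ` carrier H"
  have P: "finite ?P" by (rule finite_patterns[OF F])
  define \<tau> where "\<tau> = \<epsilon> / 2"
  have \<tau>: "\<tau> > 0" using \<epsilon> by (simp add: \<tau>_def)
  have "\<epsilon> / 4 > 0" using \<epsilon> by simp
  from negligibleD[OF negligible_not_good[OF V] this]
    eventually_D_large[of "2 * real (card ?P) * real (card U) / \<tau>\<^sup>2"] eventually_D_pos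
  have "eventually (\<lambda>n. \<forall>a\<in>near_models m F (\<epsilon> / 4) n.
     card (perturbations m F V n) \<le> 2 * card {b \<in> perturbations m F V n.
       pointwise m n a b \<in> microstates act \<mu> (carrier (K m)) (q m) F \<epsilon> (D n) (\<sigma> n)}) sequentially"
  proof eventually_elim
    case (elim n)
    let ?N = "real (card (D n))" and ?\<Gamma> = "perturbations m F V n"
    let ?M = "microstates act \<mu> (carrier (K m)) (q m) F \<epsilon> (D n) (\<sigma> n)"
    show ?case
    proof
      fix a assume a: "a \<in> near_models m F (\<epsilon> / 4) n"
      then have aK: "a \<in> D n \<rightarrow>\<^sub>E carrier (K m)" by (simp add: near_models_def)
      define J where "J = {i \<in> D n. good V n i \<and> realised m F n a i}"
      have J: "J \<subseteq> D n" "\<And>i. i \<in> J \<Longrightarrow> good V n i \<and> realised m F n a i" by (auto simp: J_def)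
      have "D n - J = {i \<in> D n. \<not> good V n i} \<union> {i \<in> D n. \<not> realised m F n a i}" by (auto simp: J_def)
      then have "card (D n - J) \<le> card {i \<in> D n. \<not> good V n i} + card {i \<in> D n. \<not> realised m F n a i}"
        by (simp only: card_Un_le)
      moreover have "real (card {i \<in> D n. \<not> realised m F n a i}) \<le> \<epsilon> / 4 * ?N"
        using a by (simp add: near_models_def)
      ultimately have small: "real (card (D n - J)) \<le> \<epsilon> / 2 * ?N" using elim(1) by linarith
      let ?dev = "\<lambda>p b. \<Sum>i\<in>J. deviation m F n p (pointwise m n a b) i"
      define Bad where "Bad = (\<lambda>p. {b \<in> ?\<Gamma>. \<tau> * ?N < \<bar>?dev p b\<bar>})"
      have Bad: "real (card (Bad p)) * (\<tau> * ?N)\<^sup>2 \<le> ?N * real (card U) * real (card ?\<Gamma>)" if p: "p \<in> ?P" for p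
      proof -
        have "real (card (Bad p)) * (\<tau> * ?N)\<^sup>2 = (\<Sum>b\<in>Bad p. (\<tau> * ?N)\<^sup>2)" by simp
        also have "\<dots> \<le> (\<Sum>b\<in>Bad p. (?dev p b)\<^sup>2)"
        proof (rule sum_mono)
          fix b assume "b \<in> Bad p"
          then have "\<bar>\<tau> * ?N\<bar> \<le> \<bar>?dev p b\<bar>" using \<tau> by (simp add: Bad_def abs_mult)
          then show "(\<tau> * ?N)\<^sup>2 \<le> (?dev p b)\<^sup>2" by (simp only: abs_le_square_iff)
        qed
        also have "\<dots> \<le> (\<Sum>b\<in>?\<Gamma>. (?dev p b)\<^sup>2)"
          by (rule sum_mono2) (auto simp: finite_perturbations Bad_def)
        also have "\<dots> \<le> ?N * real (card U) * real (card ?\<Gamma>)"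
          by (rule deviation_second_moment[OF F U aK p J loc])
        finally show ?thesis .
      qed
      have "card (\<Union>p\<in>?P. Bad p) \<le> (\<Sum>p\<in>?P. card (Bad p))" by (rule card_UN_le[OF P])
      then have "real (card (\<Union>p\<in>?P. Bad p)) \<le> real (\<Sum>p\<in>?P. card (Bad p))" by (simp only: of_nat_le_iff)
      then have "real (card (\<Union>p\<in>?P. Bad p)) * (\<tau> * ?N)\<^sup>2 \<le> real (\<Sum>p\<in>?P. card (Bad p)) * (\<tau> * ?N)\<^sup>2"
        by (rule mult_right_mono) simp
      also have "\<dots> = (\<Sum>p\<in>?P. real (card (Bad p)) * (\<tau> * ?N)\<^sup>2)" by (simp add: sum_distrib_right)
      also have "\<dots> \<le> (\<Sum>p\<in>?P. ?N * real (card U) * real (card ?\<Gamma>))" by (rule sum_mono) (rule Bad)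
      also have "\<dots> = real (card ?P) * real (card U) * ?N * real (card ?\<Gamma>)" by simp
      finally have 1: "real (card (\<Union>p\<in>?P. Bad p)) * (\<tau> * ?N)\<^sup>2 \<le> real (card ?P) * real (card U) * ?N * real (card ?\<Gamma>)" .
      have "2 * real (card ?P) * real (card U) \<le> \<tau>\<^sup>2 * ?N"
        using elim(2) \<tau> by (simp add: pos_divide_le_eq mult.commute)
      then have "2 * real (card ?P) * real (card U) * (?N * real (card ?\<Gamma>)) \<le> \<tau>\<^sup>2 * ?N * (?N * real (card ?\<Gamma>))"
        by (rule mult_right_mono) simp
      then have "2 * (real (card (\<Union>p\<in>?P. Bad p)) * (\<tau> * ?N)\<^sup>2) \<le> real (card ?\<Gamma>) * (\<tau> * ?N)\<^sup>2"
        using 1 by (simp add: power2_eq_square algebra_simps)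
      moreover have "?N > 0" using elim(3) by (simp only: of_nat_0_less_iff)
      then have "(\<tau> * ?N)\<^sup>2 > 0" by (intro zero_less_power mult_pos_pos \<tau>)
      ultimately have "2 * real (card (\<Union>p\<in>?P. Bad p)) \<le> real (card ?\<Gamma>)" by simp
      then have few: "2 * card (\<Union>p\<in>?P. Bad p) \<le> card ?\<Gamma>" by linarith
      have "?\<Gamma> - (\<Union>p\<in>?P. Bad p) \<subseteq> {b \<in> ?\<Gamma>. pointwise m n a b \<in> ?M}"
      proof
        fix b assume b: "b \<in> ?\<Gamma> - (\<Union>p\<in>?P. Bad p)"
        have "pointwise m n a b \<in> ?M"
        proof (rule perturbation_microstate[OF F _ elim(3) J(1) _ small])
          show "pointwise m n a b \<in> D n \<rightarrow>\<^sub>E carrier (K m)"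
            by (rule pointwise_closed[OF aK]) (use b in \<open>simp add: perturbations_def\<close>)
          show "realised m F n (pointwise m n a b) i" if "i \<in> J" for i
            by (rule realised_pointwise[OF F(2)]) (use b that in \<open>simp_all add: perturbations_def J_def\<close>)
          show "\<bar>?dev p b\<bar> \<le> \<epsilon> / 2 * ?N" if "p \<in> ?P" for p
          proof -
            have "b \<notin> Bad p" "b \<in> ?\<Gamma>" using b that by blast+
            then show ?thesis by (simp add: Bad_def \<tau>_def not_less)
          qed
        qed
        then show "b \<in> {b \<in> ?\<Gamma>. pointwise m n a b \<in> ?M}" using b by simp
      qed
      then have "card (?\<Gamma> - (\<Union>p\<in>?P. Bad p)) \<le> card {b \<in> ?\<Gamma>. pointwise m n a b \<in> ?M}"
        by (rule card_mono[rotated]) (simp add: finite_perturbations)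
      moreover have "card (?\<Gamma> - (\<Union>p\<in>?P. Bad p)) = card ?\<Gamma> - card (\<Union>p\<in>?P. Bad p)"
      proof (rule card_Diff_subset)
        show "finite (\<Union>p\<in>?P. Bad p)"
          by (rule finite_UN_I[OF P]) (simp add: Bad_def finite_perturbations)
        show "(\<Union>p\<in>?P. Bad p) \<subseteq> ?\<Gamma>" by (rule UN_least) (simp add: Bad_def)
      qed
      ultimately show "card ?\<Gamma> \<le> 2 * card {b \<in> ?\<Gamma>. pointwise m n a b \<in> ?M}" using few by linarith
    qed
  qed
  then show ?thesis by (rule that)
qed

text \<open>The perturbation \<open>b\<close> that works for at least half of the chosen near models
  acts on colourings as a right multiplication, and it acts on their projections as right
  multiplication by the projection of \<open>b\<close>. The latter is injective, so different
  projected near models yield different projected microstates.\<close>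

lemma projected_models_le_microstates:
  assumes dense: "T closure_of (homoclinic_group G H T act) = topspace T"
    and F: "finite F" "F \<subseteq> carrier G" and \<epsilon>: "\<epsilon> > 0" and m': "m \<le> m'"
  shows "eventually (\<lambda>n. card (projected_models m m' F (\<epsilon> / 4) n)
    \<le> 2 * card ((\<lambda>a. compose (D n) (proj m' m) a) `
        microstates act \<mu> (carrier (K m')) (q m') F \<epsilon> (D n) (\<sigma> n))) sequentially"
proof -
  obtain V where ev: "eventually (\<lambda>n. \<forall>a\<in>near_models m' F (\<epsilon> / 4) n.
     card (perturbations m' F V n) \<le> 2 * card {b \<in> perturbations m' F V n.
       pointwise m' n a b \<in> microstates act \<mu> (carrier (K m')) (q m') F \<epsilon> (D n) (\<sigma> n)}) sequentially"
    by (rule most_perturbations_microstates[OF dense F \<epsilon>])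
  then show ?thesis
  proof eventually_elim
    case (elim n)
    let ?\<Gamma> = "perturbations m' F V n" and ?Y = "projected_models m m' F (\<epsilon> / 4) n"
    let ?M = "microstates act \<mu> (carrier (K m')) (q m') F \<epsilon> (D n) (\<sigma> n)"
    let ?pr = "\<lambda>a. compose (D n) (proj m' m) a"
    have "\<forall>y\<in>?Y. \<exists>a. a \<in> near_models m' F (\<epsilon> / 4) n \<and> y = ?pr a"
      by (auto simp: projected_models_def)
    from bchoice[OF this] obtain pre where pre: "\<forall>y\<in>?Y. pre y \<in> near_models m' F (\<epsilon> / 4) n \<and> y = ?pr (pre y)" ..
    have "\<exists>b\<in>?\<Gamma>. card ?Y \<le> 2 * card {y \<in> ?Y. pointwise m' n (pre y) b \<in> ?M}"
    proof (rule ex_popular_element[OF finite_projected_models finite_perturbations perturbations_nonempty[OF F(2)]])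
      fix y assume "y \<in> ?Y"
      then show "card ?\<Gamma> \<le> 2 * card {b \<in> ?\<Gamma>. pointwise m' n (pre y) b \<in> ?M}" using elim pre by blast
    qed
    then obtain b where b: "b \<in> ?\<Gamma>" and le: "card ?Y \<le> 2 * card {y \<in> ?Y. pointwise m' n (pre y) b \<in> ?M}" by blast
    have bK: "b \<in> D n \<rightarrow>\<^sub>E carrier (K m')" using b by (simp add: perturbations_def)
    have "card {y \<in> ?Y. pointwise m' n (pre y) b \<in> ?M} \<le> card (?pr ` ?M)"
    proof (rule card_inj_on_le[of "\<lambda>y. ?pr (pointwise m' n (pre y) b)"])
      show "(\<lambda>y. ?pr (pointwise m' n (pre y) b)) ` {y \<in> ?Y. pointwise m' n (pre y) b \<in> ?M} \<subseteq> ?pr ` ?M" by blast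
      have "finite (D n \<rightarrow>\<^sub>E carrier (K m'))" by (simp add: finite_PiE finite_K)
      then have "finite ?M" by (rule rev_finite_subset) (simp add: microstates_def subset_iff)
      then show "finite (?pr ` ?M)" by simp
      show "inj_on (\<lambda>y. ?pr (pointwise m' n (pre y) b)) {y \<in> ?Y. pointwise m' n (pre y) b \<in> ?M}"
      proof (rule inj_onI)
        fix y z
        assume "y \<in> {y \<in> ?Y. pointwise m' n (pre y) b \<in> ?M}" "z \<in> {y \<in> ?Y. pointwise m' n (pre y) b \<in> ?M}"
          and e: "?pr (pointwise m' n (pre y) b) = ?pr (pointwise m' n (pre z) b)"
        then have yz: "y \<in> ?Y" "z \<in> ?Y" by simp_all
        have YK: "w \<in> D n \<rightarrow>\<^sub>E carrier (K m)" if "w \<in> ?Y" for w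
          using projected_models_PiE[OF m'] that by blast
        show "y = z"
        proof (rule PiE_ext[OF YK[OF yz(1)] YK[OF yz(2)]])
          fix i assume i: "i \<in> D n"
          have bi: "b i \<in> carrier (K m')" by (rule PiE_mem[OF bK i])
          have val: "?pr (pointwise m' n (pre w) b) i = w i \<otimes>\<^bsub>K m\<^esub> proj m' m (b i)" if w: "w \<in> ?Y" for w
          proof -
            have "pre w \<in> near_models m' F (\<epsilon> / 4) n" using pre w by blast
            then have "pre w \<in> D n \<rightarrow>\<^sub>E carrier (K m')" by (rule subsetD[OF near_models_PiE])
            then have "pre w i \<in> carrier (K m')" using i by (rule PiE_mem)
            then have "?pr (pointwise m' n (pre w) b) i = ?pr (pre w) i \<otimes>\<^bsub>K m\<^esub> proj m' m (b i)"
              using i bi by (simp add: compose_eq pointwise_def proj_mult[OF m'])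
            moreover have "w = ?pr (pre w)" using pre w by blast
            ultimately show ?thesis by simp
          qed
          have "y i \<otimes>\<^bsub>K m\<^esub> proj m' m (b i) = z i \<otimes>\<^bsub>K m\<^esub> proj m' m (b i)"
            using fun_cong[OF e, of i] unfolding val[OF yz(1)] val[OF yz(2)] .
          then show "y i = z i"
            using PiE_mem[OF YK[OF yz(1)] i] PiE_mem[OF YK[OF yz(2)] i] proj_closed[OF m' bi]
            by (simp add: K_cancel)
        qed
      qed
    qed
    then show ?case using le by linarith
  qed
qed

text \<open>Replacing \<open>\<alpha>\<close> by its approximation \<open>\<theta> \<circ> q m\<close>
  changes the pattern of \<open>x\<close> along \<open>F\<close> only if some \<open>f x\<close>
  lies in the exceptional set; by invariance the measure of this event is at most \<open>card
  F\<close> times the measure of the exceptional set.\<close>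

lemma microstates_of_approximation:
  assumes A: "finite A" and \<alpha>: "\<alpha> \<in> measurable \<mu> (count_space A)"
    and F: "finite F" "F \<subseteq> carrier G" and \<epsilon>: "\<epsilon> > 0"
    and \<theta>: "\<And>k. k \<in> carrier (K m) \<Longrightarrow> \<theta> k \<in> A"
    and close: "real (card F) * measure \<mu> {x \<in> carrier H. \<alpha> x \<noteq> \<theta> (q m x)} \<le> \<epsilon> / 2"
    and \<eta>: "\<eta> > 0" "real (card (F \<rightarrow>\<^sub>E carrier (K m))) * \<eta> \<le> \<epsilon> / 2"
    and a: "a \<in> microstates act \<mu> (carrier (K m)) (q m) F \<eta> (D n) (\<sigma> n)"
  shows "compose (D n) \<theta> a \<in> microstates act \<mu> A \<alpha> F \<epsilon> (D n) (\<sigma> n)"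
  unfolding microstates_def
proof (intro CollectI conjI ballI)
  have aK: "a i \<in> carrier (K m)" if "i \<in> D n" for i
    using a that by (auto simp: microstates_def)
  show "compose (D n) \<theta> a \<in> D n \<rightarrow>\<^sub>E A"
    unfolding compose_def restrict_PiE_iff using \<theta> aK by simp
  fix p assume p: "p \<in> F \<rightarrow>\<^sub>E A"
  define Q where "Q = {r \<in> F \<rightarrow>\<^sub>E carrier (K m). \<forall>f\<in>F. \<theta> (r f) = p f}"
  have fG: "f \<in> carrier G" if "f \<in> F" for f using F that by blast
  have "\<bar>measure \<mu> {x \<in> carrier H. (\<lambda>f\<in>F. q m (act f x)) \<in> Q}
      - card {i \<in> D n. (\<lambda>f\<in>F. a (\<sigma> n f i)) \<in> Q} / card (D n)\<bar> \<le> \<epsilon> / 2"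
    using microstate_event_frequency[OF finite_K q_measurable F less_imp_le[OF \<eta>(1)] a, of Q] \<eta>(2)
    by (simp add: Q_def)
  moreover have "{x \<in> carrier H. (\<lambda>f\<in>F. q m (act f x)) \<in> Q}
      = {x \<in> carrier H. \<forall>f\<in>F. \<theta> (q m (act f x)) = p f}"
    by (rule Collect_cong) (simp add: Q_def restrict_PiE_iff fG cong: conj_cong ball_cong)
  moreover have "{i \<in> D n. (\<lambda>f\<in>F. a (\<sigma> n f i)) \<in> Q} = {i \<in> D n. \<forall>f\<in>F. compose (D n) \<theta> a (\<sigma> n f i) = p f}"
    by (rule Collect_cong) (simp add: Q_def restrict_PiE_iff fG aK compose_eq cong: conj_cong ball_cong)
  ultimately have 1: "\<bar>measure \<mu> {x \<in> carrier H. \<forall>f\<in>F. \<theta> (q m (act f x)) = p f}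
      - card {i \<in> D n. \<forall>f\<in>F. compose (D n) \<theta> a (\<sigma> n f i) = p f} / card (D n)\<bar> \<le> \<epsilon> / 2"
    by simp
  let ?X = "{x \<in> space \<mu>. \<forall>f\<in>F. \<alpha> (act f x) = p f}"
  let ?Z = "{x \<in> carrier H. \<forall>f\<in>F. \<theta> (q m (act f x)) = p f}"
  let ?E = "{x \<in> carrier H. \<alpha> x \<noteq> \<theta> (q m x)}"
  let ?Ef = "\<lambda>f. {x \<in> carrier H. act f x \<in> ?E}"
  have X: "?X \<in> sets \<mu>" by (rule observable_orbit_cell[OF \<alpha> F p])
  have E: "?E \<in> sets \<mu>"
  proof -
    have "?E = (\<Union>k\<in>carrier (K m). {x \<in> carrier H. q m x \<in> {k}} - (\<alpha> -` {\<theta> k} \<inter> space \<mu>))"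
      by (auto simp: space_mu)
    also have "\<dots> \<in> sets \<mu>"
    proof (rule sets.finite_UN[OF finite_K])
      fix k assume "k \<in> carrier (K m)"
      then have "\<alpha> -` {\<theta> k} \<inter> space \<mu> \<in> sets \<mu>" by (intro measurable_sets[OF \<alpha>]) (simp add: \<theta>)
      then show "{x \<in> carrier H. q m x \<in> {k}} - (\<alpha> -` {\<theta> k} \<inter> space \<mu>) \<in> sets \<mu>"
        by (rule sets.Diff[OF q_cylinder_sets])
    qed
    finally show ?thesis .
  qed
  have Ef: "?Ef f \<in> sets \<mu>" "measure \<mu> (?Ef f) = measure \<mu> ?E" if "f \<in> F" for f
  proof -
    have "act f -` ?E \<inter> space \<mu> \<in> sets \<mu>" by (rule measurable_sets[OF act_invariant(1)[OF fG[OF that]] E])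
    moreover have "act f -` ?E \<inter> space \<mu> = ?Ef f" by (auto simp: space_mu)
    ultimately show "?Ef f \<in> sets \<mu>" by simp
    show "measure \<mu> (?Ef f) = measure \<mu> ?E" by (rule act_invariant(2)[OF fG[OF that] E])
  qed
  let ?B = "\<Union>f\<in>F. ?Ef f"
  have B: "?B \<in> sets \<mu>" using Ef(1) by (intro sets.finite_UN F(1))
  have "measure \<mu> ?B \<le> (\<Sum>f\<in>F. measure \<mu> (?Ef f))"
    by (rule finite_measure_subadditive_finite[OF F(1)]) (use Ef(1) in blast)
  also have "\<dots> = real (card F) * measure \<mu> ?E" using Ef(2) by simp
  finally have mB: "measure \<mu> ?B \<le> \<epsilon> / 2" using close by simp
  have eqB: "\<alpha> (act f x) = \<theta> (q m (act f x))" if "x \<in> carrier H" "x \<notin> ?B" "f \<in> F" for x f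
    using that fG[OF that(3)] by auto
  have Z: "?Z \<in> sets \<mu>"
  proof -
    have "?Z = {x \<in> carrier H. pattern m F x \<in> Q}"
      by (rule Collect_cong) (simp add: pattern_def Q_def restrict_PiE_iff fG cong: conj_cong ball_cong)
    also have "\<dots> = (\<Union>r\<in>Q. {x \<in> carrier H. pattern m F x = r})" by blast
    also have "\<dots> = (\<Union>r\<in>Q. {x \<in> space \<mu>. \<forall>f\<in>F. q m (act f x) = r f})"
    proof (rule SUP_cong[OF refl])
      fix r assume "r \<in> Q"
      then have "pattern m F x = r \<longleftrightarrow> (\<forall>f\<in>F. q m (act f x) = r f)" for x
        by (auto simp: pattern_def Q_def PiE_iff intro: extensionalityI[of _ F])
      then show "{x \<in> carrier H. pattern m F x = r} = {x \<in> space \<mu>. \<forall>f\<in>F. q m (act f x) = r f}"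
        by (simp add: space_mu)
    qed
    also have "\<dots> \<in> sets \<mu>"
    proof (rule sets.finite_UN)
      have "finite (F \<rightarrow>\<^sub>E carrier (K m))" by (simp add: finite_PiE finite_K F)
      then show "finite Q" by (rule rev_finite_subset) (auto simp: Q_def)
      show "{x \<in> space \<mu>. \<forall>f\<in>F. q m (act f x) = r f} \<in> sets \<mu>" if "r \<in> Q" for r
        using that by (intro observable_orbit_cell[OF q_measurable F]) (simp add: Q_def)
    qed
    finally show ?thesis .
  qed
  have "measure \<mu> ?X \<le> measure \<mu> (?Z \<union> ?B)"
  proof (rule finite_measure_mono)
    show "?X \<subseteq> ?Z \<union> ?B"
    proof
      fix x assume x: "x \<in> ?X"
      then have xH: "x \<in> carrier H" by (simp add: space_mu)
      show "x \<in> ?Z \<union> ?B"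
      proof (cases "x \<in> ?B")
        case False
        have "\<theta> (q m (act f x)) = p f" if f: "f \<in> F" for f
        proof -
          have "\<alpha> (act f x) = p f" using x f by blast
          then show ?thesis using eqB[OF xH False f] by simp
        qed
        then show ?thesis using xH by blast
      qed blast
    qed
  qed (use Z B in blast)
  also have "\<dots> \<le> measure \<mu> ?Z + measure \<mu> ?B" by (rule measure_Un_le[OF Z B])
  finally have 2: "measure \<mu> ?X \<le> measure \<mu> ?Z + \<epsilon> / 2" using mB by simp
  have "measure \<mu> ?Z \<le> measure \<mu> (?X \<union> ?B)"
  proof (rule finite_measure_mono)
    show "?Z \<subseteq> ?X \<union> ?B"
    proof
      fix x assume x: "x \<in> ?Z"
      then have xH: "x \<in> carrier H" by simp
      show "x \<in> ?X \<union> ?B"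
      proof (cases "x \<in> ?B")
        case False
        have "\<alpha> (act f x) = p f" if f: "f \<in> F" for f
        proof -
          have "\<theta> (q m (act f x)) = p f" using x f by blast
          then show ?thesis using eqB[OF xH False f] by simp
        qed
        then show ?thesis using xH space_mu by blast
      qed blast
    qed
  qed (use X B in blast)
  also have "\<dots> \<le> measure \<mu> ?X + measure \<mu> ?B" by (rule measure_Un_le[OF X B])
  finally have 3: "measure \<mu> ?Z \<le> measure \<mu> ?X + \<epsilon> / 2" using mB by simp
  show "\<bar>measure \<mu> ?X - card {i \<in> D n. \<forall>f\<in>F. compose (D n) \<theta> a (\<sigma> n f i) = p f} / card (D n)\<bar> \<le> \<epsilon>"
    using 1 2 3 by linarith
qed

text \<open>The supremum over observables is bounded below by the choice \<open>\<beta> = q m\<close>.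
  Any refinement \<open>\<alpha>\<close> of \<open>q m\<close>, with \<open>q m = \<gamma> \<circ>
  \<alpha>\<close>, is approximated by \<open>\<theta> \<circ> q m'\<close> with \<open>\<gamma>
  \<circ> \<theta>\<close> equal to the projection from level \<open>m'\<close> to level
  \<open>m\<close>, so that microstates of \<open>q m'\<close> and the microstates of
  \<open>\<alpha>\<close> that they induce have the same image at level \<open>m\<close>. The
  factor two in the comparison with near models disappears in the growth rate.\<close>

lemma model_entropy_le_measured_entropy:
  assumes dense: "T closure_of (homoclinic_group G H T act) = topspace T"
  shows "model_entropy m \<le> measured_sofic_entropy G act \<mu> D \<sigma>"
proof -
  let ?L = "\<lambda>A \<alpha> \<gamma> \<epsilon> F. limsup (\<lambda>n. log_count (enat (card
                        ((\<lambda>a. compose (D n) \<gamma> a) ` microstates act \<mu> A \<alpha> F \<epsilon> (D n) (\<sigma> n))))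
                      / ereal (card (D n)))"
  let ?I = "INF (A, \<alpha>, \<gamma>)\<in>refinements \<mu> (carrier (K m)) (q m).
      INF \<epsilon>\<in>{0<..}. INF F\<in>finite_subsets (carrier G). ?L A \<alpha> \<gamma> \<epsilon> F"
  have main: "model_entropy m \<le> ?L A \<alpha> \<gamma> \<epsilon> F"
    if ref: "(A, \<alpha>, \<gamma>) \<in> refinements \<mu> (carrier (K m)) (q m)" and \<epsilon>: "\<epsilon> > 0"
      and F: "finite F" "F \<subseteq> carrier G" for A \<alpha> \<gamma> \<epsilon> F
  proof (rule ereal_le_epsilon2)
    fix c :: real assume c: "c > 0"
    have A: "finite A" and \<alpha>: "\<alpha> \<in> measurable \<mu> (count_space A)" and \<gamma>: "\<And>x. x \<in> carrier H \<Longrightarrow> q m x = \<gamma> (\<alpha> x)"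
      using ref by (auto simp: refinements_def finite_observables_def space_mu)
    have \<alpha>A: "\<alpha> x \<in> A" if "x \<in> carrier H" for x
      using measurable_space[OF \<alpha>] that by (simp add: space_mu)
    have cF: "real (card F) + 1 > 0" by (simp add: add_nonneg_pos)
    have cancel: "u * (v / u) = v" if "u > 0" for u v :: real using that by simp
    define d where "d = \<epsilon> / 2 / (real (card F) + 1)"
    have d: "d > 0" using \<epsilon> cF by (simp add: d_def)
    obtain m' \<theta> where m': "m \<le> m'"
      and \<theta>: "\<And>k. k \<in> carrier (K m') \<Longrightarrow> \<exists>x\<in>carrier H. q m' x = k \<and> \<theta> k = \<alpha> x"
      and close: "measure \<mu> {x \<in> carrier H. \<alpha> x \<noteq> \<theta> (q m' x)} < d"
      by (rule observable_approximable[OF A \<alpha> d, of m]) blast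
    have \<theta>A: "\<theta> k \<in> A" "\<gamma> (\<theta> k) = proj m' m k" if k: "k \<in> carrier (K m')" for k
    proof -
      from \<theta>[OF k] obtain x where x: "x \<in> carrier H" "q m' x = k" "\<theta> k = \<alpha> x" by blast
      then show "\<theta> k \<in> A" using \<alpha>A by simp
      show "\<gamma> (\<theta> k) = proj m' m k" using \<gamma>[OF x(1)] proj_q[OF m' x(1)] x by simp
    qed
    have "real (card F) * measure \<mu> {x \<in> carrier H. \<alpha> x \<noteq> \<theta> (q m' x)} \<le> (real (card F) + 1) * d"
      using close by (intro mult_mono) auto
    then have closeF: "real (card F) * measure \<mu> {x \<in> carrier H. \<alpha> x \<noteq> \<theta> (q m' x)} \<le> \<epsilon> / 2"
      unfolding d_def cancel[OF cF] .
    define P where "P = real (card (F \<rightarrow>\<^sub>E carrier (K m')))"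
    have P: "P + 1 > 0" by (simp add: P_def add_nonneg_pos)
    define \<eta> where "\<eta> = \<epsilon> / 2 / (P + 1)"
    have \<eta>: "\<eta> > 0" using \<epsilon> P by (simp add: \<eta>_def)
    have "P * \<eta> \<le> (P + 1) * \<eta>" using \<eta> by (intro mult_right_mono) auto
    also have "\<dots> = \<epsilon> / 2" unfolding \<eta>_def by (rule cancel[OF P])
    finally have P\<eta>: "real (card (F \<rightarrow>\<^sub>E carrier (K m'))) * \<eta> \<le> \<epsilon> / 2" by (simp add: P_def)
    have "model_entropy m \<le> model_growth m m' F (\<eta> / 4)" using \<eta> by (intro model_entropy_le m' F) simp
    also have "\<dots> \<le> ?L A \<alpha> \<gamma> \<epsilon> F + ereal c"
      unfolding model_growth_def
    proof (rule limsup_le_limsup_add)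
      show "eventually (\<lambda>n. log_count (enat (card (projected_models m m' F (\<eta> / 4) n))) / ereal (card (D n))
          \<le> log_count (enat (card ((\<lambda>a. compose (D n) \<gamma> a) ` microstates act \<mu> A \<alpha> F \<epsilon> (D n) (\<sigma> n))))
                      / ereal (card (D n)) + ereal c) sequentially"
        using projected_models_le_microstates[OF dense F \<eta> m'] eventually_D_large[of "ln 2 / c"] eventually_D_pos
      proof eventually_elim
        case (elim n)
        let ?M' = "microstates act \<mu> (carrier (K m')) (q m') F \<eta> (D n) (\<sigma> n)"
        let ?M = "microstates act \<mu> A \<alpha> F \<epsilon> (D n) (\<sigma> n)"
        have "(\<lambda>a. compose (D n) (proj m' m) a) ` ?M' \<subseteq> (\<lambda>a. compose (D n) \<gamma> a) ` ?M"
        proof (rule image_subsetI)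
          fix a assume a: "a \<in> ?M'"
          then have aK: "a \<in> D n \<rightarrow>\<^sub>E carrier (K m')" by (simp add: microstates_def)
          have "compose (D n) (proj m' m) a = compose (D n) \<gamma> (compose (D n) \<theta> a)"
            unfolding compose_def
            by (rule restrict_ext) (simp add: \<theta>A(2) PiE_mem[OF aK])
          moreover have "compose (D n) \<theta> a \<in> ?M"
            by (rule microstates_of_approximation[OF A \<alpha> F \<epsilon> \<theta>A(1) closeF \<eta> P\<eta> a])
          ultimately show "compose (D n) (proj m' m) a \<in> (\<lambda>a. compose (D n) \<gamma> a) ` ?M" by blast
        qed
        moreover have "finite ?M"
        proof -
          have "finite (D n \<rightarrow>\<^sub>E A)" by (simp add: finite_PiE A)
          then show ?thesis by (rule rev_finite_subset) (simp add: microstates_def subset_iff)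
        qed
        ultimately have "card ((\<lambda>a. compose (D n) (proj m' m) a) ` ?M') \<le> card ((\<lambda>a. compose (D n) \<gamma> a) ` ?M)"
          by (intro card_mono) auto
        then have "real (card (projected_models m m' F (\<eta> / 4) n)) \<le> 2 * real (card ((\<lambda>a. compose (D n) \<gamma> a) ` ?M))"
          using elim(1) by linarith
        also have "\<dots> \<le> exp (c * real (card (D n))) * real (card ((\<lambda>a. compose (D n) \<gamma> a) ` ?M))"
        proof (rule mult_right_mono)
          have "ln 2 \<le> c * real (card (D n))" using elim(2) c by (simp add: pos_divide_le_eq mult.commute)
          then have "exp (ln 2) \<le> exp (c * real (card (D n)))" by (simp only: exp_le_cancel_iff)
          then show "2 \<le> exp (c * real (card (D n)))" by simp
        qed simp
        finally show ?case by (intro log_count_per_site_le[OF elim(3)]) auto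
      qed
    qed
    finally show "model_entropy m \<le> ?L A \<alpha> \<gamma> \<epsilon> F + ereal c" .
  qed
  have "model_entropy m \<le> ?I"
    using main by (intro INF_greatest) (clarsimp intro!: INF_greatest simp: finite_subsets_def)
  also have "\<dots> \<le> measured_sofic_entropy G act \<mu> D \<sigma>"
    unfolding measured_sofic_entropy_def
    by (rule SUP_upper2[of "(carrier (K m), q m)"])
      (simp_all add: finite_observables_def finite_K q_measurable)
  finally show ?thesis .
qed

end

section \<open>Equality of the two entropies\<close>

theorem theorem8p2:
  fixes G :: "('g, 'a) monoid_scheme"
    and H :: "('h, 'b) monoid_scheme"
    and T :: "'h topology"
    and \<mu> :: "'h measure"
    and act :: "'g \<Rightarrow> 'h \<Rightarrow> 'h"
    and D :: "nat \<Rightarrow> 'd set"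
    and \<sigma> :: "nat \<Rightarrow> 'g \<Rightarrow> 'd \<Rightarrow> 'd"
    and \<rho> :: "'h \<Rightarrow> 'h \<Rightarrow> real"
  assumes "group G" and "countable (carrier G)"
    and "sofic_approximation G D \<sigma>"
    and "profinite_group H T"
    and "haar_prob_measure H T \<mu>"
    and "acts_by_continuous_automorphisms G H T act"
    and "T closure_of (homoclinic_group G H T act) = topspace T"
    and "continuous_pseudometric T \<rho>" and "generating_pseudometric G T act \<rho>"
  shows "measured_sofic_entropy G act \<mu> D \<sigma> = topological_sofic_entropy G T act \<rho> D \<sigma>"
proof -
  obtain K q where tower: "finite_quotient_tower H T K q"
    by (rule profinite_group_finite_quotient_tower[OF assms(4)])
  interpret sofic_profinite_action H T K q \<mu> G act D \<sigma>
    by (intro sofic_profinite_action.intro haar_quotient_tower.intro tower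
      haar_quotient_tower_axioms.intro sofic_profinite_action_axioms.intro assms(1,3,5,6))
  have "measured_sofic_entropy G act \<mu> D \<sigma> = (SUP m. model_entropy m)"
    by (intro antisym measured_entropy_le_model_entropy SUP_least model_entropy_le_measured_entropy assms(7))
  moreover have "topological_sofic_entropy G T act \<rho> D \<sigma> = (SUP m. model_entropy m)"
    by (intro antisym topological_entropy_le_model_entropy SUP_least
      model_entropy_le_topological_entropy assms(8,9))
  ultimately show ?thesis by simp
qed

end
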